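(* Let $k$ be a field with $\operatorname{char} k\ne2$, let $q\in k^\times$ be not a root of unity, let $C_0\neq 0$ be in the center of $U_q(\mathfrak{sl}_2)$, and let $A$ be the associated quantized symplectic oscillator algebra of rank $1$. Suppose $r=\pm q^n$ with $n\in\mathbb{Z}_{\ge0}$. Let $0=n_0<n_1<\dots<n_k\le n+1$ be all the integers $j$ with $0\le j\le n+1$ and $\alpha_{r,j+1}=0$, and put $t_i=q^{-n_i}r$. Then: (1) As a $U_q(\mathfrak{sl}_2)$-module, $Z(r)$ is the direct sum of the $U_q(\mathfrak{sl}_2)$-Verma modules $Z_C(q^{-i}r)$ for $0\le i<n_k$ and the $A$-Verma module $Z(t_k)$ (regarded as a submodule of $Z(r)$). (2) $Z(r)$ has the filtration by $A$-submodules $$Z(r)=Z(t_0)\supset W(t_0)\supset Z(t_1)\supset W(t_1)\supset\dots\supset W(t_{k-1})\supset Z(t_k)\supset W(t_k),$$ where the successive subquotients are, respectively, $$V(t_0),\ V((q^3t_1)^{-1}),\ V(t_1),\ V((q^3t_2)^{-1}),\ \dots,\ V(t_{k-1}),\ V((q^3t_k)^{-1}),\ V(t_k).$$ (3) If $Z(t_k)$ is not simple, then its unique maximal submodule is of the form $Z(t)$ for some $t=\pm q^{-N}$ with $N$ a positive integer. (4) The modules $V(t_i)$ are finite dimensional for $0\le i<k$.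
   Context: $U_q(\mathfrak{sl}_2)$ is the $k$-algebra generated by $E,F,K,K^{-1}$ with $KK^{-1}=K^{-1}K=1$, $KEK^{-1}=q^2E$, $KFK^{-1}=q^{-2}F$, $EF-FE=\frac{K-K^{-1}}{q-q^{-1}}$. For $C_0$ in its center, $A$ is the $k$-algebra generated by $E,F,K,K^{-1},X,Y$ with these relations together with $EX=qXE$, $EY=X+q^{-1}YE$, $FX=YK^{-1}+XF$, $FY=YF$, $KXK^{-1}=qX$, $KYK^{-1}=q^{-1}Y$, $qYX-XY=C_0$. The subalgebra generated by $E,F,K^{\pm1}$ is $U_q(\mathfrak{sl}_2)$. For $r\in k^\times$: $Z_C(r)$ is the Verma module of highest weight $r$ over $U_q(\mathfrak{sl}_2)$; $Z(r)=A/(AE+AX+A(K-r))$ is the Verma module over $A$; $W(r)$ is its unique maximal submodule and $V(r)=Z(r)/W(r)$ its simple quotient. The scalar $c_{0,r}$ is the one by which $C_0$ acts on $Z_C(r)$. Put $\{a\}=\frac{a-a^{-1}}{q-q^{-1}}$ for $a\in k^\times$ and $\alpha_{r,m}=\sum_{j=0}^{m-2}\{q^{1-j}r\}c_{0,q^{-j}r}$ for $m\ge1$ (so $\alpha_{r,1}=0$, the empty sum). Nonzero homomorphisms between $A$-Verma modules are injective and unique up to scalar, so $Z(t_i)$ is identified with its image in $Z(r)$ (that such embeddings exist is part of the statement), and likewise $W(t_i)\subset Z(t_i)\subset Z(r)$. (The integer $k\ge 0$ indexing the $n_i$ is unrelated to the field $k$.) *)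

theory Defs
  imports "HOL-Algebra.Module" "HOL-Algebra.QuotRing" "HOL-Library.Poly_Mapping"
begin

section \<open>Algebras given by generators and relations\<close>

text \<open>The free algebra on \<open>'g\<close> over a field \<open>'k\<close> is the monoid algebra of the free monoid, that is,
  the type of finitely supported functions from words to \<open>'k\<close> with the convolution product that
  \<open>Poly_Mapping\<close> provides for an arbitrary \<open>monoid_add\<close>. The monoid of words is
  written additively for this reason only.\<close>

datatype 'g word = Word "'g list"

fun word_append :: "'g word \<Rightarrow> 'g word \<Rightarrow> 'g word" where
  "word_append (Word u) (Word v) = Word (u @ v)"

instantiation word :: (type) monoid_add
begin

definition zero_word :: "'a word" where "zero_word = Word []"

definition plus_word :: "'a word \<Rightarrow> 'a word \<Rightarrow> 'a word" where "plus_word = word_append"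

instance
proof
  fix a b c :: "'a word"
  show "a + b + c = a + (b + c)"
    by (cases a; cases b; cases c) (simp add: plus_word_def)
  show "0 + a = a" by (cases a) (simp add: plus_word_def zero_word_def)
  show "a + 0 = a" by (cases a) (simp add: plus_word_def zero_word_def)
qed

end

type_synonym ('g, 'k) free_alg = "'g word \<Rightarrow>\<^sub>0 'k"

definition gen :: "'g \<Rightarrow> ('g, 'k::field) free_alg" where
  "gen g = Poly_Mapping.single (Word [g]) 1"

definition scal :: "'k \<Rightarrow> ('g, 'k::field) free_alg" where
  "scal c = Poly_Mapping.single 0 c"

definition free_map :: "('g \<Rightarrow> 'h) \<Rightarrow> ('g, 'k::field) free_alg \<Rightarrow> ('h, 'k) free_alg" where
  "free_map f p =
    (\<Sum>w\<in>Poly_Mapping.keys p. Poly_Mapping.single (map_word f w) (Poly_Mapping.lookup p w))"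

definition free_ring :: "('g, 'k::field) free_alg ring" where
  "free_ring = \<lparr>carrier = UNIV, monoid.mult = (*), one = 1, zero = 0, add = (+)\<rparr>"

definition rel_ideal :: "('g, 'k::field) free_alg set \<Rightarrow> ('g, 'k) free_alg set" where
  "rel_ideal S = genideal free_ring S"

definition presented :: "('g, 'k::field) free_alg set \<Rightarrow> ('g, 'k) free_alg set ring" where
  "presented S = free_ring Quot (rel_ideal S)"

definition cls :: "('g, 'k::field) free_alg set \<Rightarrow> ('g, 'k) free_alg \<Rightarrow> ('g, 'k) free_alg set" where
  "cls S p = rel_ideal S +>\<^bsub>free_ring\<^esub> p"

definition ring_center :: "('a, 'b) ring_scheme \<Rightarrow> 'a set" where
  "ring_center R = {z \<in> carrier R. \<forall>x\<in>carrier R. z \<otimes>\<^bsub>R\<^esub> x = x \<otimes>\<^bsub>R\<^esub> z}"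

section \<open>Left modules over noncommutative rings\<close>

text \<open>The locale \<open>module\<close> of HOL-Algebra assumes a commutative ring; its record type and the
  locale \<open>submodule\<close> do not, and are used here for left modules. The fields \<open>mult\<close>
  and \<open>one\<close>, which the record inherits from rings, carry no meaning for modules.\<close>

definition regular_module :: "('a, 'b) ring_scheme \<Rightarrow> ('a, 'a) module" where
  "regular_module R = \<lparr>carrier = carrier R, monoid.mult = monoid.mult R, one = one R,
     zero = zero R, add = add R, module.smult = monoid.mult R\<rparr>"

definition quotient_module :: "('a, 'v) module \<Rightarrow> 'v set \<Rightarrow> ('a, 'v set) module" where
  "quotient_module M N = \<lparr>carrier = a_rcosets\<^bsub>M\<^esub> N, monoid.mult = undefined, one = undefined,
     zero = N, add = set_add M, module.smult = (\<lambda>a C. \<Union>x\<in>C. N +>\<^bsub>M\<^esub> (a \<odot>\<^bsub>M\<^esub> x))\<rparr>"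

definition submod :: "('a, 'v) module \<Rightarrow> 'v set \<Rightarrow> ('a, 'v) module" where
  "submod M N = M\<lparr>carrier := N\<rparr>"

definition restrict_scalars :: "('b \<Rightarrow> 'a) \<Rightarrow> ('a, 'v) module \<Rightarrow> ('b, 'v) module" where
  "restrict_scalars f M = \<lparr>carrier = carrier M, monoid.mult = monoid.mult M, one = one M,
     zero = zero M, add = add M, module.smult = (\<lambda>b x. f b \<odot>\<^bsub>M\<^esub> x)\<rparr>"

definition lmod_hom :: "('a, 'c) ring_scheme \<Rightarrow> ('a, 'v) module \<Rightarrow> ('a, 'w) module \<Rightarrow> ('v \<Rightarrow> 'w) set" where
  "lmod_hom R M N = {f \<in> carrier M \<rightarrow> carrier N.
     (\<forall>x\<in>carrier M. \<forall>y\<in>carrier M. f (x \<oplus>\<^bsub>M\<^esub> y) = f x \<oplus>\<^bsub>N\<^esub> f y) \<and>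
     (\<forall>a\<in>carrier R. \<forall>x\<in>carrier M. f (a \<odot>\<^bsub>M\<^esub> x) = a \<odot>\<^bsub>N\<^esub> f x)}"

definition lmod_embedding :: "('a, 'c) ring_scheme \<Rightarrow> ('a, 'v) module \<Rightarrow> ('a, 'w) module \<Rightarrow> ('v \<Rightarrow> 'w) \<Rightarrow> bool" where
  "lmod_embedding R M N f \<longleftrightarrow> f \<in> lmod_hom R M N \<and> inj_on f (carrier M)"

definition lmod_iso :: "('a, 'c) ring_scheme \<Rightarrow> ('a, 'v) module \<Rightarrow> ('a, 'w) module \<Rightarrow> bool" where
  "lmod_iso R M N \<longleftrightarrow> (\<exists>f\<in>lmod_hom R M N. bij_betw f (carrier M) (carrier N))"

definition maximal_submodule :: "('a, 'c) ring_scheme \<Rightarrow> ('a, 'v) module \<Rightarrow> 'v set \<Rightarrow> bool" where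
  "maximal_submodule R M N \<longleftrightarrow> submodule N R M \<and> N \<noteq> carrier M \<and>
     (\<forall>N'. submodule N' R M \<and> N \<subseteq> N' \<and> N' \<noteq> carrier M \<longrightarrow> N' = N)"

definition simple_module :: "('a, 'c) ring_scheme \<Rightarrow> ('a, 'v) module \<Rightarrow> bool" where
  "simple_module R M \<longleftrightarrow> carrier M \<noteq> {\<zero>\<^bsub>M\<^esub>} \<and>
     (\<forall>N. submodule N R M \<longrightarrow> N = {\<zero>\<^bsub>M\<^esub>} \<or> N = carrier M)"

text \<open>\<open>I\<close> is meant to be finite, since \<open>finsum\<close> is.\<close>

definition internal_direct_sum ::
  "('a, 'c) ring_scheme \<Rightarrow> ('a, 'v) module \<Rightarrow> 'i set \<Rightarrow> ('i \<Rightarrow> 'v set) \<Rightarrow> bool" where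
  "internal_direct_sum R M I S \<longleftrightarrow> (\<forall>i\<in>I. submodule (S i) R M) \<and>
     (\<forall>v\<in>carrier M. \<exists>!x. x \<in> (\<Pi>\<^sub>E i\<in>I. S i) \<and> v = finsum M x I)"

definition finite_dimensional :: "('k::field, 'v) module \<Rightarrow> bool" where
  "finite_dimensional M \<longleftrightarrow> (\<exists>B. finite B \<and> B \<subseteq> carrier M \<and>
     (\<forall>v\<in>carrier M. \<exists>a. v = finsum M (\<lambda>b. a b \<odot>\<^bsub>M\<^esub> b) B))"

section \<open>The quantum group and the quantized symplectic oscillator algebra\<close>

text \<open>\<open>gKi\<close> is the generator inverse to \<open>gK\<close>.\<close>

datatype uq_gen = gE | gF | gK | gKi

datatype osc_gen = Uq uq_gen | gX | gY

text \<open>The relations of \<open>U\<^sub>q(sl\<^sub>2)\<close>, each written as an element to be killed, for generators placed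
  by \<open>u\<close> in an arbitrary free algebra.\<close>

definition uq_rels_at :: "(uq_gen \<Rightarrow> ('g, 'k::field) free_alg) \<Rightarrow> 'k \<Rightarrow> ('g, 'k) free_alg set" where
  "uq_rels_at u q = (let E = u gE; F = u gF; K = u gK; Ki = u gKi in
    {K * Ki - 1,
     Ki * K - 1,
     K * E * Ki - scal (q\<^sup>2) * E,
     K * F * Ki - scal (q powi (-2)) * F,
     E * F - F * E - scal (inverse (q - inverse q)) * (K - Ki)})"

definition uq_rels :: "'k::field \<Rightarrow> (uq_gen, 'k) free_alg set" where
  "uq_rels q = uq_rels_at gen q"

definition uq :: "'k::field \<Rightarrow> (uq_gen, 'k) free_alg set ring" where
  "uq q = presented (uq_rels q)"

text \<open>An element \<open>C\<^sub>0\<close> of \<open>uq q\<close> is a coset in the free algebra on \<open>uq_gen\<close>. The last line below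
  imposes \<open>qYX - XY = C\<^sub>0\<close> for every representative of it; modulo the other relations these
  relations all coincide.\<close>

definition osc_rels :: "'k::field \<Rightarrow> (uq_gen, 'k) free_alg set \<Rightarrow> (osc_gen, 'k) free_alg set" where
  "osc_rels q C0 = (let E = gen (Uq gE); F = gen (Uq gF); K = gen (Uq gK); Ki = gen (Uq gKi);
      X = gen gX; Y = gen gY in
    uq_rels_at (\<lambda>g. gen (Uq g)) q \<union>
    {E * X - scal q * X * E,
     E * Y - (X + scal (inverse q) * Y * E),
     F * X - (Y * Ki + X * F),
     F * Y - Y * F,
     K * X * Ki - scal q * X,
     K * Y * Ki - scal (inverse q) * Y} \<union>
    {scal q * Y * X - X * Y - free_map Uq c |c. c \<in> C0})"

definition osc :: "'k::field \<Rightarrow> (uq_gen, 'k) free_alg set \<Rightarrow> (osc_gen, 'k) free_alg set ring" where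
  "osc q C0 = presented (osc_rels q C0)"

text \<open>The canonical homomorphism from \<open>uq q\<close> to \<open>osc q C0\<close> (all classes in the union coincide).\<close>

definition uq_to_osc ::
  "'k::field \<Rightarrow> (uq_gen, 'k) free_alg set \<Rightarrow> (uq_gen, 'k) free_alg set \<Rightarrow> (osc_gen, 'k) free_alg set" where
  "uq_to_osc q C0 u = (\<Union>p\<in>u. cls (osc_rels q C0) (free_map Uq p))"

section \<open>Verma modules\<close>

definition uq_verma :: "'k::field \<Rightarrow> 'k \<Rightarrow>
    ((uq_gen, 'k) free_alg set, (uq_gen, 'k) free_alg set set) module" where
  "uq_verma q r = (let R = uq q; p = cls (uq_rels q) in
    quotient_module (regular_module R)
      {a \<otimes>\<^bsub>R\<^esub> p (gen gE) \<oplus>\<^bsub>R\<^esub> b \<otimes>\<^bsub>R\<^esub> p (gen gK - scal r) |a b.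
        a \<in> carrier R \<and> b \<in> carrier R})"

definition osc_verma :: "'k::field \<Rightarrow> (uq_gen, 'k) free_alg set \<Rightarrow> 'k \<Rightarrow>
    ((osc_gen, 'k) free_alg set, (osc_gen, 'k) free_alg set set) module" where
  "osc_verma q C0 r = (let R = osc q C0; p = cls (osc_rels q C0) in
    quotient_module (regular_module R)
      {a \<otimes>\<^bsub>R\<^esub> p (gen (Uq gE)) \<oplus>\<^bsub>R\<^esub> b \<otimes>\<^bsub>R\<^esub> p (gen gX) \<oplus>\<^bsub>R\<^esub> c \<otimes>\<^bsub>R\<^esub> p (gen (Uq gK) - scal r) |a b c.
        a \<in> carrier R \<and> b \<in> carrier R \<and> c \<in> carrier R})"

definition osc_verma_max :: "'k::field \<Rightarrow> (uq_gen, 'k) free_alg set \<Rightarrow> 'k \<Rightarrow>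
    (osc_gen, 'k) free_alg set set set" where
  "osc_verma_max q C0 r = (THE N. maximal_submodule (osc q C0) (osc_verma q C0 r) N)"

definition osc_simple :: "'k::field \<Rightarrow> (uq_gen, 'k) free_alg set \<Rightarrow> 'k \<Rightarrow>
    ((osc_gen, 'k) free_alg set, (osc_gen, 'k) free_alg set set set) module" where
  "osc_simple q C0 r = quotient_module (osc_verma q C0 r) (osc_verma_max q C0 r)"

definition central_scalar :: "'k::field \<Rightarrow> (uq_gen, 'k) free_alg set \<Rightarrow> 'k \<Rightarrow> 'k" where
  "central_scalar q C0 r = (THE c. \<forall>v\<in>carrier (uq_verma q r).
     C0 \<odot>\<^bsub>uq_verma q r\<^esub> v = cls (uq_rels q) (scal c) \<odot>\<^bsub>uq_verma q r\<^esub> v)"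

definition qbrace :: "'k::field \<Rightarrow> 'k \<Rightarrow> 'k" where
  "qbrace q a = (a - inverse a) / (q - inverse q)"

definition alpha :: "'k::field \<Rightarrow> (uq_gen, 'k) free_alg set \<Rightarrow> 'k \<Rightarrow> nat \<Rightarrow> 'k" where
  "alpha q C0 r m =
    (\<Sum>j<m - 1. qbrace q (q powi (1 - int j) * r) * central_scalar q C0 (q powi (- int j) * r))"

end

theory Submission
  imports Defs "HOL-Computational_Algebra.Polynomial"
begin

text \<open>The Verma module \<open>Z(s)\<close> is realised on the polynomial ring \<open>k[F][Y]\<close>, on which \<open>F\<close> and \<open>Y\<close> act by
  multiplication and \<open>1\<close> is the highest weight vector. This works for every central \<open>C\<^sub>0\<close>, without any
  knowledge of the center: the relations \<open>EY = X + q\<^sup>-\<^sup>1YE\<close> and \<open>XY = qYX - C\<^sub>0\<close> dictate \<open>E(Y\<^sup>j\<^sup>+\<^sup>1)\<close> and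
  \<open>X(Y\<^sup>j\<^sup>+\<^sup>1)\<close> in terms of lower powers, and \<open>C\<^sub>0\<close>, a polynomial in \<open>E\<close>, \<open>F\<close>, \<open>K\<close>, acts on \<open>Y\<^sup>j\<close> through
  \<open>E(Y\<^sup>i)\<close> with \<open>i \<le> j\<close> only. Each relation is compatible with multiplication by \<open>F\<close>, so it has to be
  verified on powers of \<open>Y\<close> only, by induction (\<open>FX\<close>, \<open>KX\<close>, \<open>EY\<close>, \<open>YX\<close>, \<open>EX\<close>). By \<open>osc_universal\<close>
  this module has the universal property of \<open>Z(s)\<close>; homomorphisms \<open>Z(s') \<rightarrow> Z(s)\<close> become multiplications
  \<open>x \<mapsto> xw\<close> by singular vectors \<open>w\<close> and are injective for \<open>w \<noteq> 0\<close> because \<open>k[F,Y]\<close> is a domain. A Verma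
  submodule is a principal ideal. The maximal submodule is
  the largest stable subspace on which the constant coefficient vanishes.

  Let \<open>qs = \<plusminus>q\<^sup>M\<close>. For \<open>j \<le> M\<close> there are vectors \<open>v\<^sub>j\<close>, monic of degree \<open>j\<close> in \<open>Y\<close> and killed by \<open>E\<close>, with
  \<open>v\<^sub>j\<^sub>+\<^sub>1 = Yv\<^sub>j - b\<^sub>jFv\<^sub>j\<^sub>-\<^sub>1\<close> and \<open>Xv\<^sub>j = a\<^sub>jv\<^sub>j\<^sub>-\<^sub>1\<close> (\<open>vvec_EX\<close>), where \<open>a\<^sub>j\<close>, and \<open>b\<^sub>j\<close> if \<open>j < M\<close>, is a nonzero
  multiple of \<open>\<alpha>\<^sub>s\<^sub>,\<^sub>j\<^sub>+\<^sub>1\<close>. Hence \<open>v\<^sub>j\<close> is singular exactly when \<open>\<alpha>\<^sub>s\<^sub>,\<^sub>j\<^sub>+\<^sub>1 = 0\<close>, and every singular vector of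
  its weight is a multiple of \<open>v\<^sub>j\<close> (\<open>singular_unique\<close>). Division with remainder by the monic \<open>v\<^sub>d\<close>, for
  \<open>d = n\<^sub>k\<close>, gives the direct sum of part (1). The only other highest weight vectors for the quantum group in
  degrees up to \<open>M\<close> are \<open>u\<^sub>j = F\<^sup>M\<^sup>-\<^sup>jv\<^sub>j\<close> for \<open>j < M\<close>; here \<open>X\<close> maps \<open>u\<^sub>j\<close> to a nonzero multiple of \<open>u\<^sub>j\<^sub>+\<^sub>1\<close>, and
  \<open>Yu\<^sub>j = Fu\<^sub>j\<^sub>+\<^sub>1 + b\<^sub>ju\<^sub>j\<^sub>-\<^sub>1\<close>.

  Let \<open>d \<le> M\<close> be the first positive zero, so that \<open>v\<^sub>d\<close> generates the next Verma module. A submodule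
  containing some \<open>v\<^sub>j\<close> with \<open>j < d\<close> contains \<open>1\<close>, since \<open>a\<^sub>j, \<dots>, a\<^sub>1 \<noteq> 0\<close>. Therefore the maximal submodule
  consists of \<open>\<Sum>\<^sub>j\<^sub><\<^sub>d k[F]u\<^sub>j\<close> and the multiples of \<open>v\<^sub>d\<close> (\<open>max_submod_eq_gap_submod\<close>), and the simple quotient
  is spanned by the finitely many \<open>F\<^sup>iv\<^sub>j\<close> with \<open>j < d\<close> and \<open>i < M - j\<close>. Modulo the multiples of \<open>v\<^sub>d\<close>, the
  maximal submodule is generated by \<open>u\<^sub>d\<^sub>-\<^sub>1\<close>, because \<open>Y\<close> leads from \<open>u\<^sub>d\<^sub>-\<^sub>1\<close> to all \<open>u\<^sub>j\<close>; and it is simple, because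
  a nonzero submodule contains some \<open>u\<^sub>j\<close> and \<open>X\<close> leads from there to \<open>u\<^sub>d\<^sub>-\<^sub>1\<close>. So it is the simple module whose
  highest weight is that of \<open>u\<^sub>d\<^sub>-\<^sub>1\<close>, namely \<open>(q\<^sup>3\<cdot>q\<^sup>-\<^sup>ds)\<^sup>-\<^sup>1\<close>. Parts (2) and (4) follow by applying this to
  each \<open>Z(t\<^sub>i)\<close> with \<open>i < k\<close>.

  If no positive \<open>j \<le> M\<close> is a zero, a proper submodule contains no \<open>v\<^sub>j\<close>, hence no \<open>u\<^sub>j\<close>, hence no nonzero element of
  degree at most \<open>M\<close> in \<open>Y\<close>. In an element of smallest degree \<open>D > M\<close>, repeated application of \<open>E\<close> lowers
  the leading coefficient to a constant without killing it. So the submodule contains a monic element, which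
  generates it and is singular (\<open>submodule_is_Verma\<close>); this is part (3).\<close>

section \<open>Evaluating noncommutative polynomials at operators\<close>

fun word_op :: "('g \<Rightarrow> 'v \<Rightarrow> 'v) \<Rightarrow> 'g word \<Rightarrow> 'v \<Rightarrow> 'v" where
  "word_op T (Word u) x = foldr T u x"

text \<open>The word \<open>g\<^sub>1\<cdots>g\<^sub>n\<close> becomes the composition \<open>T g\<^sub>1 \<circ> \<cdots> \<circ> T g\<^sub>n\<close>, so that for linear operators
  \<open>ev sc T\<close> is the representation of the free algebra given by \<open>T\<close>.\<close>
definition ev :: "('k::field \<Rightarrow> 'v::ab_group_add \<Rightarrow> 'v) \<Rightarrow> ('g \<Rightarrow> 'v \<Rightarrow> 'v) \<Rightarrow>
    ('g, 'k) free_alg \<Rightarrow> 'v \<Rightarrow> 'v" where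
  "ev sc T p x = (\<Sum>w\<in>Poly_Mapping.keys p. sc (Poly_Mapping.lookup p w) (word_op T w x))"

locale operators = vector_space sc
  for sc :: "'k::field \<Rightarrow> 'v::ab_group_add \<Rightarrow> 'v" +
  fixes T :: "'g \<Rightarrow> 'v \<Rightarrow> 'v"
  assumes T_add: "T g (x + y) = T g x + T g y"
    and T_scale: "T g (sc c x) = sc c (T g x)"

definition stable :: "('k::field \<Rightarrow> 'v::ab_group_add \<Rightarrow> 'v) \<Rightarrow> ('g \<Rightarrow> 'v \<Rightarrow> 'v) \<Rightarrow> 'v set \<Rightarrow> bool" where
  "stable sc T B \<longleftrightarrow> 0 \<in> B \<and> (\<forall>x\<in>B. \<forall>y\<in>B. x + y \<in> B) \<and> (\<forall>c. \<forall>x\<in>B. sc c x \<in> B) \<and>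
     (\<forall>g. \<forall>x\<in>B. T g x \<in> B)"

lemma stableI:
  assumes "0 \<in> B" "\<And>x y. x \<in> B \<Longrightarrow> y \<in> B \<Longrightarrow> x + y \<in> B" "\<And>c x. x \<in> B \<Longrightarrow> sc c x \<in> B"
    "\<And>g x. x \<in> B \<Longrightarrow> T g x \<in> B"
  shows "stable sc T B"
  using assms unfolding stable_def by blast

lemma stableD:
  assumes "stable sc T B"
  shows "0 \<in> B" "x \<in> B \<Longrightarrow> y \<in> B \<Longrightarrow> x + y \<in> B" "x \<in> B \<Longrightarrow> sc c x \<in> B" "x \<in> B \<Longrightarrow> T g x \<in> B"
  using assms unfolding stable_def by blast+

lemma stable_UNIV: "stable sc T UNIV"
  by (simp add: stable_def)

lemma free_alg_sum_single:
  "p = (\<Sum>w\<in>Poly_Mapping.keys p. Poly_Mapping.single w (Poly_Mapping.lookup p w))"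
proof (rule poly_mapping_eqI)
  fix u
  have "Poly_Mapping.lookup (\<Sum>w\<in>Poly_Mapping.keys p. Poly_Mapping.single w (Poly_Mapping.lookup p w)) u
     = (\<Sum>w\<in>Poly_Mapping.keys p. if w = u then Poly_Mapping.lookup p w else 0)"
    by (simp add: lookup_sum lookup_single when_def)
  also have "\<dots> = Poly_Mapping.lookup p u"
    by (simp add: in_keys_iff)
  finally show "Poly_Mapping.lookup p u =
    Poly_Mapping.lookup (\<Sum>w\<in>Poly_Mapping.keys p. Poly_Mapping.single w (Poly_Mapping.lookup p w)) u" ..
qed

lemma sum_induct_closed:
  assumes "finite A" "P 0" "\<And>a b. P a \<Longrightarrow> P b \<Longrightarrow> P (a + b)" "\<And>i. i \<in> A \<Longrightarrow> P (f i)"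
  shows "P (sum f A)"
  using assms(1,4) by (induction A rule: finite_induct) (auto intro: assms)

lemma single_Word_Cons:
  "Poly_Mapping.single (Word (g # u)) c = gen g * (Poly_Mapping.single (Word u) (c::'k::field))"
  by (simp add: gen_def mult_single plus_word_def)

lemma single_Word_Nil: "Poly_Mapping.single (Word []) c = scal (c::'k::field) * 1"
  by (simp add: scal_def zero_word_def)

text \<open>Words grow on the left, which is the side on which operators act.\<close>
lemma free_alg_induct [case_names one gen scal add]:
  fixes p :: "('g, 'k::field) free_alg"
  assumes one: "P 1" and gen: "\<And>g p. P p \<Longrightarrow> P (gen g * p)"
    and scal: "\<And>c p. P p \<Longrightarrow> P (scal c * p)" and add: "\<And>p p'. P p \<Longrightarrow> P p' \<Longrightarrow> P (p + p')"
  shows "P p"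
proof -
  have zero: "P 0"
    using scal[OF one, of 0] by (simp add: scal_def)
  have single: "P (Poly_Mapping.single (Word u) c)" for u c
  proof (induction u)
    case Nil
    show ?case unfolding single_Word_Nil by (rule scal[OF one])
  next
    case (Cons g u)
    then show ?case unfolding single_Word_Cons by (rule gen)
  qed
  have "P (Poly_Mapping.single w c)" for w c
    by (cases w) (simp add: single)
  then show ?thesis
    by (subst free_alg_sum_single) (rule sum_induct_closed[where P=P], auto intro: add zero)
qed

lemma scal_simps: "scal (c + d) = scal c + scal d" "scal (c * d) = scal c * scal d" "scal 1 = 1"
  by (simp_all add: scal_def single_add mult_single)

lemma scal_mult_commute: "p * scal c = scal c * (p :: ('g, 'k::field) free_alg)"
proof (induction p rule: free_alg_induct)
  case (scal d p)
  have "scal d * scal c = scal c * (scal d :: ('g, 'k) free_alg)"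
    unfolding scal_simps(2)[symmetric] by (simp add: mult.commute)
  then have "scal d * (p * scal c) = scal c * (scal d * p)"
    unfolding scal by (simp flip: mult.assoc)
  then show ?case by (simp add: mult.assoc)
next
  case (gen g p)
  have "gen g * scal c = scal c * (gen g :: ('g, 'k) free_alg)"
    by (simp add: gen_def scal_def mult_single)
  then have "gen g * (p * scal c) = scal c * (gen g * p)"
    unfolding gen by (simp flip: mult.assoc)
  then show ?case by (simp add: mult.assoc)
qed (auto simp: distrib_left distrib_right)

context operators
begin

abbreviation "eval \<equiv> ev sc T"

lemma T_zero: "T g 0 = 0"
  using T_add[of g 0 0] by simp

lemma T_uminus: "T g (- x) = - T g x"
  using T_add[of g x "- x"] T_zero[of g] by (simp add: eq_neg_iff_add_eq_0 add.commute)

lemma T_diff: "T g (x - y) = T g x - T g y"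
  using T_add[of g x "- y"] by (simp add: T_uminus)

lemma T_sum: "T g (sum f A) = (\<Sum>i\<in>A. T g (f i))"
  by (induction A rule: infinite_finite_induct) (auto simp: T_zero T_add)

lemma word_op_add: "word_op T w (x + y) = word_op T w x + word_op T w y"
proof (cases w)
  case (Word u)
  have "foldr T u (x + y) = foldr T u x + foldr T u y"
    by (induction u) (auto simp: T_add)
  then show ?thesis using Word by simp
qed

lemma word_op_scale: "word_op T w (sc c x) = sc c (word_op T w x)"
proof (cases w)
  case (Word u)
  have "foldr T u (sc c x) = sc c (foldr T u x)"
    by (induction u) (auto simp: T_scale)
  then show ?thesis using Word by simp
qed

lemma ev_superset:
  assumes "finite A" "Poly_Mapping.keys p \<subseteq> A"
  shows "eval p x = (\<Sum>w\<in>A. sc (Poly_Mapping.lookup p w) (word_op T w x))"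
  unfolding ev_def using assms
  by (intro sum.mono_neutral_left) (auto simp: in_keys_iff)

lemma ev_plus: "eval (p + p') x = eval p x + eval p' x"
proof -
  let ?A = "Poly_Mapping.keys p \<union> Poly_Mapping.keys p'"
  have "Poly_Mapping.keys (p + p') \<subseteq> ?A" by (rule Poly_Mapping.keys_add)
  then show ?thesis
    by (simp add: ev_superset[of ?A] lookup_add scale_left_distrib sum.distrib)
qed

lemma ev_zero: "eval 0 x = 0"
  by (simp add: ev_def)

lemma ev_uminus: "eval (- p) x = - eval p x"
  using ev_plus[of p "- p" x] by (simp add: ev_zero eq_neg_iff_add_eq_0 add.commute)

lemma ev_minus: "eval (p - p') x = eval p x - eval p' x"
  using ev_plus[of p "- p'" x] by (simp add: ev_uminus)

lemma ev_single: "eval (Poly_Mapping.single w c) x = sc c (word_op T w x)"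
  by (simp add: ev_def)

lemma ev_one: "eval 1 x = x"
  by (simp add: ev_single zero_word_def flip: single_one)

lemma ev_add_arg: "eval p (x + y) = eval p x + eval p y"
  by (simp add: ev_def word_op_add scale_right_distrib sum.distrib)

lemma ev_scale_arg: "eval p (sc c x) = sc c (eval p x)"
  by (simp add: ev_def word_op_scale scale_sum_right mult.commute)

lemma ev_zero_arg: "eval p 0 = 0"
  using ev_add_arg[of p 0 0] by simp

lemma ev_diff_arg: "eval p (x - y) = eval p x - eval p y"
  using ev_add_arg[of p "x - y" y] by (simp add: algebra_simps)

lemma ev_gen: "eval (gen g) x = T g x"
  by (simp add: gen_def ev_single)

lemma ev_scal: "eval (scal c) x = sc c x"
  by (simp add: scal_def ev_single zero_word_def)

lemma ev_sum: "eval (sum f A) x = (\<Sum>i\<in>A. eval (f i) x)"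
  by (induction A rule: infinite_finite_induct) (auto simp: ev_plus ev_zero)

lemma ev_gen_mult: "eval (gen g * p) x = T g (eval p x)"
proof -
  have single: "eval (gen g * Poly_Mapping.single w c) x = T g (eval (Poly_Mapping.single w c) x)" for w c
    by (cases w) (simp add: gen_def mult_single plus_word_def ev_single T_scale)
  have "eval (gen g * p) x =
    (\<Sum>w\<in>Poly_Mapping.keys p. eval (gen g * Poly_Mapping.single w (Poly_Mapping.lookup p w)) x)"
    by (subst free_alg_sum_single[of p]) (simp add: sum_distrib_left ev_sum)
  also have "\<dots> = T g (eval p x)"
    unfolding single T_sum[symmetric] ev_sum[symmetric] free_alg_sum_single[symmetric] ..
  finally show ?thesis .
qed

lemma ev_scal_mult: "eval (scal c * p) x = sc c (eval p x)"
proof -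
  have single: "eval (scal c * Poly_Mapping.single w c') x = sc c (eval (Poly_Mapping.single w c') x)" for w c'
    by (simp add: scal_def mult_single ev_single)
  have "eval (scal c * p) x =
    (\<Sum>w\<in>Poly_Mapping.keys p. eval (scal c * Poly_Mapping.single w (Poly_Mapping.lookup p w)) x)"
    by (subst free_alg_sum_single[of p]) (simp add: sum_distrib_left ev_sum)
  also have "\<dots> = sc c (eval p x)"
    unfolding single scale_sum_right[symmetric] ev_sum[symmetric] free_alg_sum_single[symmetric] ..
  finally show ?thesis .
qed

text \<open>Multiplicativity rests on the two preceding cases of a generator and of a scalar as left factor, which
  follow from linearity of the operators; the induction over the left factor does the rest.\<close>
lemma ev_mult: "eval (p * p') x = eval p (eval p' x)"
  by (induction p rule: free_alg_induct)
    (auto simp: ev_one ev_gen_mult ev_scal_mult ev_plus distrib_right mult.assoc)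

lemmas ev_simps = ev_plus ev_minus ev_uminus ev_zero ev_one ev_gen ev_scal ev_mult

lemma stable_uminus: "stable sc T B \<Longrightarrow> x \<in> B \<Longrightarrow> - x \<in> B"
  using stableD(3)[of sc T B x "-1"] by simp

lemma stable_minus: "stable sc T B \<Longrightarrow> x \<in> B \<Longrightarrow> y \<in> B \<Longrightarrow> x - y \<in> B"
  using stableD(2)[of sc T B x "- y"] stable_uminus by simp

lemma stable_singleton_0: "stable sc T {0}"
  by (auto simp: stable_def T_zero)

lemma ev_stable: "stable sc T B \<Longrightarrow> x \<in> B \<Longrightarrow> eval p x \<in> B"
  by (induction p rule: free_alg_induct)
    (auto simp: ev_one ev_gen_mult ev_scal_mult ev_plus intro: stableD)

end

text \<open>Congruence modulo \<open>D\<close> is preserved by the operators, so the error terms of the successive generators of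
  a word add up within \<open>D\<close>. Working modulo \<open>D\<close>, with \<open>\<iota>\<close> required to be linear on \<open>B\<close> only, makes the statement
  applicable to subquotients.\<close>
lemma ev_intertwine:
  assumes ops: "operators sc T" "operators sc' T'"
    and st: "stable sc T B" "stable sc' T' D"
    and add: "\<And>x y. x \<in> B \<Longrightarrow> y \<in> B \<Longrightarrow> \<iota> (x + y) = \<iota> x + \<iota> y"
    and scale: "\<And>c x. x \<in> B \<Longrightarrow> \<iota> (sc c x) = sc' c (\<iota> x)"
    and gen: "\<And>g x. x \<in> B \<Longrightarrow> \<iota> (T g x) - T' g (\<iota> x) \<in> D"
    and x: "x \<in> B"
  shows "\<iota> (ev sc T p x) - ev sc' T' p (\<iota> x) \<in> D"
proof -
  interpret A: operators sc T by fact
  interpret C: operators sc' T' by fact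
  show ?thesis
  proof (induction p rule: free_alg_induct)
    case one
    show ?case using stableD(1)[OF st(2)] by (simp add: A.ev_one C.ev_one)
  next
    case (gen g p)
    have "T' g (\<iota> (ev sc T p x) - ev sc' T' p (\<iota> x)) \<in> D"
      by (rule stableD(4)[OF st(2) gen])
    moreover have "\<iota> (T g (ev sc T p x)) - T' g (\<iota> (ev sc T p x)) \<in> D"
      by (rule assms(7)) (rule A.ev_stable[OF st(1) x])
    ultimately have "\<iota> (T g (ev sc T p x)) - T' g (\<iota> (ev sc T p x)) + T' g (\<iota> (ev sc T p x) - ev sc' T' p (\<iota> x)) \<in> D"
      by (intro stableD(2)[OF st(2)])
    then show ?case by (simp add: A.ev_gen_mult C.ev_gen_mult C.T_diff)
  next
    case (scal c p)
    then have "sc' c (\<iota> (ev sc T p x) - ev sc' T' p (\<iota> x)) \<in> D"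
      by (rule stableD(3)[OF st(2)])
    then show ?case
      using A.ev_stable[OF st(1) x]
      by (simp add: A.ev_scal_mult C.ev_scal_mult scale C.scale_right_diff_distrib)
  next
    case (add p p')
    then have "(\<iota> (ev sc T p x) - ev sc' T' p (\<iota> x)) + (\<iota> (ev sc T p' x) - ev sc' T' p' (\<iota> x)) \<in> D"
      by (rule stableD(2)[OF st(2)])
    then show ?case
      using A.ev_stable[OF st(1) x]
      by (simp add: A.ev_plus C.ev_plus assms(5) algebra_simps)
  qed
qed

text \<open>With \<open>f\<close> the identity, \<open>free_op f\<close> is the left regular representation of the free algebra. A general
  \<open>f\<close> turns the free algebra on the target of \<open>f\<close> into a module over the one on the source, which exhibits
  \<open>free_map f\<close> as an evaluation (\<open>free_map_eq_ev\<close>) and so as a ring homomorphism.\<close>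
definition free_scale :: "'k::field \<Rightarrow> ('g, 'k) free_alg \<Rightarrow> ('g, 'k) free_alg" where
  "free_scale c x = scal c * x"

definition free_op :: "('h \<Rightarrow> 'g) \<Rightarrow> 'h \<Rightarrow> ('g, 'k::field) free_alg \<Rightarrow> ('g, 'k) free_alg" where
  "free_op f h x = gen (f h) * x"

lemma vector_space_free_scale: "vector_space (free_scale :: 'k::field \<Rightarrow> ('g, 'k) free_alg \<Rightarrow> _)"
  by unfold_locales (auto simp: free_scale_def scal_simps distrib_left distrib_right mult.assoc)

lemma operators_free: "operators free_scale (free_op f)"
proof -
  interpret vector_space free_scale by (rule vector_space_free_scale)
  show ?thesis
  proof
    show "free_op f g (free_scale c x) = free_scale c (free_op f g x)" for g c x
      unfolding free_op_def free_scale_def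
      using scal_mult_commute[of "gen (f g)" c] by (simp flip: mult.assoc)
  qed (simp add: free_op_def distrib_left)
qed

lemma free_op_mult: "free_op f h x * y = free_op f h (x * y)" "free_scale c x * y = free_scale c (x * y)"
  by (simp_all add: free_op_def free_scale_def mult.assoc)

lemma ev_free_mult: "ev free_scale (free_op f) p (x * y) = ev free_scale (free_op f) p x * y"
proof -
  interpret operators free_scale "free_op f" by (rule operators_free)
  show ?thesis
    by (induction p rule: free_alg_induct)
      (simp_all add: ev_one ev_gen_mult ev_scal_mult ev_plus free_op_mult distrib_right)
qed

lemma ev_free_self: "ev free_scale (free_op (\<lambda>g. g)) p x = p * x"
proof -
  interpret operators free_scale "free_op (\<lambda>g. g)" by (rule operators_free)
  show ?thesis
    by (induction p rule: free_alg_induct)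
      (simp_all add: ev_one ev_gen_mult ev_scal_mult ev_plus distrib_right,
        simp_all add: free_op_def free_scale_def mult.assoc)
qed

lemma word_op_free: "word_op (free_op f) w 1 = (Poly_Mapping.single (map_word f w) 1 :: ('g, 'k::field) free_alg)"
proof (cases w)
  case (Word u)
  have "foldr (free_op f) u 1 = (Poly_Mapping.single (Word (map f u)) 1 :: ('g, 'k) free_alg)"
    by (induction u) (auto simp: free_op_def single_Word_Cons simp flip: zero_word_def)
  then show ?thesis using Word by simp
qed

lemma free_map_eq_ev: "free_map f p = ev free_scale (free_op f) p 1"
  by (simp add: free_map_def ev_def word_op_free free_scale_def scal_def mult_single)

lemma free_map_mult: "free_map f (p * p') = free_map f p * free_map f p'"
proof -
  interpret operators free_scale "free_op f" by (rule operators_free)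
  show ?thesis
    by (simp add: free_map_eq_ev ev_mult flip: ev_free_mult)
qed

lemma free_map_simps:
  "free_map f (p + p') = free_map f p + free_map f p'"
  "free_map f (p - p') = free_map f p - free_map f p'"
  "free_map f 1 = 1" "free_map f 0 = 0" "free_map f (gen g) = gen (f g)" "free_map f (scal c) = scal c"
proof -
  interpret operators free_scale "free_op f" by (rule operators_free)
  show "free_map f (p + p') = free_map f p + free_map f p'"
    "free_map f (p - p') = free_map f p - free_map f p'"
    "free_map f 1 = 1" "free_map f 0 = 0" "free_map f (gen g) = gen (f g)" "free_map f (scal c) = scal c"
    by (simp_all add: free_map_eq_ev ev_simps free_op_def free_scale_def)
qed

lemma ev_free_map: 
  assumes "operators sc T"
  shows "ev sc T (free_map f p) x = ev sc (\<lambda>h. T (f h)) p x"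
proof -
  interpret A: operators sc T by fact
  interpret C: operators sc "\<lambda>h. T (f h)"
    by unfold_locales (auto simp: A.T_add A.T_scale)
  show ?thesis
    by (induction p rule: free_alg_induct)
      (auto simp: free_map_mult free_map_simps A.ev_simps C.ev_simps)
qed

section \<open>Presented algebras\<close>

lemma ring_free_ring: "ring (free_ring :: ('g, 'k::field) free_alg ring)"
proof (rule ringI)
  show "abelian_group (free_ring :: ('g, 'k::field) free_alg ring)"
  proof (rule abelian_groupI)
    fix x :: "('g, 'k) free_alg" 
    show "\<exists>y\<in>carrier free_ring. y \<oplus>\<^bsub>free_ring\<^esub> x = \<zero>\<^bsub>free_ring\<^esub>"
      by (auto simp: free_ring_def intro: exI[of _ "- x"])
  qed (auto simp: free_ring_def algebra_simps)
  show "monoid (free_ring :: ('g, 'k::field) free_alg ring)"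
    by unfold_locales (auto simp: free_ring_def algebra_simps)
qed (auto simp: free_ring_def algebra_simps)

lemma ideal_rel_ideal: "ideal (rel_ideal S) free_ring"
  unfolding rel_ideal_def by (rule ring.genideal_ideal[OF ring_free_ring]) (simp add: free_ring_def)

lemma rel_ideal_props:
  shows "0 \<in> rel_ideal S" "x \<in> rel_ideal S \<Longrightarrow> y \<in> rel_ideal S \<Longrightarrow> x + y \<in> rel_ideal S"
    "x \<in> rel_ideal S \<Longrightarrow> z * x \<in> rel_ideal S" "x \<in> rel_ideal S \<Longrightarrow> x * z \<in> rel_ideal S"
    "x \<in> S \<Longrightarrow> x \<in> rel_ideal S"
proof -
  interpret ideal "rel_ideal S" free_ring by (rule ideal_rel_ideal)
  have A: "additive_subgroup (rel_ideal S) free_ring" ..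
  show "0 \<in> rel_ideal S" using additive_subgroup.zero_closed[OF A] by (simp add: free_ring_def)
  show "x + y \<in> rel_ideal S" if "x \<in> rel_ideal S" "y \<in> rel_ideal S" 
    using additive_subgroup.a_closed[OF A that] by (simp add: free_ring_def)
  show "z * x \<in> rel_ideal S" if "x \<in> rel_ideal S"
    using I_l_closed[OF that, of z] by (simp add: free_ring_def)
  show "x * z \<in> rel_ideal S" if "x \<in> rel_ideal S"
    using I_r_closed[OF that, of z] by (simp add: free_ring_def)
  show "x \<in> rel_ideal S" if "x \<in> S"
    using genideal_self[of S] that by (auto simp: free_ring_def rel_ideal_def)
qed

lemma rel_ideal_uminus: "x \<in> rel_ideal S \<Longrightarrow> - x \<in> rel_ideal S"
  using rel_ideal_props(3)[of x S "- 1"] by simp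

lemma rel_ideal_minus: "x \<in> rel_ideal S \<Longrightarrow> y \<in> rel_ideal S \<Longrightarrow> x - y \<in> rel_ideal S"
  using rel_ideal_props(2)[of x S "- y"] rel_ideal_uminus[of y S] by simp

lemma rel_ideal_minimal:
  assumes "S \<subseteq> J" "0 \<in> J" "\<And>x y. x \<in> J \<Longrightarrow> y \<in> J \<Longrightarrow> x + y \<in> J"
    "\<And>x z. x \<in> J \<Longrightarrow> z * x \<in> J" "\<And>x z. x \<in> J \<Longrightarrow> x * z \<in> J"
  shows "rel_ideal S \<subseteq> J"
proof -
  have inv: "inv\<^bsub>add_monoid free_ring\<^esub> x = - x" for x :: "('a, 'b) free_alg"
  proof -
    interpret ring "free_ring :: ('a, 'b) free_alg ring" by (rule ring_free_ring)
    have "\<ominus>\<^bsub>free_ring\<^esub> x = - x"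
      by (rule minus_equality) (auto simp: free_ring_def)
    then show ?thesis by (simp add: a_inv_def)
  qed
  have "ideal J free_ring"
  proof (rule idealI[OF ring_free_ring])
    show "subgroup J (add_monoid free_ring)"
    proof
      fix x assume "x \<in> J"
      then show "inv\<^bsub>add_monoid free_ring\<^esub> x \<in> J"
        using assms(4)[of x "- 1"] unfolding inv by simp
    qed (use assms in \<open>auto simp: free_ring_def\<close>)
  qed (use assms in \<open>auto simp: free_ring_def\<close>)
  then show ?thesis
    unfolding rel_ideal_def by (rule ring.genideal_minimal[OF ring_free_ring]) (rule assms(1))
qed

lemma cls_altdef: "cls S p = {i + p |i. i \<in> rel_ideal S}"
  by (auto simp: cls_def a_r_coset_def r_coset_def free_ring_def)

lemma cls_eq_iff: "cls S p = cls S p' \<longleftrightarrow> p - p' \<in> rel_ideal S"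
proof
  assume "cls S p = cls S p'"
  moreover have "p \<in> cls S p" using rel_ideal_props(1)[of S] by (force simp: cls_altdef)
  ultimately show "p - p' \<in> rel_ideal S" by (auto simp: cls_altdef)
next
  assume *: "p - p' \<in> rel_ideal S"
  have "i + p \<in> cls S p'" if "i \<in> rel_ideal S" for i
    using rel_ideal_props(2)[OF that *] by (auto simp: cls_altdef intro!: exI[of _ "i + (p - p')"])
  moreover have "i + p' \<in> cls S p" if "i \<in> rel_ideal S" for i
    using rel_ideal_minus[OF that *] by (auto simp: cls_altdef intro!: exI[of _ "i - (p - p')"])
  ultimately show "cls S p = cls S p'" by (auto simp: cls_altdef)
qed

lemma cls_self: "p \<in> cls S p"
  using rel_ideal_props(1)[of S] by (force simp: cls_altdef)

lemma mem_cls_iff: "p' \<in> cls S p \<longleftrightarrow> p' - p \<in> rel_ideal S"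
  by (auto simp: cls_altdef intro!: exI[of _ "p' - p"])

lemma carrier_presented: "carrier (presented S) = range (cls S)"
  by (auto simp: presented_def FactRing_def A_RCOSETS_def' cls_def free_ring_def)

lemma presented_mult: "cls S p \<otimes>\<^bsub>presented S\<^esub> cls S p' = cls S (p * p')"
  using ideal.rcoset_mult_add[OF ideal_rel_ideal, of p p' S]
  by (simp add: presented_def FactRing_def cls_def free_ring_def)

lemma presented_add: "cls S p \<oplus>\<^bsub>presented S\<^esub> cls S p' = cls S (p + p')"
  using ideal.a_rcos_sum[OF ideal_rel_ideal, of p p' S]
  by (simp add: presented_def FactRing_def cls_def free_ring_def)

lemma presented_zero: "\<zero>\<^bsub>presented S\<^esub> = cls S 0"
  by (simp add: presented_def FactRing_def cls_altdef)

lemma ring_center_presented: 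
  "cls S c \<in> ring_center (presented S) \<Longrightarrow> c * p - p * c \<in> rel_ideal S"
  by (auto simp: ring_center_def carrier_presented presented_mult cls_eq_iff)

text \<open>The elements of the free algebra that map \<open>B\<close> into \<open>D\<close> form a two-sided ideal.\<close>
lemma ev_rel_ideal:
  assumes ops: "operators sc T" and B: "stable sc T B" and D: "stable sc T D"
    and rel: "\<And>p x. p \<in> S \<Longrightarrow> x \<in> B \<Longrightarrow> ev sc T p x \<in> D"
    and p: "p \<in> rel_ideal S" and x: "x \<in> B"
  shows "ev sc T p x \<in> D"
proof -
  interpret operators sc T by fact
  let ?J = "{p. \<forall>x\<in>B. ev sc T p x \<in> D}"
  have "rel_ideal S \<subseteq> ?J"
    by (rule rel_ideal_minimal)
      (auto simp: rel ev_zero ev_plus ev_mult stableD[OF D] ev_stable[OF D] ev_stable[OF B])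
  then show ?thesis using p x by auto
qed

lemma stable_sum: "stable sc T D \<Longrightarrow> (\<And>i. i \<in> I \<Longrightarrow> f i \<in> D) \<Longrightarrow> sum f I \<in> D"
  by (induction I rule: infinite_finite_induct) (auto intro: stableD)

section \<open>Modules modelled by operators on a vector space\<close>

text \<open>A module over the presented algebra is studied through a subquotient \<open>B/D\<close> of a vector space on which the
  generators act by operators: \<open>\<pi>\<close> maps \<open>B\<close> onto the module with kernel \<open>D\<close>. Keeping \<open>B\<close> and
  \<open>D\<close> as sets allows submodules, quotients and restrictions of scalars to share one vector space.\<close>
definition models :: "('k::field \<Rightarrow> 'v::ab_group_add \<Rightarrow> 'v) \<Rightarrow> ('g \<Rightarrow> 'v \<Rightarrow> 'v) \<Rightarrow> ('g, 'k) free_alg set \<Rightarrow>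
    'v set \<Rightarrow> 'v set \<Rightarrow> ('v \<Rightarrow> 'm) \<Rightarrow> (('g, 'k) free_alg set, 'm) module \<Rightarrow> bool" where
  "models sc T S B D \<pi> M \<longleftrightarrow> operators sc T \<and> stable sc T B \<and> stable sc T D \<and> D \<subseteq> B \<and>
     carrier M = \<pi> ` B \<and> \<zero>\<^bsub>M\<^esub> = \<pi> 0 \<and>
     (\<forall>x\<in>B. \<forall>y\<in>B. \<pi> x \<oplus>\<^bsub>M\<^esub> \<pi> y = \<pi> (x + y)) \<and>
     (\<forall>p. \<forall>x\<in>B. cls S p \<odot>\<^bsub>M\<^esub> \<pi> x = \<pi> (ev sc T p x)) \<and>
     (\<forall>x\<in>B. \<forall>y\<in>B. \<pi> x = \<pi> y \<longleftrightarrow> x - y \<in> D)"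

lemma modelsD:
  assumes "models sc T S B D \<pi> M"
  shows "operators sc T" "stable sc T B" "stable sc T D" "D \<subseteq> B" "carrier M = \<pi> ` B"
    "\<zero>\<^bsub>M\<^esub> = \<pi> 0" "x \<in> B \<Longrightarrow> y \<in> B \<Longrightarrow> \<pi> x \<oplus>\<^bsub>M\<^esub> \<pi> y = \<pi> (x + y)"
    "x \<in> B \<Longrightarrow> cls S p \<odot>\<^bsub>M\<^esub> \<pi> x = \<pi> (ev sc T p x)"
    "x \<in> B \<Longrightarrow> y \<in> B \<Longrightarrow> \<pi> x = \<pi> y \<longleftrightarrow> x - y \<in> D"
  using assms unfolding models_def by blast+

lemma models_regular:
  "models free_scale (free_op (\<lambda>g. g)) S UNIV (rel_ideal S) (cls S) (regular_module (presented S))"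
proof -
  have "stable free_scale (free_op (\<lambda>g. g)) (rel_ideal S)"
    by (auto simp: stable_def free_scale_def free_op_def intro: rel_ideal_props)
  then show ?thesis
    by (auto simp: models_def operators_free stable_UNIV ev_free_self regular_module_def
        carrier_presented presented_zero presented_add presented_mult cls_eq_iff)
qed

lemma models_quotient:
  assumes M: "models sc T S B D \<pi> M"
    and B': "stable sc T B'" "D \<subseteq> B'" "B' \<subseteq> B"
  shows "models sc T S B B' (\<lambda>x. \<pi> ` B' +>\<^bsub>M\<^esub> \<pi> x) (quotient_module M (\<pi> ` B'))"
proof -
  interpret operators sc T by (rule modelsD(1)[OF M])
  note st = modelsD(2,3)[OF M]
  let ?C = "\<lambda>x. \<pi> ` B' +>\<^bsub>M\<^esub> \<pi> x"
  have coset: "?C x = (\<lambda>b. \<pi> (b + x)) ` B'" if "x \<in> B" for x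
    using B'(3) that by (force simp: a_r_coset_def r_coset_def modelsD(7)[OF M])
  have eq: "?C x = ?C y \<longleftrightarrow> x - y \<in> B'" if x: "x \<in> B" and y: "y \<in> B" for x y
  proof
    assume "?C x = ?C y"
    moreover have "\<pi> x \<in> ?C x" using x stableD(1)[OF B'(1)] by (force simp: coset)
    ultimately obtain b where b: "b \<in> B'" "\<pi> x = \<pi> (b + y)" using y by (auto simp: coset)
    then have "x - (b + y) \<in> D"
      using B'(3) x y stableD(2)[OF st(1)] by (subst modelsD(9)[OF M, symmetric]) auto
    then have "x - (b + y) + b \<in> B'" using B' b stableD(2)[OF B'(1)] by blast
    then show "x - y \<in> B'" by (simp add: algebra_simps)
  next
    assume d: "x - y \<in> B'"
    have 1: "\<pi> (b + x) \<in> ?C y" if "b \<in> B'" for b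
      using y stableD(2)[OF B'(1) that d] by (auto simp: coset intro!: image_eqI[of _ _ "b + (x - y)"])
    have 2: "\<pi> (b + y) \<in> ?C x" if "b \<in> B'" for b
      using x stable_minus[OF B'(1) that d] by (auto simp: coset intro!: image_eqI[of _ _ "b - (x - y)"])
    show "?C x = ?C y"
    proof (rule subset_antisym)
      show "?C x \<subseteq> ?C y" unfolding coset[OF x] using 1 by blast
      show "?C y \<subseteq> ?C x" unfolding coset[OF y] using 2 by blast
    qed
  qed
  have add: "?C x <+>\<^bsub>M\<^esub> ?C y = ?C (x + y)" if x: "x \<in> B" and y: "y \<in> B" for x y
  proof -
    have xy: "x + y \<in> B" using x y stableD(2)[OF st(1)] by blast
    have "\<pi> (b + x) \<oplus>\<^bsub>M\<^esub> \<pi> (b' + y) = \<pi> ((b + b') + (x + y))" if "b \<in> B'" "b' \<in> B'" for b b'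
      using that B'(3) x y stableD(2)[OF st(1)]
      by (subst modelsD(7)[OF M]) (auto simp: algebra_simps)
    then have "?C x <+>\<^bsub>M\<^esub> ?C y = {\<pi> ((b + b') + (x + y)) |b b'. b \<in> B' \<and> b' \<in> B'}"
      unfolding set_add_def' coset[OF x] coset[OF y] by fastforce
    also have "\<dots> = ?C (x + y)"
      unfolding coset[OF xy] using stableD(1,2)[OF B'(1)] by force
    finally show ?thesis .
  qed
  have smult: "(\<Union>z\<in>?C x. \<pi> ` B' +>\<^bsub>M\<^esub> (cls S p \<odot>\<^bsub>M\<^esub> z)) = ?C (ev sc T p x)" if x: "x \<in> B" for x p
  proof -
    have "\<pi> ` B' +>\<^bsub>M\<^esub> (cls S p \<odot>\<^bsub>M\<^esub> z) = ?C (ev sc T p x)" if "z \<in> ?C x" for z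
    proof -
      from that x obtain b where b: "b \<in> B'" "z = \<pi> (b + x)" by (auto simp: coset)
      have bx: "b + x \<in> B" using b B' x stableD(2)[OF st(1)] by blast
      have "?C (ev sc T p (b + x)) = ?C (ev sc T p x)"
        unfolding eq[OF ev_stable[OF st(1) bx] ev_stable[OF st(1) x]]
        using ev_stable[OF B'(1) b(1)] by (simp add: ev_add_arg)
      then show ?thesis using b bx by (simp add: modelsD(8)[OF M])
    qed
    moreover have "?C x \<noteq> {}" using coset[OF x] stableD(1)[OF B'(1)] by blast
    ultimately show ?thesis by blast
  qed
  have zero: "\<pi> ` B' = ?C 0" using coset[of 0] stableD(1)[OF st(1)] by auto
  have carr: "a_rcosets\<^bsub>M\<^esub> (\<pi> ` B') = ?C ` B"
    by (auto simp: A_RCOSETS_def' modelsD(5)[OF M])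
  show ?thesis
    unfolding models_def quotient_module_def
    using modelsD(1,2)[OF M] B' add smult eq zero carr by simp
qed

lemma models_submod:
  assumes M: "models sc T S B D \<pi> M" and B': "stable sc T B'" "D \<subseteq> B'" "B' \<subseteq> B"
  shows "models sc T S B' D \<pi> (submod M (\<pi> ` B'))"
proof -
  have B: "x \<in> B" if "x \<in> B'" for x using B'(3) that by blast
  show ?thesis
    unfolding models_def submod_def
    using modelsD(1,3)[OF M] B'(1,2)
    by (simp add: modelsD(6)[OF M] modelsD(7)[OF M B B] modelsD(8)[OF M B] modelsD(9)[OF M B B])
qed

lemma models_abelian_group:
  assumes M: "models sc T S B D \<pi> M"
  shows "abelian_group M"
proof -
  interpret operators sc T by (rule modelsD(1)[OF M])
  note st = modelsD(2)[OF M]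
  have carr: "x \<in> carrier M \<longleftrightarrow> (\<exists>b\<in>B. x = \<pi> b)" for x
    by (auto simp: modelsD(5)[OF M])
  show ?thesis
  proof (rule abelian_groupI)
    fix x y z assume "x \<in> carrier M" "y \<in> carrier M" "z \<in> carrier M"
    then obtain a b c where abc: "a \<in> B" "b \<in> B" "c \<in> B" "x = \<pi> a" "y = \<pi> b" "z = \<pi> c"
      by (auto simp: carr)
    note simps = modelsD(6,7)[OF M] stableD(1,2)[OF st] abc stable_uminus[OF st]
    show "x \<oplus>\<^bsub>M\<^esub> y \<in> carrier M" by (auto simp: carr simps)
    show "x \<oplus>\<^bsub>M\<^esub> y \<oplus>\<^bsub>M\<^esub> z = x \<oplus>\<^bsub>M\<^esub> (y \<oplus>\<^bsub>M\<^esub> z)" by (simp add: simps add.assoc)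
    show "x \<oplus>\<^bsub>M\<^esub> y = y \<oplus>\<^bsub>M\<^esub> x" by (simp add: simps add.commute)
    show "\<zero>\<^bsub>M\<^esub> \<oplus>\<^bsub>M\<^esub> x = x" by (simp add: simps)
    show "\<exists>y\<in>carrier M. y \<oplus>\<^bsub>M\<^esub> x = \<zero>\<^bsub>M\<^esub>"
      by (rule bexI[of _ "\<pi> (- a)"]) (auto simp: carr simps)
  qed (use stableD(1)[OF st] in \<open>auto simp: carr modelsD(6)[OF M]\<close>)
qed

lemma models_finsum:
  assumes M: "models sc T S B D \<pi> M" and "finite I" "\<And>i. i \<in> I \<Longrightarrow> f i \<in> B"
  shows "finsum M (\<lambda>i. \<pi> (f i)) I = \<pi> (sum f I) \<and> sum f I \<in> B"
proof -
  interpret abelian_group M by (rule models_abelian_group[OF M])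
  note st = modelsD(2)[OF M]
  from assms(2,3) show ?thesis
  proof (induction I rule: finite_induct)
    case empty
    then show ?case using modelsD(6)[OF M] stableD(1)[OF st] by simp
  next
    case (insert i I)
    have "finsum M (\<lambda>i. \<pi> (f i)) (insert i I) = \<pi> (f i) \<oplus>\<^bsub>M\<^esub> finsum M (\<lambda>i. \<pi> (f i)) I"
      using insert by (intro finsum_insert) (auto simp: modelsD(5)[OF M])
    then show ?case using insert modelsD(7)[OF M] stableD(2)[OF st] by simp
  qed
qed

lemma models_submoduleI:
  assumes M: "models sc T S B D \<pi> M" and B': "stable sc T B'" "B' \<subseteq> B"
  shows "submodule (\<pi> ` B') (presented S) M"
proof -
  interpret operators sc T by (rule modelsD(1)[OF M])
  interpret G: abelian_group M by (rule models_abelian_group[OF M])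
  have neg: "\<ominus>\<^bsub>M\<^esub> \<pi> x = \<pi> (- x)" if "x \<in> B" for x
    using that stable_uminus[OF modelsD(2)[OF M]]
    by (intro G.minus_equality) (auto simp: modelsD(5,6,7)[OF M])
  show ?thesis
  proof (intro submodule.intro submodule_axioms.intro subgroup.intro)
    fix x y assume "x \<in> \<pi> ` B'" "y \<in> \<pi> ` B'"
    then show "x \<otimes>\<^bsub>add_monoid M\<^esub> y \<in> \<pi> ` B'"
      using B' stableD(2)[OF B'(1)] by (auto simp: modelsD(7)[OF M] subsetD)
  next
    fix x assume "x \<in> \<pi> ` B'"
    then obtain b where "b \<in> B'" "x = \<pi> b" by blast
    then have "\<ominus>\<^bsub>M\<^esub> x = \<pi> (- b)" using neg[of b] B'(2) by auto
    then show "inv\<^bsub>add_monoid M\<^esub> x \<in> \<pi> ` B'"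
      using stable_uminus[OF B'(1) \<open>b \<in> B'\<close>] by (simp add: a_inv_def)
  next
    fix a x assume "a \<in> carrier (presented S)" "x \<in> \<pi> ` B'"
    then show "a \<odot>\<^bsub>M\<^esub> x \<in> \<pi> ` B'"
      using B'(2) ev_stable[OF B'(1)] by (auto simp: modelsD(8)[OF M] carrier_presented subsetD)
  qed (use B' stableD(1)[OF B'(1)] in \<open>auto simp: modelsD(5,6)[OF M]\<close>)
qed

text \<open>Together with the converse above, this is the correspondence between submodules of \<open>B/D\<close> and stable subspaces
  between \<open>D\<close> and \<open>B\<close>.\<close>
lemma models_submoduleD:
  assumes M: "models sc T S B D \<pi> M" and N: "submodule N (presented S) M"
  defines "B' \<equiv> {x \<in> B. \<pi> x \<in> N}"
  shows "stable sc T B'" "D \<subseteq> B'" "B' \<subseteq> B" "\<pi> ` B' = N"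
proof -
  interpret operators sc T by (rule modelsD(1)[OF M])
  interpret N: submodule N "presented S" M by (rule N)
  note st = modelsD(2)[OF M]
  have sm: "\<pi> (ev sc T p x) \<in> N" if "x \<in> B" "\<pi> x \<in> N" for p x
    using N.smult_closed[of "cls S p" "\<pi> x"] that by (simp add: carrier_presented modelsD(8)[OF M])
  have z: "\<pi> 0 \<in> N" using N.one_closed by (simp add: modelsD(6)[OF M])
  show "stable sc T B'"
  proof (rule stableI)
    fix x y assume "x \<in> B'" "y \<in> B'"
    then show "x + y \<in> B'"
      using N.m_closed[of "\<pi> x" "\<pi> y"] stableD(2)[OF st] by (auto simp: B'_def modelsD(7)[OF M])
  qed (use sm[of _ "scal _"] sm[of _ "gen _"] z stableD[OF st] in \<open>auto simp: B'_def ev_simps\<close>)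
  show "B' \<subseteq> B" by (auto simp: B'_def)
  show "D \<subseteq> B'"
  proof
    fix d assume d: "d \<in> D"
    then have "d \<in> B" using modelsD(4)[OF M] by blast
    moreover have "\<pi> d = \<pi> 0"
      using d \<open>d \<in> B\<close> stableD(1)[OF st] by (subst modelsD(9)[OF M]) auto
    ultimately show "d \<in> B'" using z by (simp add: B'_def)
  qed
  show "\<pi> ` B' = N"
    using N.subset by (auto simp: B'_def modelsD(5)[OF M])
qed

text \<open>Isomorphisms are given by a map of representatives that is bijective and equivariant modulo \<open>D\<close> and \<open>D'\<close>.
  Both directions are recorded, since the natural \<open>g\<close> may point either way.\<close>
lemma models_iso:
  assumes M: "models sc T S B D \<pi> M" and M': "models sc' T' S B' D' \<pi>' M'"
    and maps: "\<And>x. x \<in> B \<Longrightarrow> g x \<in> B'"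
    and onto: "\<And>y. y \<in> B' \<Longrightarrow> \<exists>x\<in>B. y - g x \<in> D'"
    and ker: "\<And>x. x \<in> B \<Longrightarrow> g x \<in> D' \<longleftrightarrow> x \<in> D"
    and add: "\<And>x y. x \<in> B \<Longrightarrow> y \<in> B \<Longrightarrow> g (x + y) = g x + g y"
    and scale: "\<And>c x. x \<in> B \<Longrightarrow> g (sc c x) = sc' c (g x)"
    and intertw: "\<And>h x. x \<in> B \<Longrightarrow> g (T h x) - T' h (g x) \<in> D'"
  shows "lmod_iso (presented S) M M' \<and> lmod_iso (presented S) M' M"
proof -
  interpret A: operators sc T by (rule modelsD(1)[OF M])
  interpret C: operators sc' T' by (rule modelsD(1)[OF M'])
  note st = modelsD(2,3)[OF M] and st' = modelsD(2,3)[OF M']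
  have neg: "g (x - y) = g x - g y" if "x \<in> B" "y \<in> B" for x y
    using add[of "x - y" y] that A.stable_minus[OF st(1)] by simp
  have ev: "g (ev sc T p x) - ev sc' T' p (g x) \<in> D'" if "x \<in> B" for p x
    using that add scale intertw
    by (intro ev_intertwine[where \<iota>=g and B=B, OF modelsD(1)[OF M] modelsD(1)[OF M'] st(1) st'(2)]) auto
  define f where "f m = \<pi>' (g (SOME x. x \<in> B \<and> \<pi> x = m))" for m
  have f: "f (\<pi> x) = \<pi>' (g x)" if x: "x \<in> B" for x
  proof -
    have some: "(SOME y. y \<in> B \<and> \<pi> y = \<pi> x) \<in> B \<and> \<pi> (SOME y. y \<in> B \<and> \<pi> y = \<pi> x) = \<pi> x"
      by (rule someI[where P="\<lambda>y. y \<in> B \<and> \<pi> y = \<pi> x"]) (use x in auto)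
    define y where "y = (SOME y. y \<in> B \<and> \<pi> y = \<pi> x)"
    have y: "y \<in> B" "\<pi> y = \<pi> x" using some unfolding y_def by blast+
    have "y - x \<in> D" using modelsD(9)[OF M y(1) x] y(2) by simp
    then have "g y - g x \<in> D'"
      using ker[of "y - x"] A.stable_minus[OF st(1) y(1) x] neg[OF y(1) x] by simp
    then have "\<pi>' (g y) = \<pi>' (g x)"
      using maps x y by (subst modelsD(9)[OF M']) auto
    then show ?thesis by (simp add: f_def y_def)
  qed
  have inj: "inj_on f (carrier M)"
  proof (rule inj_onI)
    fix m m' assume "m \<in> carrier M" "m' \<in> carrier M" and eq: "f m = f m'"
    then obtain x y where xy: "x \<in> B" "y \<in> B" "m = \<pi> x" "m' = \<pi> y"
      by (auto simp: modelsD(5)[OF M])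
    then have "g x - g y \<in> D'"
      using eq maps by (subst modelsD(9)[OF M', symmetric]) (auto simp: f)
    then show "m = m'"
      using ker[of "x - y"] xy A.stable_minus[OF st(1)] neg by (simp add: modelsD(9)[OF M])
  qed
  have surj: "f ` carrier M = carrier M'"
  proof -
    have "\<pi>' y \<in> f ` \<pi> ` B" if y: "y \<in> B'" for y
    proof -
      obtain x where x: "x \<in> B" "y - g x \<in> D'" using onto[OF y] by blast
      then have "\<pi>' y = \<pi>' (g x)" using y maps by (subst modelsD(9)[OF M']) auto
      then show ?thesis using x f by force
    qed
    then show ?thesis using maps by (auto simp: modelsD(5)[OF M] modelsD(5)[OF M'] f)
  qed
  have hom: "f \<in> lmod_hom (presented S) M M'"
    unfolding lmod_hom_def
  proof (intro CollectI conjI ballI Pi_I)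
    fix m m' assume "m \<in> carrier M" "m' \<in> carrier M"
    then obtain x y where xy: "x \<in> B" "y \<in> B" "m = \<pi> x" "m' = \<pi> y"
      by (auto simp: modelsD(5)[OF M])
    then show "f (m \<oplus>\<^bsub>M\<^esub> m') = f m \<oplus>\<^bsub>M'\<^esub> f m'"
      using stableD(2)[OF st(1)] maps by (simp add: modelsD(7)[OF M] modelsD(7)[OF M'] f add)
  next
    fix a m assume "a \<in> carrier (presented S)" "m \<in> carrier M"
    then obtain p x where px: "x \<in> B" "m = \<pi> x" "a = cls S p"
      by (auto simp: modelsD(5)[OF M] carrier_presented)
    have "\<pi>' (g (ev sc T p x)) = \<pi>' (ev sc' T' p (g x))"
      using ev[OF px(1)] maps A.ev_stable[OF st(1)] C.ev_stable[OF st'(1)] px(1)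
      by (subst modelsD(9)[OF M']) auto
    then show "f (a \<odot>\<^bsub>M\<^esub> m) = a \<odot>\<^bsub>M'\<^esub> f m"
      using px maps A.ev_stable[OF st(1)] by (simp add: modelsD(8)[OF M] modelsD(8)[OF M'] f)
  qed (use surj in auto)
  have bij: "bij_betw f (carrier M) (carrier M')"
    using inj surj by (simp add: bij_betw_def)
  let ?f' = "inv_into (carrier M) f"
  have f'M: "?f' y \<in> carrier M" "f (?f' y) = y" if "y \<in> carrier M'" for y
    using that surj by (auto simp: inv_into_into f_inv_into_f)
  have f'f: "?f' (f x) = x" if "x \<in> carrier M" for x
    using inj that by (rule inv_into_f_f)
  have clM: "x \<oplus>\<^bsub>M\<^esub> y \<in> carrier M" if "x \<in> carrier M" "y \<in> carrier M" for x y
    using abelian_groupE(1)[OF models_abelian_group[OF M]] that by blast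
  have clM2: "a \<odot>\<^bsub>M\<^esub> x \<in> carrier M" if "x \<in> carrier M" "a \<in> carrier (presented S)" for x a
    using that A.ev_stable[OF st(1)] by (auto simp: modelsD(5)[OF M] carrier_presented modelsD(8)[OF M])
  have "?f' \<in> lmod_hom (presented S) M' M"
    unfolding lmod_hom_def
  proof (intro CollectI conjI ballI Pi_I)
    fix x y assume xy: "x \<in> carrier M'" "y \<in> carrier M'"
    have "?f' (f (?f' x \<oplus>\<^bsub>M\<^esub> ?f' y)) = ?f' x \<oplus>\<^bsub>M\<^esub> ?f' y"
      using f'M xy clM by (intro f'f) auto
    moreover have "f (?f' x \<oplus>\<^bsub>M\<^esub> ?f' y) = x \<oplus>\<^bsub>M'\<^esub> y"
      using hom f'M xy by (simp add: lmod_hom_def)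
    ultimately show "?f' (x \<oplus>\<^bsub>M'\<^esub> y) = ?f' x \<oplus>\<^bsub>M\<^esub> ?f' y" by simp
  next
    fix a x assume ax: "a \<in> carrier (presented S)" "x \<in> carrier M'"
    have "?f' (f (a \<odot>\<^bsub>M\<^esub> ?f' x)) = a \<odot>\<^bsub>M\<^esub> ?f' x"
      using f'M ax clM2 by (intro f'f) auto
    moreover have "f (a \<odot>\<^bsub>M\<^esub> ?f' x) = a \<odot>\<^bsub>M'\<^esub> x"
      using hom f'M ax by (simp add: lmod_hom_def)
    ultimately show "?f' (a \<odot>\<^bsub>M'\<^esub> x) = a \<odot>\<^bsub>M\<^esub> ?f' x" by simp
  qed (use f'M in auto)
  then show ?thesis
    using hom bij bij_betw_inv_into[OF bij] unfolding lmod_iso_def by blast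
qed

lemma models_direct_sum:
  assumes M: "models sc T S UNIV {0} \<pi> M" and I: "finite I"
    and st: "\<And>i. i \<in> I \<Longrightarrow> stable sc T (V i)"
    and ex: "\<And>x. \<exists>f. (\<forall>i\<in>I. f i \<in> V i) \<and> x = sum f I"
    and unique: "\<And>f. (\<And>i. i \<in> I \<Longrightarrow> f i \<in> V i) \<Longrightarrow> sum f I = 0 \<Longrightarrow> \<forall>i\<in>I. f i = 0"
  shows "internal_direct_sum (presented S) M I (\<lambda>i. \<pi> ` V i)"
proof -
  interpret operators sc T by (rule modelsD(1)[OF M])
  interpret G: abelian_group M by (rule models_abelian_group[OF M])
  have inj: "\<pi> x = \<pi> y \<longleftrightarrow> x = y" for x y
    using modelsD(9)[OF M, of x y] by simp
  have fs: "finsum M g I = \<pi> (sum f I)" if "\<And>i. i \<in> I \<Longrightarrow> g i = \<pi> (f i)" for f g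
  proof -
    have "finsum M g I = finsum M (\<lambda>i. \<pi> (f i)) I"
      by (rule G.finsum_cong') (auto simp: that modelsD(5)[OF M])
    then show ?thesis using models_finsum[OF M I, of f] by simp
  qed
  show ?thesis
    unfolding internal_direct_sum_def
  proof (intro conjI ballI)
    fix i assume "i \<in> I"
    then show "submodule (\<pi> ` V i) (presented S) M"
      by (intro models_submoduleI[OF M st]) auto
  next
    fix v assume "v \<in> carrier M"
    then obtain x where x: "v = \<pi> x" by (auto simp: modelsD(5)[OF M])
    obtain f where f: "\<forall>i\<in>I. f i \<in> V i" "x = sum f I" using ex by blast
    show "\<exists>!g. g \<in> (\<Pi>\<^sub>E i\<in>I. \<pi> ` V i) \<and> v = finsum M g I"
    proof (intro ex1I conjI)
      show "(\<lambda>i\<in>I. \<pi> (f i)) \<in> (\<Pi>\<^sub>E i\<in>I. \<pi> ` V i)" using f by auto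
      show "v = finsum M (\<lambda>i\<in>I. \<pi> (f i)) I"
        using fs[of "\<lambda>i\<in>I. \<pi> (f i)" f] f(2) x by simp
    next
      fix g assume g: "g \<in> (\<Pi>\<^sub>E i\<in>I. \<pi> ` V i) \<and> v = finsum M g I"
      then have "\<forall>i\<in>I. \<exists>y\<in>V i. g i = \<pi> y" by (fastforce simp: PiE_def Pi_def)
      then obtain h where h: "\<forall>i\<in>I. h i \<in> V i \<and> g i = \<pi> (h i)" by metis
      have "\<pi> x = \<pi> (sum h I)" using g fs[of g h] h x by simp
      then have "(\<Sum>i\<in>I. h i - f i) = 0" using f(2) by (simp add: inj sum_subtractf)
      then have "\<forall>i\<in>I. h i - f i = 0"
        using unique[of "\<lambda>i. h i - f i"] f h st stable_minus by blast
      then show "g = (\<lambda>i\<in>I. \<pi> (f i))"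
        using h g by (intro extensionalityI[of _ I]) (auto simp: PiE_def)
    qed
  qed
qed

lemma models_finite_dimensional:
  fixes sc :: "'k::field \<Rightarrow> 'v::ab_group_add \<Rightarrow> 'v"
  assumes M: "models sc T S B D \<pi> M" and I: "finite I" and h: "\<And>i. i \<in> I \<Longrightarrow> h i \<in> B"
    and spn: "\<And>x. x \<in> B \<Longrightarrow> \<exists>a. x - (\<Sum>i\<in>I. sc (a i) (h i)) \<in> D"
  shows "finite_dimensional (restrict_scalars (\<lambda>c. cls S (scal c)) (M :: (_, 'm) module))" (is "finite_dimensional ?M")
proof -
  interpret operators sc T by (rule modelsD(1)[OF M])
  interpret gM: abelian_group M by (rule models_abelian_group[OF M])
  note st = modelsD(2,3)[OF M]
  let ?p = "\<lambda>i. \<pi> (h i)"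
  have fs: "finsum ?M f J = finsum M f J" for f and J :: "'m set"
    by (simp add: finsum_def finprod_def restrict_scalars_def)
  have *: "\<exists>a. v = finsum ?M (\<lambda>b. a b \<odot>\<^bsub>?M\<^esub> b) (?p ` I)" if "v \<in> carrier M" for v
  proof -
    obtain x where x: "x \<in> B" "v = \<pi> x" using \<open>v \<in> carrier M\<close> by (auto simp: modelsD(5)[OF M])
    obtain a where a: "x - (\<Sum>i\<in>I. sc (a i) (h i)) \<in> D" using spn[OF x(1)] by blast
    \<comment> \<open>Different indices may give the same element of \<open>M\<close>; their coefficients are added up.\<close>
    define r where "r b = h (inv_into I ?p b)" for b
    define a' where "a' b = (\<Sum>i\<in>{i \<in> I. ?p i = b}. a i)" for b
    have r: "r b \<in> B" "\<pi> (r b) = b" if "b \<in> ?p ` I" for b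
      unfolding r_def using that h inv_into_into[OF that] f_inv_into_f[OF that] by auto
    have "finsum ?M (\<lambda>b. a' b \<odot>\<^bsub>?M\<^esub> b) (?p ` I) = finsum M (\<lambda>b. \<pi> (sc (a' b) (r b))) (?p ` I)"
      unfolding fs
    proof (rule gM.finsum_cong')
      fix b assume b: "b \<in> ?p ` I"
      have "cls S (scal (a' b)) \<odot>\<^bsub>M\<^esub> \<pi> (r b) = \<pi> (sc (a' b) (r b))"
        using modelsD(8)[OF M r(1)[OF b]] by (simp add: ev_simps)
      then show "a' b \<odot>\<^bsub>?M\<^esub> b = \<pi> (sc (a' b) (r b))"
        by (simp add: restrict_scalars_def r(2)[OF b])
    qed (use r stableD(3)[OF st(1)] in \<open>auto simp: modelsD(5)[OF M]\<close>)
    also have "\<dots> = \<pi> (\<Sum>b\<in>?p ` I. sc (a' b) (r b))" and mem: "(\<Sum>b\<in>?p ` I. sc (a' b) (r b)) \<in> B"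
      using models_finsum[OF M, of "?p ` I" "\<lambda>b. sc (a' b) (r b)"] r(1) I stableD(3)[OF st(1)]
      by auto
    moreover have "\<pi> x = \<pi> (\<Sum>b\<in>?p ` I. sc (a' b) (r b))"
    proof -
      have "(\<Sum>i\<in>I. sc (a i) (h i)) = (\<Sum>b\<in>?p ` I. \<Sum>i\<in>{i \<in> I. ?p i = b}. sc (a i) (h i))"
        by (rule sum.image_gen[OF I])
      then have "(\<Sum>i\<in>I. sc (a i) (h i)) - (\<Sum>b\<in>?p ` I. sc (a' b) (r b))
        = (\<Sum>b\<in>?p ` I. \<Sum>i\<in>{i \<in> I. ?p i = b}. sc (a i) (h i - r b))"
        by (simp add: a'_def scale_sum_left sum_subtractf scale_right_diff_distrib)
      moreover have "\<dots> \<in> D"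
      proof (intro stable_sum[OF st(2)] stableD(3)[OF st(2)])
        fix b i assume "b \<in> ?p ` I" "i \<in> {i \<in> I. ?p i = b}"
        then show "h i - r b \<in> D"
          using r[of b] h by (subst modelsD(9)[OF M, symmetric]) auto
      qed
      ultimately have "(x - (\<Sum>i\<in>I. sc (a i) (h i))) +
          ((\<Sum>i\<in>I. sc (a i) (h i)) - (\<Sum>b\<in>?p ` I. sc (a' b) (r b))) \<in> D"
        by (intro stableD(2)[OF st(2) a]) simp
      then have "x - (\<Sum>b\<in>?p ` I. sc (a' b) (r b)) \<in> D"
        by simp
      then show ?thesis using x mem by (subst modelsD(9)[OF M]) auto
    qed
    ultimately show ?thesis using x(2) by (auto intro!: exI[of _ a'])
  qed
  show ?thesis
    unfolding finite_dimensional_def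
    by (rule exI[of _ "?p ` I"]) (use I h * in \<open>auto simp: restrict_scalars_def modelsD(5)[OF M]\<close>)
qed

section \<open>Linear maps on the polynomial ring in F and Y\<close>

text \<open>The inner polynomial variable is \<open>F\<close> and the outer one is \<open>Y\<close>. Thus the degree is the degree in \<open>Y\<close>, and the
  coefficients are polynomials in \<open>F\<close>.\<close>
definition cst :: "'k::field \<Rightarrow> 'k poly poly" where "cst c = [:[:c:]:]"
definition fF :: "'k::field poly poly" where "fF = [:[:0, 1:]:]"
definition yY :: "'k::field poly poly" where "yY = [:0, 1:]"
definition scP :: "'k::field \<Rightarrow> 'k poly poly \<Rightarrow> 'k poly poly" where "scP c x = cst c * x"
definition bas :: "nat \<Rightarrow> nat \<Rightarrow> 'k::field poly poly" where "bas i j = fF ^ i * yY ^ j"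

lemma cst_simps [simp]: "cst 0 = 0" "cst 1 = 1"
  by (simp_all add: cst_def one_pCons)

lemma cst_ring: "cst (a + b) = cst a + cst b" "cst (a - b) = cst a - cst b" "cst (a * b) = cst a * cst b"
  "cst (- a) = - cst a"
  by (simp_all add: cst_def mult.commute)

lemma cst_eq_0_iff [simp]: "cst c = 0 \<longleftrightarrow> c = 0"
  by (simp add: cst_def)

lemma scP_cst: "scP c x * y = scP c (x * y)" "x * scP c y = scP c (x * y)"
  "scP c (x + y) = scP c x + scP c y" "scP c (x - y) = scP c x - scP c y" "scP c (scP d x) = scP (c * d) x"
  "scP c 0 = 0" "scP 0 x = 0" "scP 1 x = x" "scP c (- x) = - scP c x"
  by (simp_all add: scP_def algebra_simps cst_ring)

lemma scP_left: "scP (c + d) x = scP c x + scP d x" "scP (c - d) x = scP c x - scP d x"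
  "scP (- c) x = - scP c x"
  by (simp_all add: scP_def algebra_simps cst_ring)

lemma scP_eq_0_iff [simp]: "scP c x = 0 \<longleftrightarrow> c = 0 \<or> x = 0"
  by (simp add: scP_def)

lemma coeff_scP [simp]: "coeff (scP c x) j = smult c (coeff x j)"
  by (simp add: scP_def cst_def)

lemma vector_space_scP: "vector_space scP"
  by unfold_locales (auto simp: scP_def algebra_simps cst_ring)

lemma fF_power: "fF ^ i = [:monom 1 i:]"
  by (induction i) (simp_all add: fF_def one_pCons monom_Suc mult.commute)

lemma bas_monom: "bas i j = monom (monom (1::'k::field) i) j"
proof -
  have "yY ^ j = monom (1::'k poly) j"
  proof (induction j)
    case 0
    show ?case by (simp add: monom_0 one_pCons)
  next
    case (Suc j)
    then show ?case by (simp add: yY_def monom_Suc)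
  qed
  then show ?thesis
    by (simp add: bas_def fF_power smult_monom)
qed

lemma bas_0_0 [simp]: "bas 0 0 = 1"
  by (simp add: bas_def)

lemma bas_neq_0 [simp]: "bas i j \<noteq> 0"
  by (simp add: bas_monom)

lemma fF_bas: "fF * bas i j = bas (Suc i) j" and yY_bas: "yY * bas i j = bas i (Suc j)"
  by (simp_all add: bas_def algebra_simps)

lemma fF_neq_0 [simp]: "fF \<noteq> 0" and yY_neq_0 [simp]: "yY \<noteq> 0"
  by (simp_all add: fF_def yY_def)

lemma coeff_bas: "coeff (coeff (bas i j) j') i' = (if i = i' \<and> j = j' then 1 else 0)"
  by (simp add: bas_monom)

lemma coeff_fF: "coeff (fF * x) j = pCons 0 (coeff x j)"
  by (simp add: fF_def)

lemma bas_sum: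
  fixes x :: "'k::field poly poly"
  assumes "degree x \<le> N" "\<And>j. degree (coeff x j) \<le> M"
  shows "x = (\<Sum>j\<le>N. \<Sum>i\<le>M. scP (coeff (coeff x j) i) (bas i j))"
proof (rule poly_eqI, rule poly_eqI)
  fix j i
  have "coeff (coeff (\<Sum>j\<le>N. \<Sum>i\<le>M. scP (coeff (coeff x j) i) (bas i j)) j) i =
    (\<Sum>j'\<le>N. \<Sum>i'\<le>M. if i' = i then if j' = j then coeff (coeff x j') i' else 0 else 0)"
    by (simp add: coeff_sum coeff_bas if_distrib cong: if_cong)
      (intro sum.cong refl, auto)
  also have "\<dots> = (if i \<le> M \<and> j \<le> N then coeff (coeff x j) i else 0)"
    by (cases "i \<le> M") simp_all
  also have "\<dots> = coeff (coeff x j) i"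
    using assms(1) assms(2)[of j] by (auto simp: coeff_eq_0)
  finally show "coeff (coeff x j) i = coeff (coeff (\<Sum>j\<le>N. \<Sum>i\<le>M. scP (coeff (coeff x j) i) (bas i j)) j) i" ..
qed

lemma ex_coeff_bound: "\<exists>M. \<forall>j. degree (coeff (x :: 'k::field poly poly) j) \<le> M"
proof (intro exI allI)
  fix j
  show "degree (coeff x j) \<le> Max ((\<lambda>j. degree (coeff x j)) ` {..Suc (degree x)})"
  proof (cases "j \<le> degree x")
    case False
    then have "coeff x j = coeff x (Suc (degree x))" by (simp add: coeff_eq_0)
    then show ?thesis by (intro Max_ge) auto
  qed (auto intro!: Max_ge)
qed

text \<open>The filtration by degree in \<open>Y\<close>, with a strict bound: \<open>Ylt 0\<close> is zero and \<open>Ylt 1\<close> is \<open>k[F]\<close>.\<close>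
definition Ylt :: "nat \<Rightarrow> 'k::field poly poly set" where
  "Ylt d = {x. \<forall>j\<ge>d. coeff x j = 0}"

lemma Ylt_simps [simp]: "0 \<in> Ylt d" "bas i j \<in> Ylt d \<longleftrightarrow> j < d"
  by (auto simp: Ylt_def bas_monom)

lemma Ylt_closed:
  "x \<in> Ylt d \<Longrightarrow> y \<in> Ylt d \<Longrightarrow> x + y \<in> Ylt d" "x \<in> Ylt d \<Longrightarrow> y \<in> Ylt d \<Longrightarrow> x - y \<in> Ylt d"
  "x \<in> Ylt d \<Longrightarrow> scP c x \<in> Ylt d" "x \<in> Ylt d \<Longrightarrow> fF * x \<in> Ylt d" "x \<in> Ylt d \<Longrightarrow> yY * x \<in> Ylt (Suc d)"
  "x \<in> Ylt d \<Longrightarrow> [:a:] * x \<in> Ylt d" 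
  by (auto simp: Ylt_def coeff_fF) (auto simp: yY_def coeff_pCons split: nat.split)

lemma Ylt_fF_power: "x \<in> Ylt d \<Longrightarrow> fF ^ i * x \<in> Ylt d"
  by (induction i) (auto simp: mult.assoc intro: Ylt_closed)

lemma Ylt_mono: "x \<in> Ylt d \<Longrightarrow> d \<le> d' \<Longrightarrow> x \<in> Ylt d'"
  by (auto simp: Ylt_def)

lemma Ylt_sum: "(\<And>i. i \<in> A \<Longrightarrow> f i \<in> Ylt d) \<Longrightarrow> sum f A \<in> Ylt d"
  by (induction A rule: infinite_finite_induct) (auto intro: Ylt_closed)

lemma Ylt_exists: "\<exists>d. x \<in> Ylt d"
  by (rule exI[of _ "Suc (degree x)"]) (auto simp: Ylt_def coeff_eq_0)

lemma Ylt_0: "x \<in> Ylt 0 \<longleftrightarrow> x = 0"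
  by (auto simp: Ylt_def poly_eq_iff)

lemma Ylt_degree: "x \<in> Ylt (Suc d) \<Longrightarrow> degree x \<le> d"
  by (auto simp: Ylt_def intro!: degree_le)

lemma Ylt_1: "x \<in> Ylt (Suc 0) \<longleftrightarrow> (\<exists>a. x = [:a:])"
  using degree_eq_zeroE[of x] Ylt_degree[of x 0] by (auto simp: Ylt_def coeff_pCons split: nat.split)

lemma bas_induct [consumes 1, case_names zero add bas]:
  fixes x :: "'k::field poly poly"
  assumes x: "x \<in> Ylt d"
    and zero: "P 0" and add: "\<And>x y. P x \<Longrightarrow> P y \<Longrightarrow> P (x + y)"
    and bas: "\<And>c i j. j < d \<Longrightarrow> P (scP c (bas i j))"
  shows "P x"
proof (cases d)
  case 0
  then show ?thesis using x zero by (simp add: Ylt_0)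
next
  case (Suc n)
  obtain M where M: "\<And>j. degree (coeff x j) \<le> M" using ex_coeff_bound by blast
  have "degree x \<le> n" using x Suc by (simp add: Ylt_degree)
  show ?thesis
    by (subst bas_sum[OF \<open>degree x \<le> n\<close> M])
      (intro sum_induct_closed[where P=P] finite_atMost zero add bas, auto simp: Suc)
qed

definition lin :: "('k::field \<Rightarrow> 'v::ab_group_add \<Rightarrow> 'v) \<Rightarrow> ('k poly poly \<Rightarrow> 'v) \<Rightarrow> bool" where
  "lin sc f \<longleftrightarrow> (\<forall>x y. f (x + y) = f x + f y) \<and> (\<forall>c x. f (scP c x) = sc c (f x))"

lemma linD:
  assumes "lin sc f"
  shows "f (x + y) = f x + f y" "f (scP c x) = sc c (f x)" "f 0 = 0" "f (x - y) = f x - f y" "f (- x) = - f x"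
proof -
  show *: "f (x + y) = f x + f y" "f (scP c x) = sc c (f x)" for x y c using assms by (auto simp: lin_def)
  show "f 0 = 0" using *(1)[of 0 0] by simp
  show "f (x - y) = f x - f y" using *(1)[of "x - y" y] by simp
  show "f (- x) = - f x" using *(1)[of x "- x"] \<open>f 0 = 0\<close> by (simp add: eq_neg_iff_add_eq_0 add.commute)
qed

lemma lin_sum: "lin sc f \<Longrightarrow> f (sum g A) = (\<Sum>i\<in>A. f (g i))"
  by (induction A rule: infinite_finite_induct) (auto simp: linD)

text \<open>The linear maps are compared on all \<open>F\<^sup>iY\<^sup>j\<close> with \<open>j < d\<close> only, since it will matter that an operator on
  \<open>Ylt d\<close> depends on the values \<open>E(Y\<^sup>j)\<close> with \<open>j < d\<close> alone.\<close>
lemma lin_eq_on: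
  assumes "lin sc f" "lin sc g" "\<And>i j. j < d \<Longrightarrow> f (bas i j) = g (bas i j)" "x \<in> Ylt d"
  shows "f x = g x"
  using assms(4)
  by (induction x rule: bas_induct) (auto simp: assms(3) linD[OF assms(1)] linD[OF assms(2)])

lemma lin_eq:
  assumes "lin sc f" "lin sc g" "\<And>i j. f (bas i j) = g (bas i j)"
  shows "f x = g x"
  using lin_eq_on[OF assms(1,2), of _ x] assms(3) Ylt_exists by blast

lemma lin_comp: "lin sc f \<Longrightarrow> lin scP g \<Longrightarrow> lin sc (\<lambda>x. f (g x))"
  by (auto simp: lin_def)

lemma lin_mult: "lin scP (\<lambda>x. a * x)" "lin scP (\<lambda>x. x * a)" 
  by (auto simp: lin_def distrib_left distrib_right scP_cst)

lemma lin_scP: "lin scP (scP c)" 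
  by (auto simp: lin_def scP_cst mult.commute)

lemma lin_add: "lin scP f \<Longrightarrow> lin scP g \<Longrightarrow> lin scP (\<lambda>x. f x + g x)"
  by (auto simp: lin_def scP_cst)

lemma lin_diff: "lin scP f \<Longrightarrow> lin scP g \<Longrightarrow> lin scP (\<lambda>x. f x - g x)"
  by (auto simp: lin_def scP_cst)

lemma lin_id: "lin scP (\<lambda>x. x)"
  by (auto simp: lin_def)

definition lext :: "('k::field \<Rightarrow> 'v::ab_group_add \<Rightarrow> 'v) \<Rightarrow> (nat \<Rightarrow> nat \<Rightarrow> 'v) \<Rightarrow> 'k poly poly \<Rightarrow> 'v" where
  "lext sc f x = (\<Sum>j\<le>degree x. \<Sum>i\<le>degree (coeff x j). sc (coeff (coeff x j) i) (f i j))"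

context vector_space
begin

lemma lext_bounds:
  assumes "degree x \<le> N" "\<And>j. degree (coeff x j) \<le> M"
  shows "lext scale f x = (\<Sum>j\<le>N. \<Sum>i\<le>M. scale (coeff (coeff x j) i) (f i j))"
proof -
  have inner: "(\<Sum>i\<le>degree (coeff x j). scale (coeff (coeff x j) i) (f i j)) =
    (\<Sum>i\<le>M. scale (coeff (coeff x j) i) (f i j))" for j
    using assms(2)[of j] by (intro sum.mono_neutral_left) (auto simp: coeff_eq_0)
  show ?thesis
    unfolding lext_def inner using assms(1)
    by (intro sum.mono_neutral_left) (auto simp: coeff_eq_0)
qed

lemma lin_lext: "lin scale (lext scale f)"
  unfolding lin_def
proof (intro conjI allI)
  fix x y :: "'a poly poly" and c
  obtain M M' where M: "\<And>j. degree (coeff x j) \<le> M" "\<And>j. degree (coeff y j) \<le> M'"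
    using ex_coeff_bound by metis
  define N where "N = max (degree x) (degree y)"
  define L where "L = max M M'"
  have b: "degree x \<le> N" "degree y \<le> N" "degree (x + y) \<le> N"
    "degree (coeff x j) \<le> L" "degree (coeff y j) \<le> L" "degree (coeff (x + y) j) \<le> L"
    "degree (scP c x) \<le> N" "degree (coeff (scP c x) j) \<le> L" for j
  proof -
    show "degree (coeff x j) \<le> L" "degree (coeff y j) \<le> L"
      using M(1)[of j] M(2)[of j] by (auto simp: L_def)
    then show "degree (coeff (x + y) j) \<le> L" by (simp add: degree_add_le)
    show "degree (coeff (scP c x) j) \<le> L"
      using \<open>degree (coeff x j) \<le> L\<close> by (auto intro: order_trans[OF degree_smult_le])
    show "degree (scP c x) \<le> N"
      by (auto simp: scP_def cst_def N_def intro: order_trans[OF degree_smult_le])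
  qed (auto simp: N_def intro: degree_add_le)
  show "lext scale f (x + y) = lext scale f x + lext scale f y"
    by (simp add: lext_bounds[OF b(1) b(4)] lext_bounds[OF b(2) b(5)] lext_bounds[OF b(3) b(6)]
        scale_left_distrib sum.distrib)
  show "lext scale f (scP c x) = scale c (lext scale f x)"
    by (simp add: lext_bounds[OF b(1) b(4)] lext_bounds[OF b(7) b(8)] scale_sum_right)
qed

lemma lext_bas: "lext scale f (bas i j) = f i j"
proof -
  have "lext scale f (bas i j) = (\<Sum>j'\<le>j. \<Sum>i'\<le>i. scale (coeff (coeff (bas i j) j') i') (f i' j'))"
    by (rule lext_bounds) (auto simp: bas_monom degree_monom_eq)
  also have "\<dots> = (\<Sum>j'\<le>j. \<Sum>i'\<le>i. if i' = i then if j' = j then f i' j' else 0 else 0)"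
    by (intro sum.cong refl) (auto simp: coeff_bas)
  also have "\<dots> = f i j" by simp
  finally show ?thesis .
qed

end

lemmas lin_lextP = vector_space.lin_lext[OF vector_space_scP]
lemmas lext_basP = vector_space.lext_bas[OF vector_space_scP]

section \<open>Representations of the quantum group on polynomials\<close>

text \<open>\<open>F\<^sup>iY\<^sup>j\<close> gets weight \<open>q\<^sup>-\<^sup>2\<^sup>i\<^sup>-\<^sup>js\<close>. The inverse of \<open>Kop q s\<close> is \<open>Kop (inverse q) (inverse s)\<close>.\<close>
definition Kop :: "'k::field \<Rightarrow> 'k \<Rightarrow> 'k poly poly \<Rightarrow> 'k poly poly" where
  "Kop q s = lext scP (\<lambda>i j. scP (s * inverse q ^ (2 * i + j)) (bas i j))"

text \<open>The scalar in \<open>EF\<^sup>iv = E_coeff q i x \<cdot> F\<^sup>i\<^sup>-\<^sup>1v\<close> for a highest weight vector \<open>v\<close> of weight \<open>x\<close>, in the form in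
  which it arises by moving \<open>E\<close> past one \<open>F\<close> at a time.\<close>
definition E_coeff :: "'k::field \<Rightarrow> nat \<Rightarrow> 'k \<Rightarrow> 'k" where
  "E_coeff q i x = (\<Sum>l<i. qbrace q (x * inverse q ^ (2 * l)))"

text \<open>For any prescribed values \<open>e j = E(Y\<^sup>j)\<close> of weight \<open>q\<^sup>2\<cdot>q\<^sup>-\<^sup>js\<close> there is exactly one way to extend \<open>E\<close> so that
  \<open>EF - FE\<close> is correct, and this gives a module over the quantum group (\<open>uq_relations\<close>): an
  iterated extension of the Verma modules generated by the powers of \<open>Y\<close>. For \<open>i = 0\<close> the truncated
  exponent \<open>i - 1\<close> is harmless, since its coefficient vanishes.\<close>
definition Eop :: "'k::field \<Rightarrow> 'k \<Rightarrow> (nat \<Rightarrow> 'k poly poly) \<Rightarrow> 'k poly poly \<Rightarrow> 'k poly poly" where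
  "Eop q s e = lext scP (\<lambda>i j. fF ^ i * e j + scP (E_coeff q i (s * inverse q ^ j)) (bas (i - 1) j))"

fun uq_op :: "'k::field \<Rightarrow> 'k \<Rightarrow> (nat \<Rightarrow> 'k poly poly) \<Rightarrow> uq_gen \<Rightarrow> 'k poly poly \<Rightarrow> 'k poly poly" where
  "uq_op q s e gE = Eop q s e"
| "uq_op q s e gF = (\<lambda>x. fF * x)"
| "uq_op q s e gK = Kop q s"
| "uq_op q s e gKi = Kop (inverse q) (inverse s)"

lemma lin_Kop: "lin scP (Kop q s)" and lin_Eop: "lin scP (Eop q s e)"
  unfolding Kop_def Eop_def by (rule lin_lextP)+

lemmas Kop_lin = linD[OF lin_Kop] and Eop_lin = linD[OF lin_Eop]

lemma Kop_bas: "Kop q s (bas i j) = scP (s * inverse q ^ (2 * i + j)) (bas i j)"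
  and Eop_bas: "Eop q s e (bas i j) = fF ^ i * e j + scP (E_coeff q i (s * inverse q ^ j)) (bas (i - 1) j)"
  unfolding Kop_def Eop_def by (rule lext_basP)+

lemma lin_uq_op: "lin scP (uq_op q s e g)"
  by (cases g) (simp_all add: lin_Kop lin_Eop lin_mult)

lemma operators_uq_op: "operators scP (uq_op q s e)"
  by (intro operators.intro vector_space_scP operators_axioms.intro) (simp_all add: linD[OF lin_uq_op])

lemma Kop_mult: "Kop q (s * s') (x * y) = Kop q s x * Kop q s' y"
proof -
  have "Kop q (s * s') (bas i j * y) = Kop q s (bas i j) * Kop q s' y" for i j
  proof (rule lin_eq[where sc=scP and f="\<lambda>y. Kop q (s * s') (bas i j * y)" and g="\<lambda>y. Kop q s (bas i j) * Kop q s' y"])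
    fix i' j' 
    have "bas i j * bas i' j' = (bas (i + i') (j + j') :: 'a poly poly)"
      by (simp add: bas_def power_add algebra_simps)
    then show "Kop q (s * s') (bas i j * bas i' j') = Kop q s (bas i j) * Kop q s' (bas i' j')"
      by (simp add: Kop_bas scP_cst power_add algebra_simps)
  qed (intro lin_comp[OF lin_Kop lin_mult(1)] lin_comp[OF lin_mult(1) lin_Kop])+
  then show ?thesis
    by (intro lin_eq[where sc=scP and f="\<lambda>x. Kop q (s * s') (x * y)" and x=x and g="\<lambda>x. Kop q s x * Kop q s' y"]
      lin_comp[OF lin_Kop lin_mult(2)] lin_comp[OF lin_mult(2) lin_Kop])
qed

lemma Kop_fF: "Kop q s (fF ^ i * x) = scP (inverse q ^ (2 * i)) (fF ^ i * Kop q s x)"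
  using Kop_mult[of q 1 s "bas i 0" x] by (simp add: Kop_bas) (simp add: bas_def scP_cst)

lemma Kop_yY: "Kop q s (yY * x) = scP (inverse q) (yY * Kop q s x)"
  using Kop_mult[of q 1 s "bas 0 1" x] by (simp add: Kop_bas) (simp add: bas_def scP_cst)

lemma Kop_inv: "q \<noteq> 0 \<Longrightarrow> s \<noteq> 0 \<Longrightarrow> Kop q s (Kop (inverse q) (inverse s) x) = x"
  "q \<noteq> 0 \<Longrightarrow> s \<noteq> 0 \<Longrightarrow> Kop (inverse q) (inverse s) (Kop q s x) = x"
  by (rule lin_eq[where sc=scP], intro lin_comp[OF lin_Kop lin_Kop], rule lin_id,
     simp add: Kop_bas Kop_lin scP_cst field_simps)+

lemma Kop_inv_weight:
  assumes "q \<noteq> 0" "s \<noteq> 0" "a \<noteq> 0" "Kop q s x = scP a x"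
  shows "Kop (inverse q) (inverse s) x = scP (inverse a) x"
proof -
  have "x = scP a (Kop (inverse q) (inverse s) x)"
    using Kop_inv(2)[OF assms(1,2), of x] assms(4) by (simp add: Kop_lin)
  then have "scP (inverse a) x = scP (inverse a) (scP a (Kop (inverse q) (inverse s) x))" by simp
  then show ?thesis using assms(3) by (simp add: scP_cst)
qed

lemma E_coeff_Suc: "E_coeff q (Suc i) x = E_coeff q i x + qbrace q (x * inverse q ^ (2 * i))"
  by (simp add: E_coeff_def)

definition weighted :: "'k::field \<Rightarrow> 'k \<Rightarrow> (nat \<Rightarrow> 'k poly poly) \<Rightarrow> bool" where
  "weighted q s e \<longleftrightarrow> (\<forall>j. Kop q s (e j) = scP (q\<^sup>2 * s * inverse q ^ j) (e j))"

lemma uq_EF: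
  assumes "q \<noteq> 0" "s \<noteq> 0"
  shows "Eop q s e (fF * x) - fF * Eop q s e x =
    scP (inverse (q - inverse q)) (Kop q s x - Kop (inverse q) (inverse s) x)"
proof (rule lin_eq[where sc=scP and f="\<lambda>x. Eop q s e (fF * x) - fF * Eop q s e x"
      and g="\<lambda>x. scP (inverse (q - inverse q)) (Kop q s x - Kop (inverse q) (inverse s) x)"])
  fix i j
  have "Eop q s e (fF * bas i j) - fF * Eop q s e (bas i j) =
     scP (qbrace q (s * inverse q ^ j * inverse q ^ (2 * i))) (bas i j)"
  proof (cases i)
    case 0
    then show ?thesis
      by (simp add: fF_bas Eop_bas) (simp add: E_coeff_def bas_def scP_cst algebra_simps)
  next
    case (Suc i')
    have "fF * scP (E_coeff q (Suc i') (s * inverse q ^ j)) (bas i' j) = 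
      scP (E_coeff q (Suc i') (s * inverse q ^ j)) (bas (Suc i') j)"
      by (simp add: scP_cst fF_bas)
    then show ?thesis
      unfolding fF_bas Eop_bas Suc by (simp add: E_coeff_Suc[of q "Suc i'"] scP_left algebra_simps)
  qed
  then show "Eop q s e (fF * bas i j) - fF * Eop q s e (bas i j) =
    scP (inverse (q - inverse q)) (Kop q s (bas i j) - Kop (inverse q) (inverse s) (bas i j))"
    using assms
    by (simp add: Kop_bas scP_cst qbrace_def power_add algebra_simps power_inverse divide_inverse flip: scP_left)
qed (intro lin_diff lin_comp[OF lin_scP] lin_Kop lin_comp[OF lin_mult(1) lin_Eop] lin_comp[OF lin_Eop lin_mult(1)])+

lemma uq_KE:
  assumes "q \<noteq> 0" "s \<noteq> 0" "weighted q s e"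
  shows "Kop q s (Eop q s e x) = scP (q\<^sup>2) (Eop q s e (Kop q s x))"
proof (rule lin_eq[where sc=scP and f="\<lambda>x. Kop q s (Eop q s e x)" and g="\<lambda>x. scP (q\<^sup>2) (Eop q s e (Kop q s x))"])
  fix i j
  have h: "scP (E_coeff q i (s * inverse q ^ j) * (s * inverse q ^ (2 * (i - 1) + j))) (bas (i - 1) j) =
    scP (q\<^sup>2 * (s * inverse q ^ (2 * i + j)) * E_coeff q i (s * inverse q ^ j)) (bas (i - 1) j)"
  proof (cases i)
    case (Suc n)
    have "inverse q ^ (2 * n + j) = q\<^sup>2 * inverse q ^ (2 * Suc n + j)"
      using assms(1) by (simp add: power_add field_simps power2_eq_square)
    then show ?thesis unfolding Suc diff_Suc_1 by (simp only: mult_ac)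
  qed (simp add: E_coeff_def)
  have "Kop q s (Eop q s e (bas i j)) =
    scP (inverse q ^ (2 * i) * (q\<^sup>2 * s * inverse q ^ j)) (fF ^ i * e j) +
    scP (E_coeff q i (s * inverse q ^ j) * (s * inverse q ^ (2 * (i - 1) + j))) (bas (i - 1) j)"
    using assms(3) by (simp add: Eop_bas Kop_lin Kop_fF Kop_bas weighted_def scP_cst)
  then show "Kop q s (Eop q s e (bas i j)) = scP (q\<^sup>2) (Eop q s e (Kop q s (bas i j)))"
    unfolding h by (simp add: Kop_bas Eop_lin Eop_bas scP_cst power_add mult_ac)
qed (intro lin_comp[OF lin_Kop] lin_comp[OF lin_scP] lin_comp[OF lin_Eop] lin_Eop lin_Kop)+

lemma uq_relations:
  assumes q: "q \<noteq> 0" "s \<noteq> 0" "weighted q s e" and p: "p \<in> uq_rels q"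
  shows "ev scP (uq_op q s e) p x = 0"
proof -
  interpret operators scP "uq_op q s e" by (rule operators_uq_op)
  have F: "Kop q s (fF * x) = scP (inverse q ^ 2) (fF * Kop q s x)" for x
    using Kop_fF[of q s 1 x] by simp
  show ?thesis
    using p uq_EF[OF q(1,2), of e x] uq_KE[OF q, of "Kop (inverse q) (inverse s) x"] q(1,2)
    by (auto simp: uq_rels_def uq_rels_at_def Let_def ev_simps Kop_inv F power_int_minus power_inverse)
qed

lemma uq_rel_ideal:
  assumes q: "q \<noteq> 0" "s \<noteq> 0" "weighted q s e" and p: "p \<in> rel_ideal (uq_rels q)"
  shows "ev scP (uq_op q s e) p x = 0"
proof -
  have "ev scP (uq_op q s e) p x \<in> {0}"
    by (rule ev_rel_ideal[OF operators_uq_op stable_UNIV operators.stable_singleton_0[OF operators_uq_op] _ p UNIV_I])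
      (simp add: uq_relations[OF q])
  then show ?thesis by simp
qed

lemma Eop_Ylt:
  assumes "x \<in> Ylt d" "\<And>j. e j \<in> Ylt j"
  shows "Eop q s e x \<in> Ylt d"
  using assms(1)
proof (induction x rule: bas_induct)
  case (bas c i j)
  have "fF ^ i * e j \<in> Ylt d"
    using bas assms(2)[of j] by (intro Ylt_fF_power) (auto intro: Ylt_mono)
  then show ?case using bas by (auto simp: Eop_lin Eop_bas intro!: Ylt_closed)
qed (auto simp: Eop_lin intro: Ylt_closed)

lemma Kop_Ylt: "x \<in> Ylt d \<Longrightarrow> Kop q s x \<in> Ylt d"
  by (induction x rule: bas_induct) (auto simp: Kop_lin Kop_bas intro!: Ylt_closed)

lemma stable_Ylt:
  assumes "\<And>j. e j \<in> Ylt j"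
  shows "stable scP (uq_op q s e) (Ylt d)"
proof (rule stableI)
  fix g and x :: "'a poly poly" assume x: "x \<in> Ylt d"
  then show "uq_op q s e g x \<in> Ylt d"
    by (cases g) (auto intro: Ylt_closed Kop_Ylt Eop_Ylt assms)
qed (auto intro: Ylt_closed)

text \<open>This locality is what makes the recursion below well-founded: the action of \<open>C\<^sub>0\<close> on \<open>Y\<^sup>j\<close> is determined by
  \<open>E(Y\<^sup>i)\<close> for \<open>i \<le> j\<close>.\<close>
lemma ev_uq_op_local:
  assumes e: "\<And>j. e j \<in> Ylt j" and eq: "\<And>j. j < d \<Longrightarrow> e j = e' j" and x: "x \<in> Ylt d"
  shows "ev scP (uq_op q s e) p x = ev scP (uq_op q s e') p x"
proof -
  have "ev scP (uq_op q s e) p x - ev scP (uq_op q s e') p x \<in> {0}"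
  proof (rule ev_intertwine[where \<iota>="\<lambda>x. x" and B="Ylt d", OF operators_uq_op operators_uq_op])
    fix g and x :: "'a poly poly" assume x: "x \<in> Ylt d"
    have "Eop q s e x = Eop q s e' x"
      by (rule lin_eq_on[OF lin_Eop lin_Eop _ x]) (simp add: Eop_bas eq)
    then show "uq_op q s e g x - uq_op q s e' g x \<in> {0}" by (cases g) auto
  qed (use x stable_Ylt[OF e] operators.stable_singleton_0[OF operators_uq_op] in auto)
  then show ?thesis by simp
qed

section \<open>The oscillator action on polynomials\<close>

text \<open>The scalar in \<open>XF\<^sup>i = F\<^sup>iX - XF_coeff q i \<cdot> F\<^sup>i\<^sup>-\<^sup>1YK\<^sup>-\<^sup>1\<close>.\<close>
definition XF_coeff :: "'k::field \<Rightarrow> nat \<Rightarrow> 'k" where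
  "XF_coeff q i = (\<Sum>l<i. q ^ (2 * l))"

text \<open>After step \<open>j\<close> the state holds the values \<open>E(Y\<^sup>i)\<close> for \<open>i \<le> j\<close> and the value \<open>X(Y\<^sup>j)\<close>. The next values are forced by
  \<open>EY = X + q\<^sup>-\<^sup>1YE\<close> and \<open>XY = qYX - C\<^sub>0\<close>; in the second, \<open>C\<^sub>0\<close> acts on \<open>Y\<^sup>j\<close> through the values of \<open>E\<close> found so
  far, those not yet found being set to \<open>0\<close>. The element \<open>c\<close> represents \<open>C\<^sub>0\<close>.\<close>
primrec osc_rec :: "'k::field \<Rightarrow> (uq_gen, 'k) free_alg \<Rightarrow> 'k \<Rightarrow> nat \<Rightarrow> (nat \<Rightarrow> 'k poly poly) \<times> 'k poly poly" where
  "osc_rec q c s 0 = (\<lambda>_. 0, 0)"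
| "osc_rec q c s (Suc j) = (let (e, x) = osc_rec q c s j in
    (e(Suc j := x + scP (inverse q) (yY * e j)),
     scP q (yY * x) - ev scP (uq_op q s e) c (yY ^ j)))"

definition eseq :: "'k::field \<Rightarrow> (uq_gen, 'k) free_alg \<Rightarrow> 'k \<Rightarrow> nat \<Rightarrow> 'k poly poly" where
  "eseq q c s j = fst (osc_rec q c s j) j"

definition xseq :: "'k::field \<Rightarrow> (uq_gen, 'k) free_alg \<Rightarrow> 'k \<Rightarrow> nat \<Rightarrow> 'k poly poly" where
  "xseq q c s j = snd (osc_rec q c s j)"

definition Xop :: "'k::field \<Rightarrow> (uq_gen, 'k) free_alg \<Rightarrow> 'k \<Rightarrow> 'k poly poly \<Rightarrow> 'k poly poly" where
  "Xop q c s = lext scP (\<lambda>i j. fF ^ i * xseq q c s j -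
     scP (XF_coeff q i * q ^ j * inverse s) (bas (i - 1) (Suc j)))"

fun osc_op :: "'k::field \<Rightarrow> (uq_gen, 'k) free_alg \<Rightarrow> 'k \<Rightarrow> osc_gen \<Rightarrow> 'k poly poly \<Rightarrow> 'k poly poly" where
  "osc_op q c s (Uq g) = uq_op q s (eseq q c s) g"
| "osc_op q c s gX = Xop q c s"
| "osc_op q c s gY = (\<lambda>x. yY * x)"

lemma lin_Xop: "lin scP (Xop q c s)"
  unfolding Xop_def by (rule lin_lextP)

lemmas Xop_lin = linD[OF lin_Xop]

lemma Xop_bas: "Xop q c s (bas i j) = fF ^ i * xseq q c s j -
     scP (XF_coeff q i * q ^ j * inverse s) (bas (i - 1) (Suc j))"
  unfolding Xop_def by (rule lext_basP)

lemma lin_osc_op: "lin scP (osc_op q c s g)"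
  by (cases g) (simp_all add: lin_uq_op lin_Xop lin_mult)

lemma operators_osc_op: "operators scP (osc_op q c s)"
  by (intro operators.intro vector_space_scP operators_axioms.intro) (simp_all add: linD[OF lin_osc_op])

lemma XF_coeff_Suc: "XF_coeff q (Suc i) = XF_coeff q i + q ^ (2 * i)" and XF_coeff_0: "XF_coeff q 0 = 0"
  by (simp_all add: XF_coeff_def)

lemma osc_rec_stable: "i \<le> j \<Longrightarrow> fst (osc_rec q c s j) i = eseq q c s i"
proof (induction j)
  case (Suc j)
  then show ?case
    by (cases "i = Suc j") (auto simp: eseq_def Let_def case_prod_beta)
qed (simp add: eseq_def)

text \<open>Centrality of \<open>C\<^sub>0\<close> is expressed for a representative \<open>c\<close> in the free algebra.\<close>
locale osc_param =
  fixes q :: "'k::field" and c :: "(uq_gen, 'k) free_alg"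
  assumes q_neq_0 [simp]: "q \<noteq> 0"
    and q_not_root: "m > 0 \<Longrightarrow> q ^ m \<noteq> 1"
    and central: "c * p - p * c \<in> rel_ideal (uq_rels q)"
begin

lemma central_comm:
  assumes "s \<noteq> 0" "weighted q s e"
  shows "ev scP (uq_op q s e) c (uq_op q s e g x) = uq_op q s e g (ev scP (uq_op q s e) c x)"
proof -
  interpret operators scP "uq_op q s e" by (rule operators_uq_op)
  show ?thesis
    using uq_rel_ideal[OF q_neq_0 assms central, of "gen g" x] by (simp add: ev_simps)
qed

text \<open>The weights have to be carried along in the induction: they ensure that the operators of each step form a
  representation of the quantum group, in which \<open>C\<^sub>0\<close> commutes with \<open>K\<close>, and this gives the weight of
  the next \<open>X(Y\<^sup>j)\<close>.\<close>
lemma osc_rec_props: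
  assumes s: "s \<noteq> 0"
  shows "(\<forall>i. fst (osc_rec q c s j) i \<in> Ylt i) \<and> weighted q s (fst (osc_rec q c s j)) \<and>
    snd (osc_rec q c s j) \<in> Ylt j \<and>
    Kop q s (snd (osc_rec q c s j)) = scP (q * s * inverse q ^ j) (snd (osc_rec q c s j))"
proof (induction j)
  case 0
  then show ?case by (simp add: weighted_def Kop_lin scP_cst)
next
  case (Suc j)
  obtain e x where ex: "osc_rec q c s j = (e, x)" by fastforce
  have e: "\<And>i. e i \<in> Ylt i" and w: "weighted q s e" and x: "x \<in> Ylt j"
    and wx: "Kop q s x = scP (q * s * inverse q ^ j) x"
    using Suc ex by auto
  interpret operators scP "uq_op q s e" by (rule operators_uq_op)
  let ?e' = "x + scP (inverse q) (yY * e j)"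
  have wy: "Kop q s (yY ^ j) = scP (s * inverse q ^ j) (yY ^ j)"
    using Kop_bas[of q s 0 j] by (simp add: bas_def)
  have y: "yY ^ j \<in> (Ylt (Suc j) :: 'k poly poly set)"
    using Ylt_simps(2)[of 0 j "Suc j"] by (simp add: bas_def)
  have "?e' \<in> Ylt (Suc j)"
    using x e[of j] by (auto intro!: Ylt_closed intro: Ylt_mono)
  then have 1: "\<forall>i. (e(Suc j := ?e')) i \<in> Ylt i" using e by simp
  have "Kop q s ?e' = scP (q\<^sup>2 * s * inverse q ^ Suc j) ?e'"
    using w by (simp add: Kop_lin Kop_yY wx weighted_def scP_cst power2_eq_square mult_ac)
      
  then have 2: "weighted q s (e(Suc j := ?e'))" using w by (simp add: weighted_def)
  have 3: "scP q (yY * x) - ev scP (uq_op q s e) c (yY ^ j) \<in> Ylt (Suc j)"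
    using x ev_stable[OF stable_Ylt[OF e] y] by (auto intro!: Ylt_closed)
  have "Kop q s (ev scP (uq_op q s e) c (yY ^ j)) = scP (s * inverse q ^ j) (ev scP (uq_op q s e) c (yY ^ j))"
    using central_comm[OF s w, of gK "yY ^ j"] by (simp add: wy ev_scale_arg)
  then have 4: "Kop q s (scP q (yY * x) - ev scP (uq_op q s e) c (yY ^ j)) =
     scP (q * s * inverse q ^ Suc j) (scP q (yY * x) - ev scP (uq_op q s e) c (yY ^ j))"
    by (simp add: Kop_lin Kop_yY wx scP_cst mult_ac)
  have st: "osc_rec q c s (Suc j) = (e(Suc j := ?e'), scP q (yY * x) - ev scP (uq_op q s e) c (yY ^ j))"
    by (simp add: ex)
  show ?case unfolding st fst_conv snd_conv using 1 2 3 4 by blast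
qed

lemma qbrace_shift: "qbrace q (inverse q * z) - inverse q * qbrace q z = - inverse z"
  if "z \<noteq> 0" "q - inverse q \<noteq> 0"
proof -
  have "qbrace q (inverse q * z) - inverse q * qbrace q z =
    ((inverse q * z - q * inverse z) - inverse q * (z - inverse z)) / (q - inverse q)"
    by (simp add: qbrace_def diff_divide_distrib right_diff_distrib)
  also have "(inverse q * z - q * inverse z) - inverse q * (z - inverse z) = - inverse z * (q - inverse q)"
    by (simp add: algebra_simps)
  finally show ?thesis using that(2) by simp
qed

lemma q_diff [simp]: "q - inverse q \<noteq> 0"
proof
  assume "q - inverse q = 0"
  then have "q ^ 2 = 1" by (simp add: power2_eq_square field_simps)
  then show False using q_not_root[of 2] by simp
qed
end

locale osc_verma_param = osc_param q c for q :: "'k::field" and c +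
  fixes s :: 'k
  assumes s [simp]: "s \<noteq> 0"
begin

abbreviation "e \<equiv> eseq q c s"
abbreviation "x \<equiv> xseq q c s"
abbreviation "E \<equiv> Eop q s e"
abbreviation "K \<equiv> Kop q s"
abbreviation "Ki \<equiv> Kop (inverse q) (inverse s)"
abbreviation "X \<equiv> Xop q c s"
abbreviation "C \<equiv> ev scP (uq_op q s e) c"

lemma e_Ylt: "e j \<in> Ylt j"
  using osc_rec_props[OF s, of j] by (auto simp: eseq_def xseq_def)

lemma weighted_e: "weighted q s e"
proof -
  have "Kop q s (e j) = scP (q\<^sup>2 * s * inverse q ^ j) (e j)" for j
    using osc_rec_props[OF s, of j] by (auto simp: eseq_def weighted_def)
  then show ?thesis by (simp add: weighted_def)
qed

lemma x_weight: "K (x j) = scP (q * s * inverse q ^ j) (x j)"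
  using osc_rec_props[OF s, of j] by (auto simp: xseq_def)

lemma e_0: "e 0 = 0" and x_0: "x 0 = 0"
  by (simp_all add: eseq_def xseq_def)

lemma e_Suc: "e (Suc j) = x j + scP (inverse q) (yY * e j)"
  by (simp add: eseq_def xseq_def Let_def case_prod_beta)

lemma yY_power_Ylt: "yY ^ j \<in> (Ylt (Suc j) :: 'k poly poly set)"
  using Ylt_simps(2)[of 0 j "Suc j"] by (simp add: bas_def)

lemma x_Suc: "x (Suc j) = scP q (yY * x j) - C (yY ^ j)"
proof -
  have "ev scP (uq_op q s (fst (osc_rec q c s j))) c (yY ^ j) = C (yY ^ j)"
    using osc_rec_props[OF s, of j]
    by (intro ev_uq_op_local[OF _ _ yY_power_Ylt]) (auto simp: osc_rec_stable)
  then show ?thesis by (simp add: xseq_def Let_def case_prod_beta)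
qed

interpretation U: operators scP "uq_op q s e" by (rule operators_uq_op)

lemma C_lin: "C (a + b) = C a + C b" "C (a - b) = C a - C b" "C (scP d a) = scP d (C a)"
  by (simp_all add: U.ev_add_arg U.ev_diff_arg U.ev_scale_arg)

lemma lin_C: "lin scP C"
  by (simp add: lin_def C_lin)

lemma C_comm: "C (E a) = E (C a)" "C (fF * a) = fF * C a" "C (K a) = K (C a)" "C (Ki a) = Ki (C a)"
  using central_comm[OF s weighted_e, of gE a] central_comm[OF s weighted_e, of gF a]
    central_comm[OF s weighted_e, of gK a] central_comm[OF s weighted_e, of gKi a]
  by simp_all

lemma E_bas_0: "E (yY ^ j) = e j" and X_bas_0: "X (yY ^ j) = x j"
  using Eop_bas[of q s e 0 j] Xop_bas[of q c s 0 j]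
  by (simp_all add: bas_def E_coeff_def XF_coeff_0 scP_cst)

lemma Ki_bas: "Ki (bas i j) = scP (inverse s * q ^ (2 * i + j)) (bas i j)"
  by (simp add: Kop_bas)

lemma Ki_yY: "Ki (yY * a) = scP q (yY * Ki a)"
  using Kop_yY[of "inverse q" "inverse s" a] by simp

lemma FX: "fF * X a = yY * Ki a + X (fF * a)"
proof (rule lin_eq[where sc=scP and f="\<lambda>a. fF * X a" and g="\<lambda>a. yY * Ki a + X (fF * a)"])
  fix i j
  show "fF * X (bas i j) = yY * Ki (bas i j) + X (fF * bas i j)"
  proof (cases i)
    case 0
    then show ?thesis
      by (simp add: Xop_bas Ki_bas fF_bas yY_bas scP_cst)
        (simp add: bas_def XF_coeff_Suc XF_coeff_0 scP_cst algebra_simps)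
  next
    case (Suc n)
    have "fF * scP z (bas n (Suc j)) = scP z (bas (Suc n) (Suc j))" for z :: 'k
      by (simp add: scP_cst fF_bas)
    then show ?thesis
      unfolding Suc Xop_bas Ki_bas fF_bas diff_Suc_1
      by (simp add: yY_bas scP_cst XF_coeff_Suc[of q "Suc n"] right_diff_distrib distrib_right scP_left power_add)
        (simp add: mult_ac)
  qed
qed (intro lin_add lin_comp[OF lin_mult(1)] lin_comp[OF lin_Xop] lin_mult lin_Xop lin_Kop)+

lemma KX: "K (X a) = scP q (X (K a))"
proof (rule lin_eq[where sc=scP and f="\<lambda>a. K (X a)" and g="\<lambda>a. scP q (X (K a))"])
  fix i j
  have "inverse q ^ (2 * (i - 1) + Suc j) * XF_coeff q i = q * inverse q ^ (2 * i + j) * XF_coeff q i"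
    by (cases i) (auto simp: XF_coeff_0 power_add)
  then have h: "z * inverse q ^ (2 * (i - 1) + Suc j) * XF_coeff q i = z * q * inverse q ^ (2 * i + j) * XF_coeff q i" for z
    by (metis mult.assoc)
  have "K (X (bas i j)) = scP (inverse q ^ (2 * i) * (q * s * inverse q ^ j)) (fF ^ i * x j) -
    scP ((q ^ j * inverse s) * s * inverse q ^ (2 * (i - 1) + Suc j) * XF_coeff q i) (bas (i - 1) (Suc j))"
    by (simp only: Xop_bas Kop_lin Kop_fF x_weight Kop_bas scP_cst mult_ac)
  also have "\<dots> = scP q (X (K (bas i j)))"
    unfolding h by (simp add: Kop_bas Xop_lin Xop_bas scP_cst power_add mult_ac)
  finally show "K (X (bas i j)) = scP q (X (K (bas i j)))" .
qed (intro lin_comp[OF lin_Kop] lin_comp[OF lin_scP] lin_comp[OF lin_Xop] lin_Xop lin_Kop)+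

lemma KiX: "Ki (X a) = scP (inverse q) (X (Ki a))"
proof -
  have "X a = K (scP (inverse q) (X (Ki a)))"
    by (simp add: Kop_lin KX scP_cst Kop_inv)
  then have "Ki (X a) = Ki (K (scP (inverse q) (X (Ki a))))" by simp
  then show ?thesis by (simp only: Kop_inv[OF q_neq_0 s])
qed

lemma KiE: "Ki (E a) = scP (inverse q ^ 2) (E (Ki a))"
proof -
  have "E a = K (scP (inverse q ^ 2) (E (Ki a)))"
    using uq_KE[OF q_neq_0 s weighted_e, of "Ki a"]
    by (simp add: Kop_lin scP_cst Kop_inv power_inverse flip: power_mult_distrib)
  then have "Ki (E a) = Ki (K (scP (inverse q ^ 2) (E (Ki a))))" by simp
  then show ?thesis by (simp only: Kop_inv[OF q_neq_0 s])
qed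

lemma E_coeff_shift: "E_coeff q i (s * inverse q ^ Suc j) + XF_coeff q i * q ^ j * inverse s
    = inverse q * E_coeff q i (s * inverse q ^ j)"
proof -
  have "qbrace q (s * inverse q ^ Suc j * inverse q ^ (2 * l)) + q ^ (2 * l) * q ^ j * inverse s =
    inverse q * qbrace q (s * inverse q ^ j * inverse q ^ (2 * l))" for l
  proof -
    have "qbrace q (inverse q * (s * inverse q ^ j * inverse q ^ (2 * l))) -
      inverse q * qbrace q (s * inverse q ^ j * inverse q ^ (2 * l)) = - inverse (s * inverse q ^ j * inverse q ^ (2 * l))"
      by (rule qbrace_shift[OF _ q_diff]) simp
    moreover have "inverse (s * inverse q ^ j * inverse q ^ (2 * l)) = q ^ (2 * l) * q ^ j * inverse s"
      by (simp add: power_inverse)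
    ultimately show ?thesis by (simp add: mult_ac algebra_simps)
  qed
  then show ?thesis
    by (simp only: E_coeff_def XF_coeff_def sum_distrib_left sum_distrib_right sum.distrib[symmetric])
qed

lemma EY: "E (yY * a) = X a + scP (inverse q) (yY * E a)"
proof (rule lin_eq[where sc=scP and f="\<lambda>a. E (yY * a)" and g="\<lambda>a. X a + scP (inverse q) (yY * E a)"])
  fix i j
  have h: "scP (E_coeff q i (s * inverse q ^ Suc j)) b = scP (inverse q * E_coeff q i (s * inverse q ^ j)) b
      - scP (XF_coeff q i * q ^ j * inverse s) b" for b
    by (simp add: scP_left[symmetric] E_coeff_shift[of i j, symmetric])
  show "E (yY * bas i j) = X (bas i j) + scP (inverse q) (yY * E (bas i j))"
    unfolding yY_bas Eop_bas Xop_bas e_Suc h by (simp add: scP_cst distrib_left yY_bas mult_ac)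
qed (intro lin_add lin_comp[OF lin_scP] lin_comp[OF lin_mult(1)] lin_comp[OF lin_Eop] lin_mult lin_Xop lin_Eop)+

text \<open>Each of the last two relations is the vanishing of an operator that commutes with \<open>F\<close>, and so needs to be
  checked on powers of \<open>Y\<close> only.\<close>
lemma fF_induct:
  assumes f: "lin scP f" and comm: "\<And>a. f (fF * a) = fF * f a" and z: "\<And>j. f (yY ^ j) = 0"
  shows "f a = 0"
proof (rule lin_eq[where sc=scP and f=f and g="\<lambda>_. 0"])
  fix i j
  show "f (bas i j) = 0"
    by (induction i) (simp_all add: comm z fF_bas[symmetric], simp add: bas_def z)
qed (rule f, simp add: lin_def scP_cst)

text \<open>On powers of \<open>Y\<close> this is the recursion for \<open>X(Y\<^sup>j)\<close>. The operator \<open>qYX - XY\<close> commutes with \<open>F\<close> because \<open>[F,X] = YK\<^sup>-\<^sup>1\<close> and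
  \<open>K\<^sup>-\<^sup>1Y = qYK\<^sup>-\<^sup>1\<close>, and \<open>C\<^sub>0\<close> does because it is central.\<close>
lemma YX: "scP q (yY * X a) - X (yY * a) = C a"
proof -
  have "scP q (yY * X a) - X (yY * a) - C a = 0"
  proof (rule fF_induct[where f="\<lambda>a. scP q (yY * X a) - X (yY * a) - C a"])
    fix a
    have 1: "X (fF * b) = fF * X b - yY * Ki b" for b using FX[of b] by simp
    show "scP q (yY * X (fF * a)) - X (yY * (fF * a)) - C (fF * a) =
      fF * (scP q (yY * X a) - X (yY * a) - C a)"
      by (simp add: 1 C_comm Ki_yY mult.left_commute[of yY fF] right_diff_distrib scP_cst)
  next
    fix j show "scP q (yY * X (yY ^ j)) - X (yY * yY ^ j) - C (yY ^ j) = 0"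
      using X_bas_0[of "Suc j"] by (simp add: X_bas_0 x_Suc)
  qed (intro lin_diff lin_comp[OF lin_scP] lin_comp[OF lin_mult(1)] lin_comp[OF lin_Xop] lin_mult lin_Xop lin_C)
  then show ?thesis by simp
qed

text \<open>The only relation that the recursion does not impose. On powers of \<open>Y\<close> it follows by induction from
  \<open>EY = X + q\<^sup>-\<^sup>1YE\<close>, from \<open>qYX - XY = C\<^sub>0\<close>, and from \<open>C\<^sub>0E = EC\<^sub>0\<close>.\<close>
lemma EX: "E (X a) = scP q (X (E a))"
proof -
  have "E (X a) - scP q (X (E a)) = 0"
  proof (rule fF_induct[where f="\<lambda>a. E (X a) - scP q (X (E a))"])
    fix a
    let ?k = "inverse (q - inverse q)"
    have 1: "X (fF * b) = fF * X b - yY * Ki b" for b using FX[of b] by simp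
    have 2: "E (fF * b) = fF * E b + scP ?k (K b - Ki b)" for b
      using uq_EF[OF q_neq_0 s, of e b] by (simp add: algebra_simps)
    have A: "E (X (fF * a)) = fF * E (X a) + scP ?k (K (X a) - Ki (X a)) - X (Ki a) - scP (inverse q) (yY * E (Ki a))"
      by (simp add: 1 2 Eop_lin EY)
    have B: "X (E (fF * a)) = fF * X (E a) - yY * Ki (E a) + scP ?k (X (K a) - X (Ki a))"
      by (simp add: 1 2 Xop_lin)
    have "E (X (fF * a)) - scP q (X (E (fF * a))) = fF * (E (X a) - scP q (X (E a))) +
      (scP (?k * (q - inverse q)) (X (Ki a)) - X (Ki a))"
      unfolding A B by (simp add: KX KiX KiE scP_cst scP_left power2_eq_square algebra_simps)
    then show "E (X (fF * a)) - scP q (X (E (fF * a))) = fF * (E (X a) - scP q (X (E a)))"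
      unfolding left_inverse[OF q_diff] by (simp add: scP_cst)
  next
    fix j show "E (X (yY ^ j)) - scP q (X (E (yY ^ j))) = 0"
    proof (induction j)
      case 0
      then show ?case using X_bas_0[of 0] E_bas_0[of 0] by (simp add: e_0 x_0 Eop_lin Xop_lin scP_cst)
    next
      case (Suc j)
      have ih: "E (x j) = scP q (X (e j))" using Suc by (simp add: E_bas_0 X_bas_0)
      have C: "E (C (yY ^ j)) = scP q (yY * X (e j)) - X (yY * e j)"
        using YX[of "e j"] C_comm(1)[of "yY ^ j"] by (simp add: E_bas_0)
      have "E (x (Suc j)) = scP q (X (x j)) + scP q (yY * X (e j)) - E (C (yY ^ j))"
        by (simp add: x_Suc Eop_lin EY ih scP_cst)
      also have "\<dots> = scP q (X (e (Suc j)))"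
        by (simp add: C e_Suc Xop_lin scP_cst)
      finally show ?case by (simp only: E_bas_0 X_bas_0) simp
    qed
  qed (intro lin_diff lin_comp[OF lin_scP] lin_comp[OF lin_Xop] lin_comp[OF lin_Eop] lin_Xop lin_Eop)
  then show ?thesis by simp
qed

end

context osc_param
begin

lemma verma_param: "s \<noteq> 0 \<Longrightarrow> osc_verma_param q c s"
  by (simp add: osc_verma_param_def osc_verma_param_axioms_def osc_param_axioms)

lemmas e_Ylt = osc_verma_param.e_Ylt[OF verma_param]
  and weighted_e = osc_verma_param.weighted_e[OF verma_param]
  and e_0 = osc_verma_param.e_0[OF verma_param] and x_0 = osc_verma_param.x_0[OF verma_param]
  and yY_power_Ylt = osc_verma_param.yY_power_Ylt[OF verma_param]
  and E_bas_0 = osc_verma_param.E_bas_0[OF verma_param] and X_bas_0 = osc_verma_param.X_bas_0[OF verma_param]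
  and FX = osc_verma_param.FX[OF verma_param] and KX = osc_verma_param.KX[OF verma_param]
  and EY = osc_verma_param.EY[OF verma_param] and YX = osc_verma_param.YX[OF verma_param]
  and EX = osc_verma_param.EX[OF verma_param]

end

section \<open>Universal properties of the polynomial modules\<close>

text \<open>Universal properties are needed for quotients of modules by submodules that are given as subspaces, so
  equations in the target are replaced by congruences modulo a stable \<open>D\<close>.\<close>
locale operators_mod = operators sc T
  for sc :: "'k::field \<Rightarrow> 'v::ab_group_add \<Rightarrow> 'v" and T :: "'g \<Rightarrow> 'v \<Rightarrow> 'v" +
  fixes D :: "'v set"
  assumes D: "stable sc T D"
begin

definition eqv :: "'v \<Rightarrow> 'v \<Rightarrow> bool" (infix \<open>\<approx>\<close> 50) where "x \<approx> y \<longleftrightarrow> x - y \<in> D"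

lemma eqv_refl [simp]: "x \<approx> x"
  using stableD(1)[OF D] by (simp add: eqv_def)

lemma eqv_sym: "x \<approx> y \<Longrightarrow> y \<approx> x"
  using stable_uminus[OF D, of "x - y"] by (simp add: eqv_def)

lemma eqv_trans [trans]: "x \<approx> y \<Longrightarrow> y \<approx> z \<Longrightarrow> x \<approx> z"
  using stableD(2)[OF D, of "x - y" "y - z"] by (simp add: eqv_def)

lemma eqv_eq_trans [trans]: "x \<approx> y \<Longrightarrow> y = z \<Longrightarrow> x \<approx> z" "x = y \<Longrightarrow> y \<approx> z \<Longrightarrow> x \<approx> z"
  by simp_all

lemma eqv_add: "x \<approx> y \<Longrightarrow> x' \<approx> y' \<Longrightarrow> x + x' \<approx> y + y'"
  using stableD(2)[OF D, of "x - y" "x' - y'"] by (simp add: eqv_def algebra_simps)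

lemma eqv_diff: "x \<approx> y \<Longrightarrow> x' \<approx> y' \<Longrightarrow> x - x' \<approx> y - y'"
  using stable_minus[OF D, of "x - y" "x' - y'"] by (simp add: eqv_def algebra_simps)

lemma eqv_scale: "x \<approx> y \<Longrightarrow> sc c x \<approx> sc c y"
  using stableD(3)[OF D, of "x - y" c] by (simp add: eqv_def scale_right_diff_distrib)

lemma eqv_T: "x \<approx> y \<Longrightarrow> T g x \<approx> T g y"
  using stableD(4)[OF D, of "x - y" g] by (simp add: eqv_def T_diff)

lemmas eqv_cong = eqv_add eqv_diff eqv_scale eqv_T

end

lemma yY_fF_induct [consumes 1, case_names zero add scale fF yY]:
  fixes x :: "'k::field poly poly"
  assumes x: "x \<in> Ylt d"
    and zero: "P 0" and add: "\<And>x y. P x \<Longrightarrow> P y \<Longrightarrow> P (x + y)" and scale: "\<And>c x. P x \<Longrightarrow> P (scP c x)"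
    and fF: "\<And>x. x \<in> Ylt d \<Longrightarrow> P x \<Longrightarrow> P (fF * x)" and yY: "\<And>j. j < d \<Longrightarrow> P (yY ^ j)"
  shows "P x"
proof -
  have "P (bas i j)" if "j < d" for i j
  proof (induction i)
    case 0
    show ?case using yY[OF that] by (simp add: bas_def)
  next
    case (Suc i)
    then show ?case using that unfolding fF_bas[symmetric] by (intro fF) simp_all
  qed
  with x show ?thesis
    by (induction x rule: bas_induct) (auto intro: zero add scale)
qed

text \<open>A linear map \<open>\<iota>\<close> that commutes with \<open>F\<close> into a module over the quantum group. The lemmas say that it commutes with
  \<open>K\<close>, \<open>K\<^sup>-\<^sup>1\<close> and \<open>E\<close> on \<open>Fx\<close> if it does so on \<open>x\<close>. The set \<open>B\<close> is where commutation with \<open>K\<close> is already known.\<close>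
locale uq_target = operators_mod sc T D
  for sc :: "'k::field \<Rightarrow> 'v::ab_group_add \<Rightarrow> 'v" and T :: "uq_gen \<Rightarrow> 'v \<Rightarrow> 'v" and D +
  fixes q s :: 'k and e :: "nat \<Rightarrow> 'k poly poly" and \<iota> :: "'k poly poly \<Rightarrow> 'v" and B :: "'k poly poly set"
  assumes qs [simp]: "q \<noteq> 0" "s \<noteq> 0" and we: "weighted q s e"
    and rels: "\<And>p x. p \<in> uq_rels q \<Longrightarrow> ev sc T p x \<in> D"
    and \<iota>: "lin sc \<iota>" and \<iota>_fF: "\<And>x. \<iota> (fF * x) = T gF (\<iota> x)"
    and B: "\<And>x. x \<in> B \<Longrightarrow> Kop (inverse q) (inverse s) x \<in> B"
begin

lemmas \<iota>_lin = linD[OF \<iota>]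

lemma uq_eqv:
  "T gK (T gKi x) \<approx> x" "T gKi (T gK x) \<approx> x"
  "T gK (T gF x) \<approx> sc (inverse q ^ 2) (T gF (T gK x))"
  "T gE (T gF x) \<approx> T gF (T gE x) + sc (inverse (q - inverse q)) (T gK x - T gKi x)"
proof -
  have r: "ev sc T (gen gK * gen gKi - 1) y \<in> D" "ev sc T (gen gKi * gen gK - 1) y \<in> D"
    "ev sc T (gen gK * gen gF * gen gKi - scal (q powi (-2)) * gen gF) y \<in> D"
    "ev sc T (gen gE * gen gF - gen gF * gen gE - scal (inverse (q - inverse q)) * (gen gK - gen gKi)) y \<in> D" for y
    by (rule rels, simp add: uq_rels_def uq_rels_at_def Let_def)+
  show KK: "T gK (T gKi x) \<approx> x" "T gKi (T gK x) \<approx> x" for x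
    using r(1,2)[of x] by (simp_all add: ev_simps eqv_def)
  have "T gK (T gF x) \<approx> T gK (T gF (T gKi (T gK x)))"
    by (intro eqv_T eqv_sym[OF KK(2)])
  also have "\<dots> \<approx> sc (inverse q ^ 2) (T gF (T gK x))"
    using r(3)[of "T gK x"] by (simp add: ev_simps eqv_def power_int_minus power_inverse)
  finally show "T gK (T gF x) \<approx> sc (inverse q ^ 2) (T gF (T gK x))" .
  show "T gE (T gF x) \<approx> T gF (T gE x) + sc (inverse (q - inverse q)) (T gK x - T gKi x)"
    using r(4)[of x] by (simp add: ev_simps eqv_def algebra_simps)
qed

lemma step_K: 
  assumes "\<iota> (Kop q s x) \<approx> T gK (\<iota> x)"
  shows "\<iota> (Kop q s (fF * x)) \<approx> T gK (\<iota> (fF * x))"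
proof -
  have "\<iota> (Kop q s (fF * x)) = sc (inverse q ^ 2) (T gF (\<iota> (Kop q s x)))"
    using Kop_fF[of q s 1 x] by (simp add: \<iota>_lin \<iota>_fF)
  also have "\<dots> \<approx> sc (inverse q ^ 2) (T gF (T gK (\<iota> x)))"
    using assms by (intro eqv_cong)
  also have "\<dots> \<approx> T gK (T gF (\<iota> x))" by (rule eqv_sym[OF uq_eqv(3)])
  finally show ?thesis by (simp add: \<iota>_fF)
qed

lemma step_Ki:
  assumes K: "\<And>x. x \<in> B \<Longrightarrow> \<iota> (Kop q s x) \<approx> T gK (\<iota> x)" and x: "x \<in> B"
  shows "\<iota> (Kop (inverse q) (inverse s) x) \<approx> T gKi (\<iota> x)"
proof -
  let ?x' = "Kop (inverse q) (inverse s) x"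
  have "\<iota> ?x' \<approx> T gKi (T gK (\<iota> ?x'))" by (rule eqv_sym[OF uq_eqv(2)])
  also have "\<dots> \<approx> T gKi (\<iota> (Kop q s ?x'))" by (intro eqv_T eqv_sym[OF K] B x)
  finally show ?thesis by (simp add: Kop_inv)
qed

lemma step_E:
  assumes "\<iota> (Kop q s x) \<approx> T gK (\<iota> x)" "\<iota> (Kop (inverse q) (inverse s) x) \<approx> T gKi (\<iota> x)"
    "\<iota> (Eop q s e x) \<approx> T gE (\<iota> x)"
  shows "\<iota> (Eop q s e (fF * x)) \<approx> T gE (\<iota> (fF * x))"
proof -
  have "Eop q s e (fF * x) = fF * Eop q s e x + 
      scP (inverse (q - inverse q)) (Kop q s x - Kop (inverse q) (inverse s) x)"
    using uq_EF[OF qs, of e x] by (simp add: algebra_simps)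
  then have "\<iota> (Eop q s e (fF * x)) = T gF (\<iota> (Eop q s e x)) +
      sc (inverse (q - inverse q)) (\<iota> (Kop q s x) - \<iota> (Kop (inverse q) (inverse s) x))"
    by (simp add: \<iota>_lin \<iota>_fF)
  also have "\<dots> \<approx> T gF (T gE (\<iota> x)) + sc (inverse (q - inverse q)) (T gK (\<iota> x) - T gKi (\<iota> x))"
    using assms by (intro eqv_cong)
  also have "\<dots> \<approx> T gE (T gF (\<iota> x))" by (rule eqv_sym[OF uq_eqv(4)])
  finally show ?thesis by (simp add: \<iota>_fF)
qed

end

definition hw_map :: "('k::field \<Rightarrow> 'v::ab_group_add \<Rightarrow> 'v) \<Rightarrow> ('v \<Rightarrow> 'v) \<Rightarrow> ('v \<Rightarrow> 'v) \<Rightarrow> 'v \<Rightarrow> 'k poly poly \<Rightarrow> 'v" where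
  "hw_map sc F Y w = lext sc (\<lambda>i j. (F ^^ i) ((Y ^^ j) w))"

context operators
begin

lemma lin_hw_map: "lin sc (hw_map sc F Y w)"
  unfolding hw_map_def by (rule lin_lext)

lemma hw_map_bas: "hw_map sc F Y w (bas i j) = (F ^^ i) ((Y ^^ j) w)"
  unfolding hw_map_def by (rule lext_bas)

lemma hw_map_1: "hw_map sc F Y w 1 = w"
  using hw_map_bas[of F Y w 0 0] by simp

lemma lin_T: "lin sc f \<Longrightarrow> lin sc (\<lambda>x. T g (f x))"
  by (simp add: lin_def T_add T_scale)

lemma hw_map_fF: "hw_map sc (T g) Y w (fF * x) = T g (hw_map sc (T g) Y w x)"
  by (rule lin_eq[where sc=sc and f="\<lambda>x. hw_map sc (T g) Y w (fF * x)" and g="\<lambda>x. T g (hw_map sc (T g) Y w x)"])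
    (intro lin_comp[OF lin_hw_map lin_mult(1)] lin_T lin_hw_map | simp add: fF_bas hw_map_bas)+

lemma hw_map_yY: "hw_map sc F Y w (yY ^ j) = (Y ^^ j) w"
  using hw_map_bas[of F Y w 0 j] by (simp add: bas_def)

end

text \<open>On \<open>k[F]\<close> the representation is the Verma module of the quantum group. The value of \<open>hw_map\<close> there does not involve
  the operator \<open>Y\<close>.\<close>
lemma uq_universal:
  fixes sc :: "'k::field \<Rightarrow> 'v::ab_group_add \<Rightarrow> 'v"
  assumes T: "operators sc T" "stable sc T D" and q: "q \<noteq> 0" "s \<noteq> 0" and e: "weighted q s e" "e 0 = 0"
    and rels: "\<And>p x. p \<in> uq_rels q \<Longrightarrow> ev sc T p x \<in> D"
    and w: "T gE w \<in> D" "T gK w - sc s w \<in> D"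
    and x: "x \<in> Ylt 1"
  shows "hw_map sc (T gF) Y w (uq_op q s e g x) - T g (hw_map sc (T gF) Y w x) \<in> D"
proof -
  interpret operators sc T by fact
  interpret uq_target sc T D q s e "hw_map sc (T gF) Y w" "Ylt 1"
    by unfold_locales (use T q e rels in \<open>auto simp: lin_hw_map hw_map_fF intro: Kop_Ylt\<close>)
  let ?i = "hw_map sc (T gF) Y w"
  have one: "yY ^ j = 1" if "j < 1" for j :: nat using that by simp
  have K: "?i (Kop q s x) \<approx> T gK (?i x)" if "x \<in> Ylt 1" for x
    using that
  proof (induction x rule: yY_fF_induct)
    fix j :: nat assume "j < 1"
    have "?i (Kop q s 1) = sc s w" using Kop_bas[of q s 0 0] by (simp add: \<iota>_lin hw_map_1)
    also have "\<dots> \<approx> T gK (?i 1)" by (rule eqv_sym) (use w(2) in \<open>simp add: eqv_def hw_map_1\<close>)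
    finally show "?i (Kop q s (yY ^ j)) \<approx> T gK (?i (yY ^ j))" using \<open>j < 1\<close> by simp
  qed (auto simp: Kop_lin \<iota>_lin T_add T_scale T_zero intro: eqv_cong step_K)
  have Ki: "?i (Kop (inverse q) (inverse s) x) \<approx> T gKi (?i x)" if "x \<in> Ylt 1" for x
    by (rule step_Ki[OF K that])
  have E: "?i (Eop q s e x) \<approx> T gE (?i x)" if "x \<in> Ylt 1" for x
    using that
  proof (induction x rule: yY_fF_induct)
    fix j :: nat assume "j < 1"
    have E1: "Eop q s e 1 = 0" using Eop_bas[of q s e 0 0] e(2) by (simp add: E_coeff_def scP_cst)
    have "?i (Eop q s e 1) \<approx> T gE (?i 1)"
      by (rule eqv_sym) (use w(1) in \<open>simp add: E1 eqv_def \<iota>_lin hw_map_1\<close>)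
    then show "?i (Eop q s e (yY ^ j)) \<approx> T gE (?i (yY ^ j))" using \<open>j < 1\<close> by simp
  next
    fix x assume "x \<in> Ylt 1" "?i (Eop q s e x) \<approx> T gE (?i x)"
    then show "?i (Eop q s e (fF * x)) \<approx> T gE (?i (fF * x))" by (intro step_E K Ki)
  qed (auto simp: Eop_lin \<iota>_lin T_add T_scale T_zero intro: eqv_cong)
  have "?i (uq_op q s e g x) \<approx> T g (?i x)"
    using K[OF x] Ki[OF x] E[OF x] by (cases g) (auto simp: \<iota>_fF)
  then show ?thesis by (simp add: eqv_def)
qed

lemma uq_rels_at_map: "uq_rels_at (\<lambda>g. gen (f g)) q = free_map f ` uq_rels q"
  by (simp add: uq_rels_def uq_rels_at_def Let_def free_map_simps free_map_mult)

context osc_param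
begin

abbreviation "rels \<equiv> osc_rels q (cls (uq_rels q) c)"

lemma osc_relations:
  assumes s: "s \<noteq> 0" and p: "p \<in> rels"
  shows "ev scP (osc_op q c s) p x = 0"
proof -
  interpret operators scP "osc_op q c s" by (rule operators_osc_op)
  have uq: "ev scP (osc_op q c s) (free_map Uq u) x = ev scP (uq_op q s (eseq q c s)) u x" for u x
    by (subst ev_free_map[OF operators_osc_op]) simp
  consider "p \<in> free_map Uq ` uq_rels q" | c' where "c' \<in> cls (uq_rels q) c"
      "p = scal q * gen gY * gen gX - gen gX * gen gY - free_map Uq c'" |
      "p \<in> {gen (Uq gE) * gen gX - scal q * gen gX * gen (Uq gE),
     gen (Uq gE) * gen gY - (gen gX + scal (inverse q) * gen gY * gen (Uq gE)),
     gen (Uq gF) * gen gX - (gen gY * gen (Uq gKi) + gen gX * gen (Uq gF)),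
     gen (Uq gF) * gen gY - gen gY * gen (Uq gF),
     gen (Uq gK) * gen gX * gen (Uq gKi) - scal q * gen gX,
     gen (Uq gK) * gen gY * gen (Uq gKi) - scal (inverse q) * gen gY}"
    using p unfolding osc_rels_def Let_def uq_rels_at_map by blast
  then show ?thesis
  proof cases
    case 1
    then show ?thesis using uq_relations[OF q_neq_0 s weighted_e[OF s]] by (auto simp: uq)
  next
    case 2
    have "ev scP (uq_op q s (eseq q c s)) (c' - c) x = 0"
      using 2(1) uq_rel_ideal[OF q_neq_0 s weighted_e[OF s]] by (simp add: mem_cls_iff)
    then have "ev scP (uq_op q s (eseq q c s)) c' x = ev scP (uq_op q s (eseq q c s)) c x"
      by (simp add: operators.ev_minus[OF operators_uq_op])
    then show ?thesis using YX[OF s, of x] by (simp add: 2 ev_simps uq)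
  next
    case 3
    have "scP q (Xop q c s (Kop q s (Kop (inverse q) (inverse s) x))) = scP q (Xop q c s x)"
      by (simp add: Kop_inv s)
    with 3 show ?thesis
      using EX[OF s, of x] EY[OF s, of x] FX[OF s, of x] KX[OF s]
      by (auto simp: ev_simps Kop_yY Kop_inv s mult.left_commute[of fF yY])
  qed
qed

text \<open>For \<open>F\<close>, \<open>Y\<close> and \<open>K\<close> the claim is immediate from the commutation relations. For \<open>E\<close> and \<open>X\<close> it is proved simultaneously on
  the filtration by degree in \<open>Y\<close>, since each of the two relations that express \<open>E(Y\<^sup>j\<^sup>+\<^sup>1)\<close> and \<open>X(Y\<^sup>j\<^sup>+\<^sup>1)\<close> by lower
  terms holds in the target too. In the step for \<open>X\<close> the map must commute with \<open>C\<^sub>0\<close> on \<open>Y\<^sup>j\<close>, which is the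
  induction hypothesis for \<open>E\<close> on everything of degree at most \<open>j\<close>.\<close>
lemma osc_universal:
  fixes sc :: "'k \<Rightarrow> 'v::ab_group_add \<Rightarrow> 'v"
  assumes T: "operators sc T" "stable sc T D" and s: "s \<noteq> 0"
    and rels: "\<And>p x. p \<in> rels \<Longrightarrow> ev sc T p x \<in> D"
    and w: "T (Uq gE) w \<in> D" "T gX w \<in> D" "T (Uq gK) w - sc s w \<in> D"
  shows "hw_map sc (T (Uq gF)) (T gY) w (osc_op q c s g x) - T g (hw_map sc (T (Uq gF)) (T gY) w x) \<in> D"
proof -
  interpret O: operators sc T by fact
  let ?i = "hw_map sc (T (Uq gF)) (T gY) w"
  let ?e = "eseq q c s" and ?Ki = "Kop (inverse q) (inverse s)"
  have ops: "operators sc (\<lambda>g. T (Uq g))"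
    by unfold_locales (simp_all add: O.T_add O.T_scale)
  have stU: "stable sc (\<lambda>g. T (Uq g)) D"
    using T(2) by (simp add: stable_def)
  have evU: "ev sc T (free_map Uq p) x = ev sc (\<lambda>g. T (Uq g)) p x" for p x
    by (rule ev_free_map[OF T(1)])
  have relU: "ev sc (\<lambda>g. T (Uq g)) p x \<in> D" if "p \<in> uq_rels q" for p x
  proof -
    have "free_map Uq p \<in> rels" using that unfolding osc_rels_def Let_def uq_rels_at_map by blast
    then show ?thesis using rels evU by metis
  qed
  have fF: "?i (fF * x) = T (Uq gF) (?i x)" for x by (rule O.hw_map_fF)
  interpret V: uq_target sc "\<lambda>g. T (Uq g)" D q s ?e ?i UNIV
    by (intro uq_target.intro uq_target_axioms.intro operators_mod.intro operators_mod_axioms.intro ops stU)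
      (use s weighted_e[OF s] relU in \<open>auto simp: O.lin_hw_map fF\<close>)
  note step_K = V.step_K and step_Ki = V.step_Ki and step_E = V.step_E and uq_eqv = V.uq_eqv
  note eqv_def = V.eqv_def and eqv_sym = V.eqv_sym and eqv_refl = V.eqv_refl
  have eqv_T: "V.eqv x y \<Longrightarrow> V.eqv (T g x) (T g y)" for g x y
    using stableD(4)[OF T(2), of "x - y" g] by (simp add: eqv_def O.T_diff)
  note eqv_cong = V.eqv_add V.eqv_diff V.eqv_scale eqv_T
  note T_zero = O.T_zero and T_add = O.T_add and T_scale = O.T_scale and ev_simps = O.ev_simps
    and hw_map_1 = O.hw_map_1 and hw_map_yY = O.hw_map_yY
  note lins = V.\<iota>_lin
  have r: "ev sc T (gen (Uq gE) * gen gY - (gen gX + scal (inverse q) * gen gY * gen (Uq gE))) y \<in> D"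
     "ev sc T (gen (Uq gF) * gen gX - (gen gY * gen (Uq gKi) + gen gX * gen (Uq gF))) y \<in> D"
     "ev sc T (gen (Uq gF) * gen gY - gen gY * gen (Uq gF)) y \<in> D"
     "ev sc T (gen (Uq gK) * gen gY * gen (Uq gKi) - scal (inverse q) * gen gY) y \<in> D"
     "ev sc T (scal q * gen gY * gen gX - gen gX * gen gY - free_map Uq c) y \<in> D" for y
    by (rule rels, unfold osc_rels_def Let_def, use cls_self[of c "uq_rels q"] in blast)+
  have EY: "T (Uq gE) (T gY y) \<approx> T gX y + sc (inverse q) (T gY (T (Uq gE) y))"
    and FX: "T gX (T (Uq gF) y) \<approx> T (Uq gF) (T gX y) - T gY (T (Uq gKi) y)"
    and FY: "T (Uq gF) (T gY y) \<approx> T gY (T (Uq gF) y)"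
    and KY0: "T (Uq gK) (T gY (T (Uq gKi) y)) \<approx> sc (inverse q) (T gY y)"
    and YX: "T gX (T gY y) \<approx> sc q (T gY (T gX y)) - ev sc (\<lambda>g. T (Uq g)) c y" for y
    using r(1)[of y] eqv_sym[of "T (Uq gF) (T gX y) - T gY (T (Uq gKi) y)" "T gX (T (Uq gF) y)"] r(2)[of y]
      r(3)[of y] r(4)[of y] r(5)[of y]
      eqv_sym[of "sc q (T gY (T gX y)) - ev sc (\<lambda>g. T (Uq g)) c y" "T gX (T gY y)"]
    by (simp_all add: eqv_def ev_simps evU algebra_simps)
  have KY: "T (Uq gK) (T gY y) \<approx> sc (inverse q) (T gY (T (Uq gK) y))" for y
  proof -
    have "T (Uq gK) (T gY y) \<approx> T (Uq gK) (T gY (T (Uq gKi) (T (Uq gK) y)))"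
      by (intro eqv_T eqv_sym[OF uq_eqv(2)])
    also have "\<dots> \<approx> sc (inverse q) (T gY (T (Uq gK) y))" by (rule KY0)
    finally show ?thesis .
  qed
  have ind: "P x" if "P 0" "\<And>x y. P x \<Longrightarrow> P y \<Longrightarrow> P (x + y)" "\<And>c x. P x \<Longrightarrow> P (scP c x)"
      "\<And>x. P x \<Longrightarrow> P (fF * x)" "\<And>j. P (yY ^ j)" for P and x :: "'k poly poly"
  proof -
    obtain d where "x \<in> Ylt d" using Ylt_exists by blast
    then show ?thesis by (induction x rule: yY_fF_induct) (use that in simp_all)
  qed
  have Y: "?i (yY * x) \<approx> T gY (?i x)" for x
  proof (induction x rule: ind)
    case (4 x)
    have "?i (yY * (fF * x)) = T (Uq gF) (?i (yY * x))" by (simp add: mult.left_commute[of yY] fF)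
    also have "\<dots> \<approx> T (Uq gF) (T gY (?i x))" by (intro eqv_T 4)
    also have "\<dots> \<approx> T gY (T (Uq gF) (?i x))" by (rule FY)
    finally show ?case by (simp add: fF)
  next
    case (5 j)
    then show ?case using hw_map_yY[of _ _ _ "Suc j"] by (simp add: hw_map_yY)
  qed (auto simp: lins T_zero T_add T_scale distrib_left scP_cst intro: eqv_cong)
  have K: "?i (Kop q s x) \<approx> T (Uq gK) (?i x)" for x
  proof (induction x rule: ind)
    case (5 j)
    show ?case
    proof (induction j)
      case 0
      have "?i (Kop q s 1) = sc s w" using Kop_bas[of q s 0 0] by (simp add: lins hw_map_1)
      also have "\<dots> \<approx> T (Uq gK) (?i 1)" by (rule eqv_sym) (use w(3) in \<open>simp add: eqv_def hw_map_1\<close>)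
      finally show ?case by simp
    next
      case (Suc j)
      have "?i (Kop q s (yY * yY ^ j)) = sc (inverse q) (?i (yY * Kop q s (yY ^ j)))"
        by (simp add: Kop_yY lins)
      also have "\<dots> \<approx> sc (inverse q) (T gY (?i (Kop q s (yY ^ j))))" by (intro eqv_cong Y)
      also have "\<dots> \<approx> sc (inverse q) (T gY (T (Uq gK) (?i (yY ^ j))))" by (intro eqv_cong Suc)
      also have "\<dots> \<approx> T (Uq gK) (T gY (?i (yY ^ j)))" by (rule eqv_sym[OF KY])
      also have "\<dots> \<approx> T (Uq gK) (?i (yY * yY ^ j))" by (intro eqv_cong eqv_sym[OF Y])
      finally show ?case by simp
    qed
  qed (auto simp: Kop_lin lins T_zero T_add T_scale intro: eqv_cong step_K)
  have Ki: "?i (?Ki x) \<approx> T (Uq gKi) (?i x)" for x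
    by (rule step_Ki[OF K UNIV_I])
  have EX_fF: "?i (Xop q c s (fF * x)) \<approx> T gX (?i (fF * x))" if "?i (Xop q c s x) \<approx> T gX (?i x)" for x
  proof -
    have "Xop q c s (fF * x) = fF * Xop q c s x - yY * ?Ki x" using osc_param.FX[OF osc_param_axioms s, of x] by simp
    then have "?i (Xop q c s (fF * x)) = T (Uq gF) (?i (Xop q c s x)) - ?i (yY * ?Ki x)"
      by (simp add: lins fF)
    also have "\<dots> \<approx> T (Uq gF) (T gX (?i x)) - T gY (?i (?Ki x))" by (intro eqv_cong that Y)
    also have "\<dots> \<approx> T (Uq gF) (T gX (?i x)) - T gY (T (Uq gKi) (?i x))" by (intro eqv_cong Ki eqv_refl)
    also have "\<dots> \<approx> T gX (T (Uq gF) (?i x))" by (rule eqv_sym[OF FX])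
    finally show ?thesis by (simp add: fF)
  qed
  have EX: "\<forall>x\<in>Ylt d. ?i (Eop q s ?e x) \<approx> T (Uq gE) (?i x) \<and> ?i (Xop q c s x) \<approx> T gX (?i x)" for d
  proof (induction d)
    case 0
    show ?case by (simp add: Ylt_0 Eop_lin Xop_lin lins T_zero)
  next
    case (Suc d)
    have y: "?i (Eop q s ?e (yY ^ d)) \<approx> T (Uq gE) (?i (yY ^ d)) \<and> ?i (Xop q c s (yY ^ d)) \<approx> T gX (?i (yY ^ d))"
    proof (cases d)
      case 0
      have "Eop q s ?e 1 = 0" "Xop q c s 1 = 0"
        using E_bas_0[OF s, of 0] X_bas_0[OF s, of 0] by (simp_all add: e_0[OF s] x_0[OF s])
      then show ?thesis
        using w(1,2) 0 eqv_sym[of _ 0] by (simp add: lins hw_map_1) (simp add: eqv_def)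
    next
      case (Suc d')
      have y': "(yY ^ d' :: 'k poly poly) \<in> Ylt d" unfolding Suc by (rule yY_power_Ylt[OF s])
      note IH = Suc.IH[rule_format, OF y']
      let ?y = "yY ^ d'"
      have "?i (Eop q s ?e (yY * ?y)) = ?i (Xop q c s ?y) + sc (inverse q) (?i (yY * Eop q s ?e ?y))"
        by (simp add: osc_param.EY[OF osc_param_axioms s] lins)
      also have "\<dots> \<approx> T gX (?i ?y) + sc (inverse q) (T gY (?i (Eop q s ?e ?y)))"
        using IH by (intro eqv_cong Y) auto
      also have "\<dots> \<approx> T gX (?i ?y) + sc (inverse q) (T gY (T (Uq gE) (?i ?y)))"
        using IH by (intro eqv_cong eqv_refl) auto
      also have "\<dots> \<approx> T (Uq gE) (T gY (?i ?y))" by (rule eqv_sym[OF EY])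
      also have "\<dots> \<approx> T (Uq gE) (?i (yY * ?y))" by (intro eqv_cong eqv_sym[OF Y])
      finally have 1: "?i (Eop q s ?e (yY * ?y)) \<approx> T (Uq gE) (?i (yY * ?y))" .
      have C: "?i (ev scP (uq_op q s ?e) c ?y) \<approx> ev sc (\<lambda>g. T (Uq g)) c (?i ?y)"
        unfolding eqv_def
      proof (rule ev_intertwine[where \<iota>="?i" and B="Ylt d", OF operators_uq_op ops stable_Ylt[OF e_Ylt[OF s]] stU])
        fix g and x :: "'k poly poly" assume "x \<in> Ylt d"
        then have "?i (uq_op q s ?e g x) \<approx> T (Uq g) (?i x)"
          using Suc.IH K Ki by (cases g) (auto simp: fF)
        then show "?i (uq_op q s ?e g x) - T (Uq g) (?i x) \<in> D" by (simp add: eqv_def)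
      qed (simp_all add: lins y')
      have "Xop q c s (yY * ?y) = scP q (yY * Xop q c s ?y) - ev scP (uq_op q s ?e) c ?y"
        using osc_param.YX[OF osc_param_axioms s, of ?y] by (simp add: algebra_simps)
      then have "?i (Xop q c s (yY * ?y)) = sc q (?i (yY * Xop q c s ?y)) - ?i (ev scP (uq_op q s ?e) c ?y)"
        by (simp add: lins)
      also have "\<dots> \<approx> sc q (T gY (?i (Xop q c s ?y))) - ev sc (\<lambda>g. T (Uq g)) c (?i ?y)"
        by (intro eqv_cong Y C)
      also have "\<dots> \<approx> sc q (T gY (T gX (?i ?y))) - ev sc (\<lambda>g. T (Uq g)) c (?i ?y)"
        using IH by (intro eqv_cong eqv_refl) auto
      also have "\<dots> \<approx> T gX (T gY (?i ?y))" by (rule eqv_sym[OF YX])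
      also have "\<dots> \<approx> T gX (?i (yY * ?y))" by (intro eqv_cong eqv_sym[OF Y])
      finally have 2: "?i (Xop q c s (yY * ?y)) \<approx> T gX (?i (yY * ?y))" .
      show ?thesis using 1 2 Suc by simp
    qed
    show ?case
    proof
      fix x :: "'k poly poly" assume "x \<in> Ylt (Suc d)"
      then show "?i (Eop q s ?e x) \<approx> T (Uq gE) (?i x) \<and> ?i (Xop q c s x) \<approx> T gX (?i x)"
      proof (induction x rule: yY_fF_induct)
        fix j assume "j < Suc d"
        show "?i (Eop q s ?e (yY ^ j)) \<approx> T (Uq gE) (?i (yY ^ j)) \<and> ?i (Xop q c s (yY ^ j)) \<approx> T gX (?i (yY ^ j))"
        proof (cases "j = d")
          case False
          then have "(yY ^ j :: 'k poly poly) \<in> Ylt d" using yY_power_Ylt[OF s, of j] \<open>j < Suc d\<close> by (auto intro: Ylt_mono)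
          then show ?thesis using Suc.IH by blast
        qed (simp add: y)
      qed (auto simp: Eop_lin Xop_lin lins T_zero T_add T_scale intro: eqv_cong step_E K Ki EX_fF)
    qed
  qed
  obtain d where "x \<in> Ylt d" using Ylt_exists by blast
  have "?i (osc_op q c s g x) \<approx> T g (?i x)"
  proof (cases g)
    case (Uq u)
    then show ?thesis using EX[of d] \<open>x \<in> Ylt d\<close> K Ki by (cases u) (auto simp: fF)
  qed (use EX[of d] \<open>x \<in> Ylt d\<close> Y in auto)
  then show ?thesis by (simp add: eqv_def)
qed

end

section \<open>Verma modules as polynomial modules\<close>

text \<open>To identify a module that is a quotient of the free algebra by a left ideal \<open>D\<close> with a cyclic module on \<open>B\<close>,
  one needs that \<open>D\<close> kills the generator \<open>w\<close> and that representatives \<open>\<iota> x\<close> with \<open>(\<iota> x)w = x\<close> can be chosen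
  equivariantly modulo \<open>D\<close>. Then \<open>p \<equiv> \<iota>(pw)\<close> modulo \<open>D\<close> for all \<open>p\<close>, so no basis of the algebra is
  needed.\<close>
lemma models_cyclic:
  assumes M: "models free_scale (free_op (\<lambda>g. g)) S UNIV D \<pi>0 M"
    and ops: "operators sc T" and B: "stable sc T B" and w: "w \<in> B"
    and add: "\<And>x y. x \<in> B \<Longrightarrow> y \<in> B \<Longrightarrow> \<iota> (x + y) = \<iota> x + \<iota> y"
    and scale: "\<And>a x. x \<in> B \<Longrightarrow> \<iota> (sc a x) = free_scale a (\<iota> x)"
    and intertw: "\<And>g x. x \<in> B \<Longrightarrow> \<iota> (T g x) - free_op (\<lambda>g. g) g (\<iota> x) \<in> D"
    and one: "\<iota> w = 1"
    and kill: "\<And>p. p \<in> D \<Longrightarrow> ev sc T p w = 0"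
    and inv: "\<And>x. x \<in> B \<Longrightarrow> ev sc T (\<iota> x) w = x"
  shows "models sc T S B {0} (\<lambda>x. \<pi>0 (\<iota> x)) M"
proof -
  interpret operators sc T by fact
  have ev: "\<iota> (ev sc T p x) - p * \<iota> x \<in> D" if "x \<in> B" for p x
    using ev_intertwine[where \<iota>=\<iota> and B=B and x=x, OF ops modelsD(1)[OF M] B modelsD(3)[OF M] add scale intertw that]
    by (simp add: ev_free_self)
  have eq: "\<pi>0 p = \<pi>0 p' \<longleftrightarrow> p - p' \<in> D" for p p' using modelsD(9)[OF M] by simp
  have diff: "\<iota> (x - y) = \<iota> x - \<iota> y" if "x \<in> B" "y \<in> B" for x y
    using add[of "x - y" y] that stable_minus[OF B] by simp
  have zero: "\<iota> 0 = 0" using diff[OF w w] by simp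
  have onto: "\<pi>0 p = \<pi>0 (\<iota> (ev sc T p w))" for p
    using ev[OF w, of p] eq[of "\<iota> (ev sc T p w)" p] by (simp add: one)
  have carr: "carrier M = (\<lambda>x. \<pi>0 (\<iota> x)) ` B"
    using onto ev_stable[OF B w] by (auto simp: modelsD(5)[OF M])
  have inj: "\<pi>0 (\<iota> x) = \<pi>0 (\<iota> y) \<longleftrightarrow> x - y \<in> {0}" if "x \<in> B" "y \<in> B" for x y
  proof
    assume "\<pi>0 (\<iota> x) = \<pi>0 (\<iota> y)"
    then have "\<iota> (x - y) \<in> D" using that by (simp add: eq diff)
    then have "ev sc T (\<iota> (x - y)) w = 0" by (rule kill)
    then show "x - y \<in> {0}" using inv[of "x - y"] that stable_minus[OF B] by simp
  qed simp
  have smult: "cls S p \<odot>\<^bsub>M\<^esub> \<pi>0 (\<iota> x) = \<pi>0 (\<iota> (ev sc T p x))" if "x \<in> B" for p x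
    using ev[OF that, of p] eq[of "\<iota> (ev sc T p x)" "p * \<iota> x"] modelsD(8)[OF M, of "\<iota> x" p]
    by (simp add: ev_free_self)
  show ?thesis
    unfolding models_def
    using ops B w stable_singleton_0 stableD(1)[OF B] carr inj smult zero add modelsD(6,7)[OF M] by simp
qed

lemma left_ideal_model:
  fixes S :: "('g, 'k::field) free_alg set"
  assumes D: "rel_ideal S \<subseteq> D" "\<And>x y. x \<in> D \<Longrightarrow> y \<in> D \<Longrightarrow> x + y \<in> D" "\<And>x z. x \<in> D \<Longrightarrow> z * x \<in> D"
    and N: "N = cls S ` D"
  shows "models free_scale (free_op (\<lambda>g. g)) S UNIV D (\<lambda>p. N +>\<^bsub>regular_module (presented S)\<^esub> cls S p)
    (quotient_module (regular_module (presented S)) N)"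
  unfolding N using D rel_ideal_props(1)[of S]
  by (intro models_quotient[OF models_regular]) (auto simp: stable_def free_scale_def free_op_def)

lemma funpow_free_op:
  assumes "operators sc T"
  shows "ev sc T (((free_op (\<lambda>g. g) g) ^^ i) p) x = (T g ^^ i) (ev sc T p x)"
  by (induction i) (simp_all add: free_op_def operators.ev_gen_mult[OF assms])

lemma (in operators) ev_free_scale: "ev sc T (free_scale a p) x = sc a (ev sc T p x)"
  by (simp add: free_scale_def ev_scal_mult)

lemma funpow_times: "((\<lambda>x. a * x) ^^ i) (y :: 'a::monoid_mult) = a ^ i * y"
  by (induction i) (simp_all add: mult.assoc)

lemma weighted_0: "weighted q s (\<lambda>_. 0)"
  by (simp add: weighted_def Kop_lin scP_cst)

lemma Ylt_1_1 [simp]: "1 \<in> Ylt (Suc 0)"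
  using Ylt_simps(2)[of 0 0 "Suc 0"] by simp

text \<open>The Verma module of the quantum group is \<open>k[F]\<close>, here with \<open>E(Y\<^sup>j) = 0\<close>, a choice that is invisible on \<open>k[F]\<close>
  except for \<open>E(1) = 0\<close>.\<close>
lemma models_uq_verma:
  assumes q: "q \<noteq> 0" "s \<noteq> 0"
  obtains \<pi> where "models scP (uq_op q s (\<lambda>_. 0)) (uq_rels q) (Ylt 1) {0} \<pi> (uq_verma q s)"
proof -
  let ?S = "uq_rels q" and ?T = "uq_op q s (\<lambda>_. 0)"
  define D where "D = {p. \<exists>a b. p - (a * gen gE + b * (gen gK - scal s)) \<in> rel_ideal ?S}"
  define N where "N = {a \<otimes>\<^bsub>uq q\<^esub> cls ?S (gen gE) \<oplus>\<^bsub>uq q\<^esub> b \<otimes>\<^bsub>uq q\<^esub> cls ?S (gen gK - scal s) |a b.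
        a \<in> carrier (uq q) \<and> b \<in> carrier (uq q)}"
  have D: "rel_ideal ?S \<subseteq> D" "\<And>x y. x \<in> D \<Longrightarrow> y \<in> D \<Longrightarrow> x + y \<in> D" "\<And>x z. x \<in> D \<Longrightarrow> z * x \<in> D"
  proof -
    have "p - (0 * gen gE + 0 * (gen gK - scal s)) \<in> rel_ideal ?S" if "p \<in> rel_ideal ?S" for p
      using that by simp
    then show "rel_ideal ?S \<subseteq> D" unfolding D_def by blast
    show "x + y \<in> D" if xy: "x \<in> D" "y \<in> D" for x y
    proof -
      obtain a b a' b' where "x - (a * gen gE + b * (gen gK - scal s)) \<in> rel_ideal ?S"
        "y - (a' * gen gE + b' * (gen gK - scal s)) \<in> rel_ideal ?S" using xy by (auto simp: D_def)
      from rel_ideal_props(2)[OF this]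
      have "(x + y) - ((a + a') * gen gE + (b + b') * (gen gK - scal s)) \<in> rel_ideal ?S"
        by (simp add: algebra_simps)
      then show ?thesis unfolding D_def by blast
    qed
    show "z * x \<in> D" if x: "x \<in> D" for x z
    proof -
      obtain a b where "x - (a * gen gE + b * (gen gK - scal s)) \<in> rel_ideal ?S" using x by (auto simp: D_def)
      from rel_ideal_props(3)[OF this, of z]
      have "z * x - ((z * a) * gen gE + (z * b) * (gen gK - scal s)) \<in> rel_ideal ?S"
        by (simp add: algebra_simps)
      then show ?thesis unfolding D_def by blast
    qed
  qed
  have ND: "N = cls ?S ` D"
  proof -
    have "N = {cls ?S (a * gen gE + b * (gen gK - scal s)) |a b. True}"
    proof (intro Set.set_eqI iffI)
      fix x assume "x \<in> N"
      then obtain a b where "x = cls ?S a \<otimes>\<^bsub>presented ?S\<^esub> cls ?S (gen gE) \<oplus>\<^bsub>presented ?S\<^esub> cls ?S b \<otimes>\<^bsub>presented ?S\<^esub> cls ?S (gen gK - scal s)"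
        unfolding N_def uq_def carrier_presented by blast
      then show "x \<in> {cls ?S (a * gen gE + b * (gen gK - scal s)) |a b. True}" by (auto simp: presented_mult presented_add)
    next
      fix x assume "x \<in> {cls ?S (a * gen gE + b * (gen gK - scal s)) |a b. True}"
      then obtain a b where "x = cls ?S (a * gen gE + b * (gen gK - scal s))" by blast
      then have "x = cls ?S a \<otimes>\<^bsub>presented ?S\<^esub> cls ?S (gen gE) \<oplus>\<^bsub>presented ?S\<^esub> cls ?S b \<otimes>\<^bsub>presented ?S\<^esub> cls ?S (gen gK - scal s)"
        by (simp add: presented_mult presented_add)
      then show "x \<in> N" unfolding N_def uq_def carrier_presented by blast
    qed
    also have "\<dots> = cls ?S ` D"
    proof -
      have "(a * gen gE + b * (gen gK - scal s)) - (a * gen gE + b * (gen gK - scal s)) \<in> rel_ideal ?S" for a b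
        using rel_ideal_props(1)[of ?S] by (simp only: diff_self)
      then have "a * gen gE + b * (gen gK - scal s) \<in> D" for a b unfolding D_def by blast
      then show ?thesis by (auto simp: D_def cls_eq_iff image_iff) blast
    qed
    finally show ?thesis .
  qed
  note M = left_ideal_model[OF D ND]
  have verma: "uq_verma q s = quotient_module (regular_module (presented ?S)) N"
    by (simp add: uq_verma_def N_def Let_def uq_def)
  let ?F = "free_op (\<lambda>g::uq_gen. g)"
  let ?i = "hw_map free_scale (?F gF) (\<lambda>x. x) 1"
  interpret Q: operators scP ?T by (rule operators_uq_op)
  interpret FA: operators free_scale ?F by (rule operators_free)
  have E1: "Eop q s (\<lambda>_. 0) 1 = 0" using Eop_bas[of q s "\<lambda>_. 0" 0 0] by (simp add: E_coeff_def scP_cst)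
  have K1: "Kop q s 1 = scP s 1" using Kop_bas[of q s 0 0] by simp
  have "models scP ?T ?S (Ylt 1) {0} (\<lambda>x. N +>\<^bsub>regular_module (presented ?S)\<^esub> cls ?S (?i x)) (uq_verma q s)"
    unfolding verma
  proof (rule models_cyclic[where w=1, OF M operators_uq_op])
    show "stable scP ?T (Ylt 1)" by (rule stable_Ylt) simp
    fix g and x :: "'a poly poly" assume x: "x \<in> Ylt 1"
    show "?i (?T g x) - ?F g (?i x) \<in> D"
    proof (rule uq_universal[OF operators_free modelsD(3)[OF M] q weighted_0 refl _ _ _ x])
      show "ev free_scale ?F p x \<in> D" if "p \<in> uq_rels q" for p x
        using that D(1) rel_ideal_props(4,5)[of _ ?S] by (auto simp: ev_free_self)
      have "?F gE 1 - (1 * gen gE + 0 * (gen gK - scal s)) \<in> rel_ideal ?S"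
        using rel_ideal_props(1)[of ?S] by (simp add: free_op_def)
      then show "?F gE 1 \<in> D" unfolding D_def by blast
      have "?F gK 1 - free_scale s 1 - (0 * gen gE + 1 * (gen gK - scal s)) \<in> rel_ideal ?S"
        using rel_ideal_props(1)[of ?S] by (simp add: free_op_def free_scale_def)
      then show "?F gK 1 - free_scale s 1 \<in> D" unfolding D_def by blast
    qed
  next
    fix p assume "p \<in> D"
    then obtain a b where ab: "p - (a * gen gE + b * (gen gK - scal s)) \<in> rel_ideal ?S" by (auto simp: D_def)
    have "ev scP ?T (p - (a * gen gE + b * (gen gK - scal s))) 1 = 0"
      by (rule uq_rel_ideal[OF q weighted_0 ab])
    then show "ev scP ?T p 1 = 0" by (simp add: Q.ev_simps E1 K1 Q.ev_zero_arg)
  next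
    fix x :: "'a poly poly" assume "x \<in> Ylt 1"
    then show "ev scP ?T (?i x) 1 = x"
    proof (induction x rule: bas_induct)
      case (bas a i j)
      then show ?case
        by (simp add: linD(2)[OF FA.lin_hw_map] FA.hw_map_bas funpow_free_op[OF operators_uq_op]
            Q.ev_free_scale Q.ev_one funpow_times) (simp add: bas_def)
    qed (simp_all add: linD[OF FA.lin_hw_map] Q.ev_simps)
  qed (simp_all add: linD[OF FA.lin_hw_map] FA.hw_map_1)
  then show thesis by (rule that)
qed

context osc_param
begin

abbreviation "C0 \<equiv> cls (uq_rels q) c"

lemma models_osc_verma:
  assumes s: "s \<noteq> 0"
  obtains \<pi> where "models scP (osc_op q c s) rels UNIV {0} \<pi> (osc_verma q C0 s)"
proof -
  let ?S = "rels" and ?T = "osc_op q c s"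
  let ?E = "gen (Uq gE)" and ?X = "gen gX" and ?K = "gen (Uq gK) - scal s"
  let ?R = "osc q C0"
  define D where "D = {p. \<exists>a b d. p - (a * ?E + b * ?X + d * ?K) \<in> rel_ideal ?S}"
  define N where "N = {a \<otimes>\<^bsub>?R\<^esub> cls ?S ?E \<oplus>\<^bsub>?R\<^esub> b \<otimes>\<^bsub>?R\<^esub> cls ?S ?X \<oplus>\<^bsub>?R\<^esub> d \<otimes>\<^bsub>?R\<^esub> cls ?S ?K |a b d.
        a \<in> carrier ?R \<and> b \<in> carrier ?R \<and> d \<in> carrier ?R}"
  have D: "rel_ideal ?S \<subseteq> D" "\<And>x y. x \<in> D \<Longrightarrow> y \<in> D \<Longrightarrow> x + y \<in> D" "\<And>x z. x \<in> D \<Longrightarrow> z * x \<in> D"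
  proof -
    have "p - (0 * ?E + 0 * ?X + 0 * ?K) \<in> rel_ideal ?S" if "p \<in> rel_ideal ?S" for p
      using that by simp
    then show "rel_ideal ?S \<subseteq> D" unfolding D_def by blast
    show "x + y \<in> D" if xy: "x \<in> D" "y \<in> D" for x y
    proof -
      obtain a b d a' b' d' where "x - (a * ?E + b * ?X + d * ?K) \<in> rel_ideal ?S"
        "y - (a' * ?E + b' * ?X + d' * ?K) \<in> rel_ideal ?S" using xy by (auto simp: D_def)
      from rel_ideal_props(2)[OF this]
      have "(x + y) - ((a + a') * ?E + (b + b') * ?X + (d + d') * ?K) \<in> rel_ideal ?S"
        by (simp add: algebra_simps)
      then show ?thesis unfolding D_def by blast
    qed
    show "z * x \<in> D" if x: "x \<in> D" for x z
    proof -
      obtain a b d where "x - (a * ?E + b * ?X + d * ?K) \<in> rel_ideal ?S" using x by (auto simp: D_def)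
      from rel_ideal_props(3)[OF this, of z]
      have "z * x - ((z * a) * ?E + (z * b) * ?X + (z * d) * ?K) \<in> rel_ideal ?S"
        by (simp add: algebra_simps)
      then show ?thesis unfolding D_def by blast
    qed
  qed
  have ND: "N = cls ?S ` D"
  proof -
    have "N = {cls ?S (a * ?E + b * ?X + d * ?K) |a b d. True}"
    proof (intro Set.set_eqI iffI)
      fix x assume "x \<in> N"
      then obtain a b d where "x = cls ?S a \<otimes>\<^bsub>presented ?S\<^esub> cls ?S ?E \<oplus>\<^bsub>presented ?S\<^esub> cls ?S b \<otimes>\<^bsub>presented ?S\<^esub> cls ?S ?X \<oplus>\<^bsub>presented ?S\<^esub> cls ?S d \<otimes>\<^bsub>presented ?S\<^esub> cls ?S ?K"
        unfolding N_def osc_def carrier_presented by blast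
      then show "x \<in> {cls ?S (a * ?E + b * ?X + d * ?K) |a b d. True}" by (auto simp: presented_mult presented_add)
    next
      fix x assume "x \<in> {cls ?S (a * ?E + b * ?X + d * ?K) |a b d. True}"
      then obtain a b d where "x = cls ?S (a * ?E + b * ?X + d * ?K)" by blast
      then have "x = cls ?S a \<otimes>\<^bsub>presented ?S\<^esub> cls ?S ?E \<oplus>\<^bsub>presented ?S\<^esub> cls ?S b \<otimes>\<^bsub>presented ?S\<^esub> cls ?S ?X \<oplus>\<^bsub>presented ?S\<^esub> cls ?S d \<otimes>\<^bsub>presented ?S\<^esub> cls ?S ?K"
        by (simp add: presented_mult presented_add)
      then show "x \<in> N" unfolding N_def osc_def carrier_presented by blast
    qed
    also have "\<dots> = cls ?S ` D"
    proof -
      have "(a * ?E + b * ?X + d * ?K) - (a * ?E + b * ?X + d * ?K) \<in> rel_ideal ?S" for a b d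
        using rel_ideal_props(1)[of ?S] by (simp only: diff_self)
      then have "a * ?E + b * ?X + d * ?K \<in> D" for a b d unfolding D_def by blast
      then show ?thesis by (auto simp: D_def cls_eq_iff image_iff) blast
    qed
    finally show ?thesis .
  qed
  note M = left_ideal_model[OF D ND]
  have verma: "osc_verma q C0 s = quotient_module (regular_module (presented ?S)) N"
    by (simp add: osc_verma_def N_def Let_def osc_def)
  let ?F = "free_op (\<lambda>g::osc_gen. g)"
  let ?i = "hw_map free_scale (?F (Uq gF)) (?F gY) 1"
  interpret Q: operators scP ?T by (rule operators_osc_op)
  interpret FA: operators free_scale ?F by (rule operators_free)
  have E1: "Eop q s (eseq q c s) 1 = 0" and X1: "Xop q c s 1 = 0"
    using E_bas_0[OF s, of 0] X_bas_0[OF s, of 0] by (simp_all add: e_0[OF s] x_0[OF s])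
  have K1: "Kop q s 1 = scP s 1" using Kop_bas[of q s 0 0] by simp
  have "models scP ?T ?S UNIV {0} (\<lambda>x. N +>\<^bsub>regular_module (presented ?S)\<^esub> cls ?S (?i x)) (osc_verma q C0 s)"
    unfolding verma
  proof (rule models_cyclic[where w=1, OF M operators_osc_op stable_UNIV UNIV_I])
    fix g and x :: "'k poly poly"
    show "?i (?T g x) - ?F g (?i x) \<in> D"
    proof (rule osc_universal[OF operators_free modelsD(3)[OF M] s])
      show "ev free_scale ?F p x \<in> D" if "p \<in> rels" for p x
        using that D(1) rel_ideal_props(4,5)[of _ ?S] by (auto simp: ev_free_self)
      have "?F (Uq gE) 1 - (1 * ?E + 0 * ?X + 0 * ?K) \<in> rel_ideal ?S"
        using rel_ideal_props(1)[of ?S] by (simp add: free_op_def)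
      then show "?F (Uq gE) 1 \<in> D" unfolding D_def by blast
      have "?F gX 1 - (0 * ?E + 1 * ?X + 0 * ?K) \<in> rel_ideal ?S"
        using rel_ideal_props(1)[of ?S] by (simp add: free_op_def)
      then show "?F gX 1 \<in> D" unfolding D_def by blast
      have "?F (Uq gK) 1 - free_scale s 1 - (0 * ?E + 0 * ?X + 1 * ?K) \<in> rel_ideal ?S"
        using rel_ideal_props(1)[of ?S] by (simp add: free_op_def free_scale_def)
      then show "?F (Uq gK) 1 - free_scale s 1 \<in> D" unfolding D_def by blast
    qed
  next
    fix p assume "p \<in> D"
    then obtain a b d where ab: "p - (a * ?E + b * ?X + d * ?K) \<in> rel_ideal ?S" by (auto simp: D_def)
    have "ev scP ?T (p - (a * ?E + b * ?X + d * ?K)) 1 \<in> {0}"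
      by (rule ev_rel_ideal[OF operators_osc_op stable_UNIV Q.stable_singleton_0 _ ab UNIV_I])
        (simp add: osc_relations[OF s])
    then show "ev scP ?T p 1 = 0" by (simp add: Q.ev_simps E1 X1 K1 Q.ev_zero_arg)
  next
    fix x :: "'k poly poly"
    show "ev scP ?T (?i x) 1 = x"
    proof (rule lin_eq[where sc=scP and f="\<lambda>x. ev scP ?T (?i x) 1" and g="\<lambda>x. x"])
      fix i j
      show "ev scP ?T (?i (bas i j)) 1 = bas i j"
        by (simp add: FA.hw_map_bas funpow_free_op[OF operators_osc_op] Q.ev_one funpow_times)
          (simp add: bas_def)
    qed (simp_all add: lin_def linD[OF FA.lin_hw_map] Q.ev_plus Q.ev_free_scale)
  qed (simp_all add: linD[OF FA.lin_hw_map] FA.hw_map_1)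
  then show thesis by (rule that)
qed

section \<open>Weights and the central scalar\<close>

lemma inv_power_inj: "inverse q ^ a = inverse q ^ b \<longleftrightarrow> a = b"
proof -
  have "a = b" if "inverse q ^ a = inverse q ^ b" "a \<le> b" for a b
  proof (rule ccontr)
    assume "a \<noteq> b"
    then obtain n where n: "b = a + n" "n > 0" using \<open>a \<le> b\<close> le_Suc_ex by fastforce
    then have "inverse q ^ n = 1" using that by (simp add: power_add)
    then have "q ^ n = 1" by (simp add: power_inverse)
    then show False using q_not_root[OF n(2)] by simp
  qed
  then show ?thesis by (metis linear)
qed

lemma coeff_Kop: "coeff (coeff (Kop q s x) j) i = s * inverse q ^ (2 * i + j) * coeff (coeff x j) i"
  by (rule lin_eq[where sc="(*)" and f="\<lambda>x. coeff (coeff (Kop q s x) j) i"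
      and g="\<lambda>x. s * inverse q ^ (2 * i + j) * coeff (coeff x j) i"])
    (auto simp: lin_def Kop_lin Kop_bas coeff_bas algebra_simps)

lemma weight_vector_coeff:
  assumes s: "s \<noteq> 0" and K: "Kop q s x = scP (s * inverse q ^ d) x" and nz: "coeff (coeff x j) i \<noteq> 0"
  shows "2 * i + j = d"
proof -
  have "s * inverse q ^ (2 * i + j) * coeff (coeff x j) i = s * inverse q ^ d * coeff (coeff x j) i"
    using arg_cong[OF K, of "\<lambda>x. coeff (coeff x j) i"] by (simp add: coeff_Kop)
  then show ?thesis using s nz inv_power_inj by simp
qed

definition cscalar :: "'k \<Rightarrow> 'k" where
  "cscalar s = coeff (coeff (ev scP (uq_op q s (\<lambda>_. 0)) c 1) 0) 0"

text \<open>\<open>C\<^sub>0\<close> commutes with \<open>K\<close>, and the weight space of \<open>1\<close> consists of the constants, because \<open>q\<close> is not a root of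
  unity.\<close>
lemma C_1:
  assumes s: "s \<noteq> 0"
  shows "ev scP (uq_op q s (\<lambda>_. 0)) c 1 = scP (cscalar s) 1"
proof (rule poly_eqI, rule poly_eqI)
  fix j i
  interpret Q: operators scP "uq_op q s (\<lambda>_. 0)" by (rule operators_uq_op)
  let ?y = "ev scP (uq_op q s (\<lambda>_. 0)) c 1"
  have K1: "Kop q s 1 = scP s 1" using Kop_bas[of q s 0 0] by simp
  have "Kop q s ?y = scP (s * inverse q ^ 0) ?y"
    using central_comm[OF s weighted_0, of gK 1] by (simp add: K1 Q.ev_scale_arg)
  then have "i = 0 \<and> j = 0" if "coeff (coeff ?y j) i \<noteq> 0"
    using weight_vector_coeff[OF s _ that, of 0] by simp
  then show "coeff (coeff ?y j) i = coeff (coeff (scP (cscalar s) 1) j) i"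
    by (cases "i = 0 \<and> j = 0") (auto simp: cscalar_def coeff_1 simp flip: one_pCons)
qed

lemma C_Ylt_1:
  assumes s: "s \<noteq> 0" and x: "x \<in> Ylt 1"
  shows "ev scP (uq_op q s (\<lambda>_. 0)) c x = scP (cscalar s) x"
proof -
  interpret Q: operators scP "uq_op q s (\<lambda>_. 0)" by (rule operators_uq_op)
  have comm: "ev scP (uq_op q s (\<lambda>_. 0)) c (fF * y) = fF * ev scP (uq_op q s (\<lambda>_. 0)) c y" for y
    using central_comm[OF s weighted_0, of gF y] by simp
  show ?thesis using x
    by (induction x rule: yY_fF_induct)
      (simp_all add: Q.ev_zero_arg Q.ev_add_arg Q.ev_scale_arg comm C_1[OF s] scP_cst mult.commute[of "cscalar s"])
qed

lemma central_scalar: 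
  assumes s: "s \<noteq> 0"
  shows "central_scalar q C0 s = cscalar s"
proof -
  obtain \<pi> where M: "models scP (uq_op q s (\<lambda>_. 0)) (uq_rels q) (Ylt 1) {0} \<pi> (uq_verma q s)"
    using models_uq_verma[OF q_neq_0 s] .
  interpret Q: operators scP "uq_op q s (\<lambda>_. 0)" by (rule operators_uq_op)
  have act: "C0 \<odot>\<^bsub>uq_verma q s\<^esub> \<pi> x = \<pi> (scP (cscalar s) x)"
    "cls (uq_rels q) (scal a) \<odot>\<^bsub>uq_verma q s\<^esub> \<pi> x = \<pi> (scP a x)" if "x \<in> Ylt 1" for x a
    using that by (simp_all add: modelsD(8)[OF M] C_Ylt_1[OF s] Q.ev_scal)
  show ?thesis
    unfolding central_scalar_def
  proof (rule the_equality)
    fix a assume a: "\<forall>v\<in>carrier (uq_verma q s). C0 \<odot>\<^bsub>uq_verma q s\<^esub> v = cls (uq_rels q) (scal a) \<odot>\<^bsub>uq_verma q s\<^esub> v"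
    have 1: "(1 :: 'k poly poly) \<in> Ylt 1" by simp
    then have "\<pi> (scP (cscalar s) 1) = \<pi> (scP a 1)"
      using a act[OF 1] by (auto simp: modelsD(5)[OF M])
    then have "scP (cscalar s) 1 - scP a 1 \<in> {0}"
      using 1 by (subst modelsD(9)[OF M, symmetric]) (auto intro!: Ylt_closed)
    then have "scP (cscalar s - a) 1 = 0" by (simp add: scP_left)
    then show "a = cscalar s" by simp
  qed (use act in \<open>auto simp: modelsD(5)[OF M]\<close>)
qed

lemma hw_map_mult: "hw_map scP (\<lambda>x. fF * x) (\<lambda>x. yY * x) w x = x * w"
proof (rule lin_eq[where sc=scP and f="hw_map scP (\<lambda>x. fF * x) (\<lambda>x. yY * x) w" and g="\<lambda>x. x * w"])
  fix i j
  show "hw_map scP (\<lambda>x. fF * x) (\<lambda>x. yY * x) w (bas i j) = bas i j * w"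
    unfolding operators.hw_map_bas[OF operators_uq_op] funpow_times by (simp add: bas_def mult.assoc)
qed (simp_all add: operators.lin_hw_map[OF operators_uq_op] lin_mult)

lemma uq_hom:
  assumes s: "s \<noteq> 0" "s' \<noteq> 0" and w: "Eop q s (eseq q c s) w = 0" "Kop q s w = scP s' w"
    and x: "x \<in> Ylt 1"
  shows "uq_op q s' (\<lambda>_. 0) g x * w = uq_op q s (eseq q c s) g (x * w)"
proof -
  have "hw_map scP (uq_op q s (eseq q c s) gF) (\<lambda>x. yY * x) w (uq_op q s' (\<lambda>_. 0) g x) -
    uq_op q s (eseq q c s) g (hw_map scP (uq_op q s (eseq q c s) gF) (\<lambda>x. yY * x) w x) \<in> {0}"
    by (rule uq_universal[OF operators_uq_op operators.stable_singleton_0[OF operators_uq_op] q_neq_0 s(2) weighted_0 refl _ _ _ x])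
      (use w s uq_relations[OF q_neq_0 s(1) weighted_e[OF s(1)]] in auto)
  then show ?thesis by (simp add: hw_map_mult)
qed

text \<open>A vector killed by \<open>E\<close> is the image of \<open>1\<close> under a homomorphism from a Verma module of the quantum group.\<close>
lemma C_singular:
  assumes s: "s \<noteq> 0" "s' \<noteq> 0" and w: "Eop q s (eseq q c s) w = 0" "Kop q s w = scP s' w"
  shows "ev scP (uq_op q s (eseq q c s)) c w = scP (cscalar s') w"
proof -
  have "ev scP (uq_op q s' (\<lambda>_. 0)) c 1 * w - ev scP (uq_op q s (eseq q c s)) c (1 * w) \<in> {0}"
    by (rule ev_intertwine[where \<iota>="\<lambda>x. x * w" and B="Ylt 1", OF operators_uq_op operators_uq_op
          stable_Ylt operators.stable_singleton_0[OF operators_uq_op]])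
      (simp_all add: uq_hom[OF s w] distrib_right scP_cst)
  then show ?thesis by (simp add: C_1[OF s(2)] scP_cst)
qed

definition singular :: "'k \<Rightarrow> 'k \<Rightarrow> 'k poly poly \<Rightarrow> bool" where
  "singular s s' w \<longleftrightarrow> Eop q s (eseq q c s) w = 0 \<and> Xop q c s w = 0 \<and> Kop q s w = scP s' w"

lemma osc_hom_mod:
  assumes s: "s \<noteq> 0" "s' \<noteq> 0" and D: "stable scP (osc_op q c s) D"
    and w: "Eop q s (eseq q c s) w \<in> D" "Xop q c s w \<in> D" "Kop q s w = scP s' w"
  shows "osc_op q c s' g x * w - osc_op q c s g (x * w) \<in> D"
proof -
  have "hw_map scP (osc_op q c s (Uq gF)) (osc_op q c s gY) w (osc_op q c s' g x) -
    osc_op q c s g (hw_map scP (osc_op q c s (Uq gF)) (osc_op q c s gY) w x) \<in> D"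
    by (rule osc_universal[OF operators_osc_op D s(2)])
      (use w osc_relations[OF s(1)] stableD(1)[OF D] in auto)
  then show ?thesis by (simp add: hw_map_mult)
qed

lemma osc_hom:
  assumes s: "s \<noteq> 0" "s' \<noteq> 0" and w: "singular s s' w"
  shows "osc_op q c s' g x * w = osc_op q c s g (x * w)"
  using osc_hom_mod[OF s operators.stable_singleton_0[OF operators_osc_op], of w g x] w
  by (simp add: singular_def)

lemma osc_hom_ev:
  assumes s: "s \<noteq> 0" "s' \<noteq> 0" and w: "singular s s' w"
  shows "ev scP (osc_op q c s') p x * w = ev scP (osc_op q c s) p (x * w)"
proof -
  have "ev scP (osc_op q c s') p x * w - ev scP (osc_op q c s) p (x * w) \<in> {0}"
    by (rule ev_intertwine[where \<iota>="\<lambda>x. x * w", OF operators_osc_op operators_osc_op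
          stable_UNIV operators.stable_singleton_0[OF operators_osc_op]])
      (simp_all add: osc_hom[OF s w] distrib_right scP_cst)
  then show ?thesis by simp
qed

text \<open>Applying \<open>K - \<nu>\<^sub>k\<close> removes the \<open>k\<close>-th term and rescales \<open>x\<^sub>0\<close> by a nonzero factor. The eigenvalues of the
  other terms may coincide with each other.\<close>
lemma eigen_isolate:
  assumes N: "0 \<in> N" "\<And>x y. x \<in> N \<Longrightarrow> y \<in> N \<Longrightarrow> x + y \<in> N" "\<And>a x. x \<in> N \<Longrightarrow> scP a x \<in> N" 
    "\<And>x. x \<in> N \<Longrightarrow> Kop q s x \<in> N"
    and I: "finite I" and x0: "Kop q s x0 = scP \<mu> x0"
    and x: "\<And>i. i \<in> I \<Longrightarrow> Kop q s (x i) = scP (\<nu> i) (x i)" and ne: "\<And>i. i \<in> I \<Longrightarrow> \<nu> i \<noteq> \<mu>"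
    and mem: "x0 + sum x I \<in> N"
  shows "x0 \<in> N"
  using I x0 x ne mem
proof (induction I arbitrary: x0 x rule: finite_induct)
  case empty
  then show ?case by simp
next
  case (insert k I)
  have neg: "- y \<in> N" if "y \<in> N" for y using N(3)[OF that, of "-1"] by (simp add: scP_left scP_cst)
  let ?y = "x0 + sum x (insert k I)"
  have "Kop q s ?y - scP (\<nu> k) ?y = scP (\<mu> - \<nu> k) x0 + (\<Sum>i\<in>I. scP (\<nu> i - \<nu> k) (x i))"
  proof -
    have "scP a (sum x I) = (\<Sum>i\<in>I. scP a (x i))" for a by (simp add: scP_def sum_distrib_left)
    moreover have "(\<Sum>i\<in>I. Kop q s (x i)) = (\<Sum>i\<in>I. scP (\<nu> i) (x i))"
      using insert.prems(2) by (intro sum.cong) auto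
    ultimately show ?thesis
      using insert.prems insert.hyps
      by (simp add: Kop_lin lin_sum[OF lin_Kop] scP_cst scP_left sum_subtractf)
  qed
  moreover have "Kop q s ?y - scP (\<nu> k) ?y \<in> N"
    using N(2)[OF N(4)[OF insert.prems(4)] neg[OF N(3)[OF insert.prems(4), of "\<nu> k"]]] by simp
  ultimately have "scP (\<mu> - \<nu> k) x0 + (\<Sum>i\<in>I. scP (\<nu> i - \<nu> k) (x i)) \<in> N" by simp
  then have "scP (\<mu> - \<nu> k) x0 \<in> N"
    by (rule insert.IH[of "scP (\<mu> - \<nu> k) x0" "\<lambda>i. scP (\<nu> i - \<nu> k) (x i)", rotated -1])
      (use insert.prems in \<open>auto simp: Kop_lin scP_cst mult.commute\<close>)
  then have "scP (inverse (\<mu> - \<nu> k)) (scP (\<mu> - \<nu> k) x0) \<in> N" by (rule N(3))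
  then show ?case using insert.prems(3)[of k] by (simp add: scP_cst)
qed

section \<open>The maximal submodule\<close>

text \<open>Since \<open>1\<close> spans its weight space and generates the module, a submodule is proper if and only if the constant
  coefficient vanishes on it. The largest such submodule can be written down directly, which avoids forming a
  sum of all proper submodules.\<close>
definition max_submod :: "'k \<Rightarrow> 'k poly poly set" where
  "max_submod s = {x. \<forall>p. coeff (coeff (ev scP (osc_op q c s) p x) 0) 0 = 0}"

lemma stable_max_submod: "stable scP (osc_op q c s) (max_submod s)"
proof -
  interpret operators scP "osc_op q c s" by (rule operators_osc_op)
  have "coeff (coeff (eval p (osc_op q c s g x)) 0) 0 = 0" if "x \<in> max_submod s" for p g x
    using that unfolding max_submod_def ev_gen[of g x, symmetric] ev_mult[symmetric] by blast
  then show ?thesis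
    by (auto simp: stable_def max_submod_def ev_zero_arg ev_add_arg ev_scale_arg)
qed

lemma one_notin_max_submod: "1 \<notin> max_submod s"
proof -
  interpret operators scP "osc_op q c s" by (rule operators_osc_op)
  have "coeff (coeff (eval 1 (1 :: 'k poly poly)) 0) 0 \<noteq> 0" by (simp add: ev_one)
  then show ?thesis unfolding max_submod_def by blast
qed

lemma max_submod_maximal:
  assumes s: "s \<noteq> 0" and N: "stable scP (osc_op q c s) N" "1 \<notin> N"
  shows "N \<subseteq> max_submod s"
proof
  fix x assume x: "x \<in> N"
  interpret operators scP "osc_op q c s" by (rule operators_osc_op)
  show "x \<in> max_submod s"
  proof (rule ccontr)
    assume "x \<notin> max_submod s"
    then obtain p where p: "coeff (coeff (eval p x) 0) 0 \<noteq> 0" by (auto simp: max_submod_def)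
    define y where "y = eval p x"
    have y: "y \<in> N" unfolding y_def by (rule ev_stable[OF N(1) x])
    obtain m where m: "\<And>j. degree (coeff y j) \<le> m" using ex_coeff_bound by blast
    define I where "I = {..degree y} \<times> {..m}"
    define t where "t = (\<lambda>(j, i). scP (coeff (coeff y j) i) (bas i j))"
    have "y = sum t I"
      unfolding I_def t_def sum.cartesian_product[symmetric] by (rule bas_sum[OF order_refl m])
    also have "\<dots> = t (0, 0) + sum t (I - {(0, 0)})"
      by (rule sum.remove) (auto simp: I_def)
    finally have "t (0, 0) + sum t (I - {(0, 0)}) \<in> N" using y by simp
    then have "t (0, 0) \<in> N"
    proof (rule eigen_isolate[where s=s and \<mu>="s" and \<nu>="\<lambda>(j, i). s * inverse q ^ (2 * i + j)", rotated -1])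
      show "Kop q s x \<in> N" if "x \<in> N" for x
        using stableD(4)[OF N(1) that, of "Uq gK"] by simp
      show "(case k of (j, i) \<Rightarrow> s * inverse q ^ (2 * i + j)) \<noteq> s" if "k \<in> I - {(0, 0)}" for k
      proof -
        obtain j i where k: "k = (j, i)" by fastforce
        then have "inverse q ^ (2 * i + j) \<noteq> inverse q ^ 0" using that unfolding inv_power_inj by auto
        then show ?thesis using s k by simp
      qed
      show "Kop q s (t (0, 0)) = scP s (t (0, 0))" using Kop_bas[of q s 0 0]
        by (simp add: t_def Kop_lin scP_cst mult.commute)
    qed (use N(1) in \<open>auto simp: stable_def I_def t_def Kop_lin Kop_bas scP_cst mult.commute\<close>)
    then have "scP (inverse (coeff (coeff y 0) 0)) (t (0, 0)) \<in> N" by (rule stableD(3)[OF N(1)])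
    then show False using p N(2) by (simp add: t_def y_def scP_cst)
  qed
qed

end

section \<open>Monic polynomials in Y\<close>

definition monicY :: "nat \<Rightarrow> 'k::field poly poly \<Rightarrow> bool" where
  "monicY d w \<longleftrightarrow> w - yY ^ d \<in> Ylt d"

lemma yY_power_monom: "yY ^ d = monom 1 d"
  using bas_monom[of 0 d] by (simp add: bas_def monom_0 flip: one_pCons)

lemma coeff_yY_power: "coeff (yY ^ d) j = (if j = d then 1 else 0)"
  by (simp add: yY_power_monom)

lemma monicY_coeff:
  assumes "monicY d w" shows "coeff w d = 1" "j > d \<Longrightarrow> coeff w j = 0" "w \<in> Ylt (Suc d)" "w \<noteq> 0"
proof -
  have "coeff w j - coeff (yY ^ d) j = 0" if "j \<ge> d" for j
    using assms that by (auto simp: monicY_def Ylt_def)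
  note * = this
  show 1: "coeff w d = 1" and 2: "j > d \<Longrightarrow> coeff w j = 0" for j 
    using *[of d] *[of j] by (simp_all add: coeff_yY_power)
  show "w \<in> Ylt (Suc d)" using 2 by (auto simp: Ylt_def)
  show "w \<noteq> 0" using 1 by auto
qed

lemma monicY_degree: "monicY d w \<Longrightarrow> degree w = d"
  using monicY_coeff[of d w] by (metis Ylt_degree le_antisym le_degree zero_neq_one)

lemma monicY_mult_Ylt:
  assumes "monicY d w" "y * w \<in> Ylt d"
  shows "y = 0"
proof (rule ccontr)
  assume "y \<noteq> 0"
  then have "coeff (y * w) (degree (y * w)) \<noteq> 0" using monicY_coeff(4)[OF assms(1)] by simp
  moreover have "degree (y * w) \<ge> d"
    using \<open>y \<noteq> 0\<close> monicY_coeff(4)[OF assms(1)] by (simp add: degree_mult_eq monicY_degree[OF assms(1)])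
  ultimately show False using assms(2) by (auto simp: Ylt_def)
qed

lemma coeff_const_mult: "f \<in> Ylt 1 \<Longrightarrow> coeff (f * w) j = coeff f 0 * coeff w j"
  by (auto simp: Ylt_1)

lemma Ylt_const: "[:a:] \<in> Ylt (Suc 0)"
  by (auto simp: Ylt_1)

lemma Ylt_const_mult: "f \<in> Ylt 1 \<Longrightarrow> x \<in> Ylt d \<Longrightarrow> f * x \<in> Ylt d"
  by (metis One_nat_def Ylt_1 Ylt_closed(6))

lemma const_eq_0_iff: "f \<in> Ylt 1 \<Longrightarrow> f = 0 \<longleftrightarrow> coeff f 0 = 0"
  by (auto simp: Ylt_1)

lemma monicY_reduce:
  assumes w: "monicY d w" and x: "x \<in> Ylt (Suc n)" and n: "d \<le> n"
  shows "x - ([:coeff x n:] * yY ^ (n - d)) * w \<in> Ylt n"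
  unfolding Ylt_def
proof (intro CollectI allI impI)
  fix j assume j: "n \<le> j"
  have "([:coeff x n:] * yY ^ (n - d)) * w = smult (coeff x n) (monom 1 (n - d) * w)"
    by (simp add: yY_power_monom)
  then have "coeff (([:coeff x n:] * yY ^ (n - d)) * w) j = coeff x n * coeff w (j - (n - d))"
    using j by (simp only: coeff_smult coeff_monom_mult) simp
  moreover have "coeff x j = coeff x n * coeff w (j - (n - d))"
  proof (cases "j = n")
    case True
    then show ?thesis using n monicY_coeff(1)[OF w] by simp
  next
    case False
    then have "j - (n - d) > d" "Suc n \<le> j" using j n by auto
    then show ?thesis using x monicY_coeff(2)[OF w] by (simp add: Ylt_def)
  qed
  ultimately show "coeff (x - ([:coeff x n:] * yY ^ (n - d)) * w) j = 0"
    by (simp only: coeff_diff diff_self)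
qed

lemma monicY_division:
  assumes w: "monicY d w"
  shows "\<exists>y r. r \<in> Ylt d \<and> x = y * w + r"
proof -
  obtain n where "x \<in> Ylt n" using Ylt_exists by blast
  then show ?thesis
  proof (induction n arbitrary: x)
    case 0
    then show ?case by (intro exI[of _ 0]) (simp add: Ylt_0)
  next
    case (Suc n)
    show ?case
    proof (cases "d \<le> n")
      case True
      let ?z = "[:coeff x n:] * yY ^ (n - d)"
      obtain y r where "r \<in> Ylt d" "x - ?z * w = y * w + r"
        using Suc.IH[OF monicY_reduce[OF w Suc.prems True]] by blast
      then have "r \<in> Ylt d \<and> x = (?z + y) * w + r" by (simp add: algebra_simps)
      then show ?thesis by blast
    next
      case False
      then show ?thesis using Ylt_mono[OF Suc.prems, of d] by (intro exI[of _ 0] exI[of _ x]) simp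
    qed
  qed
qed

lemma monic_expansion:
  assumes v: "\<And>j. monicY j (v j)" and x: "x \<in> Ylt d"
  shows "\<exists>f. (\<forall>j. f j \<in> Ylt 1) \<and> x = (\<Sum>j<d. f j * v j)"
  using x
proof (induction d arbitrary: x)
  case 0
  then show ?case by (intro exI[of _ "\<lambda>_. 0"]) (simp add: Ylt_0)
next
  case (Suc d)
  have "x - [:coeff x d:] * v d \<in> Ylt d" using monicY_reduce[OF v Suc.prems order_refl] by simp
  then obtain f where f: "\<forall>j. f j \<in> Ylt 1" "x - [:coeff x d:] * v d = (\<Sum>j<d. f j * v j)"
    using Suc.IH by blast
  have "x = (\<Sum>j<Suc d. (f(d := [:coeff x d:])) j * v j)"
    using f(2) by (simp add: algebra_simps)
  moreover have "\<forall>j. (f(d := [:coeff x d:])) j \<in> Ylt 1" using f(1) by (simp add: Ylt_const)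
  ultimately show ?case by blast
qed

lemma monic_expansion_unique:
  assumes v: "\<And>j. monicY j (v j)" and f: "\<And>j. j < d \<Longrightarrow> f j \<in> Ylt 1" and z: "(\<Sum>j<d. f j * v j) = 0"
    and j: "j < d"
  shows "f j = 0"
  using f z j
proof (induction d)
  case (Suc d)
  have "f i * v i \<in> Ylt d" if "i < d" for i
    using Suc.prems(1)[of i] that Ylt_mono[OF monicY_coeff(3)[OF v[of i]], of d] by (intro Ylt_const_mult) auto
  then have "(\<Sum>i<d. f i * v i) \<in> Ylt d" by (intro Ylt_sum) auto
  then have "coeff (\<Sum>i<d. f i * v i) d = 0" by (simp add: Ylt_def)
  then have "coeff (f d * v d) d = 0"
    using arg_cong[OF Suc.prems(2), of "\<lambda>p. coeff p d"] by simp
  then have "f d = 0"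
    using Suc.prems(1)[of d] monicY_coeff(1)[OF v[of d]] by (simp add: coeff_const_mult const_eq_0_iff)
  then show ?case using Suc by (cases "j = d") auto
qed simp

section \<open>Singular vectors at integral weights\<close>

lemma stable_mult:
  assumes N: "stable scP (osc_op q c s) N" and x: "x \<in> N"
  shows "y * x \<in> N"
proof -
  have fF: "fF * z \<in> N" and yY: "yY * z \<in> N" if "z \<in> N" for z
    using stableD(4)[OF N that, of "Uq gF"] stableD(4)[OF N that, of gY] by simp_all
  have "yY ^ j * x \<in> N" for j by (induction j) (simp_all add: x mult.assoc yY)
  then have bas: "bas i j * x \<in> N" for i j by (induction i) (simp_all add: bas_def mult.assoc fF)
  obtain d where "y \<in> Ylt d" using Ylt_exists by blast
  then show ?thesis
    by (induction y rule: bas_induct)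
      (simp_all add: distrib_right scP_cst stableD[OF N] bas)
qed

lemma coeff_Eop_0: "coeff (coeff (Eop q z (\<lambda>_. 0) f) 0) i = E_coeff q (Suc i) z * coeff (coeff f 0) (Suc i)"
proof (rule lin_eq[where sc="(*)" and f="\<lambda>f. coeff (coeff (Eop q z (\<lambda>_. 0) f) 0) i"
      and g="\<lambda>f. E_coeff q (Suc i) z * coeff (coeff f 0) (Suc i)"])
  fix i' j
  have "E_coeff q 0 x = 0" for x by (simp add: E_coeff_def)
  then show "coeff (coeff (Eop q z (\<lambda>_. 0) (bas i' j)) 0) i = E_coeff q (Suc i) z * coeff (coeff (bas i' j) 0) (Suc i)"
    by (cases i') (auto simp: Eop_bas coeff_bas)
qed (auto simp: lin_def Eop_lin algebra_simps)

text \<open>\<open>E(Y\<^sup>d)\<close> has degree less than \<open>d\<close> in \<open>Y\<close>, so \<open>E\<close> acts on leading coefficients as on the Verma module of weight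
  \<open>q\<^sup>-\<^sup>ds\<close>.\<close>
lemma coeff_Eop_top:
  assumes e: "\<And>j. e j \<in> Ylt j" and x: "x \<in> Ylt (Suc d)"
  shows "coeff (coeff (Eop q s e x) d) i = E_coeff q (Suc i) (s * inverse q ^ d) * coeff (coeff x d) (Suc i)"
proof (rule lin_eq_on[where sc="(*)" and f="\<lambda>x. coeff (coeff (Eop q s e x) d) i"
      and g="\<lambda>x. E_coeff q (Suc i) (s * inverse q ^ d) * coeff (coeff x d) (Suc i)", OF _ _ _ x])
  fix i' j assume "j < Suc d"
  then have "coeff (fF ^ i' * e j) d = 0" using Ylt_fF_power[OF e[of j], of i'] by (auto simp: Ylt_def)
  moreover have "E_coeff q 0 x = 0" for x by (simp add: E_coeff_def)
  ultimately show "coeff (coeff (Eop q s e (bas i' j)) d) i =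
      E_coeff q (Suc i) (s * inverse q ^ d) * coeff (coeff (bas i' j) d) (Suc i)"
    by (cases i') (auto simp: Eop_bas coeff_bas)
qed (auto simp: lin_def Eop_lin algebra_simps)

lemma Ylt_1_eqI: "f \<in> Ylt 1 \<Longrightarrow> g \<in> Ylt 1 \<Longrightarrow> (\<And>i. coeff (coeff f 0) i = coeff (coeff g 0) i) \<Longrightarrow> f = g"
  by (auto simp: Ylt_1 poly_eq_iff coeff_pCons split: nat.split)

lemma fF_power_Ylt: "fF ^ i \<in> Ylt (Suc 0)"
  using Ylt_simps(2)[of i 0 "Suc 0"] by (simp add: bas_def)

lemma coeff_fF_power: "coeff (coeff (fF ^ i) 0) i' = (if i = i' then 1 else 0)"
  using coeff_bas[of i 0 0 i'] by (simp add: bas_def)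

text \<open>The weights \<open>s = \<plusminus>q\<^sup>m\<close> with \<open>m \<ge> -1\<close>, where \<open>M = m + 1\<close>. The shift by one includes the weight \<open>\<plusminus>q\<^sup>-\<^sup>1\<close>, which
  occurs as \<open>t\<^sub>k\<close> when \<open>n\<^sub>k = n + 1\<close>.\<close>
locale osc_int = osc_param q c for q :: "'k::field" and c +
  fixes s \<epsilon> :: 'k and M :: nat
  assumes eps: "\<epsilon> = 1 \<or> \<epsilon> = - 1" and sM: "q * s = \<epsilon> * q ^ M"
begin

abbreviation "E \<equiv> Eop q s (eseq q c s)"
abbreviation "X \<equiv> Xop q c s"
abbreviation "K \<equiv> Kop q s"
abbreviation "Ki \<equiv> Kop (inverse q) (inverse s)"
abbreviation "C \<equiv> ev scP (uq_op q s (eseq q c s)) c"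
abbreviation "T \<equiv> osc_op q c s"

lemma eps_simps: "\<epsilon> * \<epsilon> = 1" "\<epsilon> \<noteq> 0" "inverse \<epsilon> = \<epsilon>"
  using eps by auto

lemma s: "s \<noteq> 0"
  using sM eps_simps by auto

lemma s_eq: "s = \<epsilon> * inverse q * q ^ M" and s_inv: "inverse s = \<epsilon> * q * inverse q ^ M"
proof -
  show 1: "s = \<epsilon> * inverse q * q ^ M" using sM by (simp add: field_simps)
  show "inverse s = \<epsilon> * q * inverse q ^ M" by (simp add: 1 eps_simps power_inverse mult_ac)
qed

lemma q_cancel: "q * (inverse q * z) = z" "inverse q * (q * z) = z"
  by (simp_all flip: mult.assoc)

lemma sp_neq_0: "s * inverse q ^ j \<noteq> 0"
  using s by simp

lemma qbrace_eq_0_iff: "x \<noteq> 0 \<Longrightarrow> qbrace q x = 0 \<longleftrightarrow> x * x = 1"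
  using q_diff by (auto simp: qbrace_def field_simps)

lemma qbrace_eps: "qbrace q (\<epsilon> * q ^ k) = 0 \<longleftrightarrow> k = 0"
proof -
  have "\<epsilon> * q ^ k * (\<epsilon> * q ^ k) = q ^ (2 * k)"
  proof -
    have "\<epsilon> * q ^ k * (\<epsilon> * q ^ k) = (\<epsilon> * \<epsilon>) * (q ^ k * q ^ k)" by (simp only: mult_ac)
    then show ?thesis by (simp add: eps_simps mult_2 power_add)
  qed
  then show ?thesis
    using q_not_root[of "2 * k"] eps_simps by (subst qbrace_eq_0_iff) auto
qed

text \<open>\<open>S j\<close> is \<open>\<alpha>\<^sub>s\<^sub>,\<^sub>j\<^sub>+\<^sub>1\<close>. The coefficients \<open>a\<^sub>j\<close> and \<open>b\<^sub>j\<close> of the introduction are \<open>X_coeff j\<close> and \<open>Y_coeff j\<close>: the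
  condition \<open>Ev\<^sub>j\<^sub>+\<^sub>1 = 0\<close> is \<open>a\<^sub>j = b\<^sub>j{q\<^sup>1\<^sup>-\<^sup>js}\<close>, and the relation for \<open>XY\<close> becomes the recursion
  \<open>a\<^sub>j\<^sub>+\<^sub>1{q\<^sup>1\<^sup>-\<^sup>js} = a\<^sub>j{q\<^sup>2\<^sup>-\<^sup>js} - {q\<^sup>1\<^sup>-\<^sup>js}c\<^sub>0\<close> with \<open>c\<^sub>0\<close> taken at \<open>q\<^sup>-\<^sup>js\<close>, solved by \<open>a\<^sub>j{q\<^sup>2\<^sup>-\<^sup>js} = -S j\<close>.\<close>
definition S :: "nat \<Rightarrow> 'k" where
  "S j = (\<Sum>i<j. qbrace q (q * s * inverse q ^ i) * cscalar (s * inverse q ^ i))"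

definition X_coeff :: "nat \<Rightarrow> 'k" where "X_coeff j = - S j / qbrace q (q * q * s * inverse q ^ j)"
definition Y_coeff :: "nat \<Rightarrow> 'k" where "Y_coeff j = X_coeff j / qbrace q (q * s * inverse q ^ j)"

text \<open>These are defined and monic for all \<open>j\<close>, but killed by \<open>E\<close> only for \<open>j \<le> M\<close>: the denominator of \<open>b\<^sub>M\<close> is zero.\<close>
fun vvec :: "nat \<Rightarrow> 'k poly poly" where
  "vvec 0 = 1"
| "vvec (Suc 0) = yY"
| "vvec (Suc (Suc j)) = yY * vvec (Suc j) - scP (Y_coeff (Suc j)) (fF * vvec j)"

definition uvec :: "nat \<Rightarrow> 'k poly poly" where "uvec j = fF ^ (M - j) * vvec j"

lemma q_power_diff: "j \<le> k \<Longrightarrow> q ^ k * inverse q ^ j = q ^ (k - j)"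
  by (simp add: power_diff power_inverse field_simps)

lemma qbrace_b: "j \<le> M \<Longrightarrow> qbrace q (q * s * inverse q ^ j) = 0 \<longleftrightarrow> j = M"
  unfolding sM mult.assoc by (auto simp: q_power_diff qbrace_eps)

lemma qbrace_a: "j \<le> M \<Longrightarrow> qbrace q (q * q * s * inverse q ^ j) \<noteq> 0"
  using q_power_diff[of j "Suc M"] sM qbrace_eps[of "Suc M - j"]
  by (simp add: mult_ac)

lemma S_0: "S 0 = 0" and X_coeff_0: "X_coeff 0 = 0" and Y_coeff_0: "Y_coeff 0 = 0"
  by (simp_all add: S_def X_coeff_def Y_coeff_def)

lemma X_coeff_eq_0_iff: "j \<le> M \<Longrightarrow> X_coeff j = 0 \<longleftrightarrow> S j = 0"
  using qbrace_a by (simp add: X_coeff_def)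

lemma Y_coeff_eq_0_iff: "j < M \<Longrightarrow> Y_coeff j = 0 \<longleftrightarrow> S j = 0"
  using qbrace_a[of j] qbrace_b[of j] by (simp add: X_coeff_def Y_coeff_def)

lemma yY_vvec: "yY * vvec j = vvec (Suc j) + scP (Y_coeff j) (fF * vvec (j - 1))"
  by (cases j) (simp_all add: Y_coeff_0 scP_cst)

lemma monic_vvec: "monicY j (vvec j)"
proof (induction j rule: vvec.induct)
  case (3 j)
  have 1: "yY * (vvec (Suc j) - yY ^ Suc j) \<in> Ylt (Suc (Suc j))"
    by (rule Ylt_closed(5)) (use 3(1) in \<open>simp add: monicY_def\<close>)
  have 2: "vvec j \<in> Ylt (Suc (Suc j))"
    using monicY_coeff(3)[OF 3(2)] by (rule Ylt_mono) simp
  have "yY * (vvec (Suc j) - yY ^ Suc j) - scP (Y_coeff (Suc j)) (fF * vvec j) \<in> Ylt (Suc (Suc j))"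
    by (rule Ylt_closed(2)[OF 1 Ylt_closed(3)[OF Ylt_closed(4)[OF 2]]])
  then show ?case by (simp add: monicY_def algebra_simps)
qed (simp_all add: monicY_def)

lemma vvec_neq_0: "vvec j \<noteq> 0"
  by (rule monicY_coeff(4)[OF monic_vvec])

lemma K_vvec: "K (vvec j) = scP (s * inverse q ^ j) (vvec j)"
proof (induction j rule: vvec.induct)
  case 1
  then show ?case using Kop_bas[of q s 0 0] by simp
next
  case 2
  then show ?case using Kop_bas[of q s 0 1] by (simp add: bas_def)
next
  case (3 j)
  have "K (fF * vvec j) = scP (inverse q ^ 2) (fF * K (vvec j))" using Kop_fF[of q s 1] by simp
  then show ?case using 3 by (simp add: Kop_lin Kop_yY scP_cst power2_eq_square mult_ac)
qed

lemma Ki_vvec: "Ki (vvec j) = scP (inverse s * q ^ j) (vvec j)"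
  using Kop_inv_weight[OF q_neq_0 s sp_neq_0 K_vvec[of j]] by (simp add: power_inverse)

lemma E_fF: "E (fF * v) = fF * E v + scP (inverse (q - inverse q)) (K v - Ki v)"
  using uq_EF[OF q_neq_0 s, of "eseq q c s" v] by (simp add: algebra_simps)

lemma X_fF: "X (fF * v) = fF * X v - yY * Ki v"
  using FX[OF s, of v] by simp

lemma X_fF_power: "X (fF ^ i * v) = fF ^ i * X v - scP (XF_coeff q i) (fF ^ (i - 1) * (yY * Ki v))"
proof (induction i)
  case (Suc i)
  have K: "Ki (fF ^ i * v) = scP (q ^ (2 * i)) (fF ^ i * Ki v)"
    using Kop_fF[of "inverse q" "inverse s" i v] by simp
  show ?case
  proof (cases i)
    case 0
    then show ?thesis by (simp add: X_fF XF_coeff_Suc XF_coeff_0 scP_cst)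
  next
    case (Suc n)
    have "X (fF ^ Suc i * v) = fF * X (fF ^ i * v) - yY * Ki (fF ^ i * v)"
      by (simp add: mult.assoc X_fF)
    also have "\<dots> = fF ^ Suc i * X v - scP (XF_coeff q i) (fF ^ i * (yY * Ki v)) - scP (q ^ (2 * i)) (fF ^ i * (yY * Ki v))"
      unfolding Suc.IH K using Suc by (simp add: right_diff_distrib scP_cst mult_ac)
    finally show ?thesis by (simp add: XF_coeff_Suc scP_left)
  qed
qed (simp add: XF_coeff_0 scP_cst)

text \<open>The identity \<open>q{x} + x\<^sup>-\<^sup>1 = {qx}\<close> makes the multiples of \<open>Fv\<^sub>j\<^sub>-\<^sub>1\<close> cancel in \<open>Xv\<^sub>j\<^sub>+\<^sub>1\<close>.\<close>
lemma vvec_EX: "j \<le> M \<Longrightarrow> E (vvec j) = 0 \<and> X (vvec j) = scP (X_coeff j) (vvec (j - 1))"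
proof (induction j rule: vvec.induct)
  case 1
  then show ?case
    using E_bas_0[OF s, of 0] X_bas_0[OF s, of 0] by (simp add: e_0[OF s] x_0[OF s] X_coeff_0 scP_cst)
next
  case 2
  have E1: "E 1 = 0" and X1: "X 1 = 0" 
    using E_bas_0[OF s, of 0] X_bas_0[OF s, of 0] by (simp_all add: e_0[OF s] x_0[OF s])
  have C1: "C 1 = scP (cscalar s) 1"
    using C_singular[OF s s E1] K_vvec[of 0] by simp
  have "qbrace q (q * s) \<noteq> 0" using qbrace_b[of 0] 2 by simp
  moreover have e: "q * q * s * inverse q ^ Suc 0 = q * s" by simp
  ultimately have "X_coeff (Suc 0) = - cscalar s" unfolding X_coeff_def e by (simp add: S_def)
  moreover have "- X yY = scP (cscalar s) 1"
    using YX[OF s, of 1] by (simp add: X1 C1 scP_cst)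
  then have "X yY = - scP (cscalar s) 1" by (metis minus_minus)
  ultimately show ?case using EY[OF s, of 1] by (simp add: E1 X1 scP_cst scP_left)
next
  case (3 j)
  define b a1 where "b = Y_coeff (Suc j)" and "a1 = X_coeff (Suc j)"
  define D1 D0 where "D1 = qbrace q (q * s * inverse q ^ Suc j)" and "D0 = qbrace q (q * s * inverse q ^ j)"
  have M: "Suc j \<le> M" "j \<le> M" "Suc j \<noteq> M" "j \<noteq> M" using 3(3) by auto
  have D: "D1 \<noteq> 0" "D0 \<noteq> 0" using qbrace_b[of "Suc j"] qbrace_b[of j] M by (auto simp: D1_def D0_def)
  have "q * s * inverse q ^ Suc j = (q * inverse q) * (s * inverse q ^ j)"
    by (simp only: power_Suc mult_ac)
  then have D1': "D1 = qbrace q (s * inverse q ^ j)" by (simp only: D1_def) simp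
  have aD: "qbrace q (q * q * s * inverse q ^ Suc j) = D0" "qbrace q (q * q * s * inverse q ^ Suc (Suc j)) = D1"
  proof -
    have "q * q * s * inverse q ^ Suc k = (q * inverse q) * (q * s * inverse q ^ k)" for k
      by (simp only: power_Suc mult_ac)
    then have "q * q * s * inverse q ^ Suc k = q * s * inverse q ^ k" for k by simp
    then show "qbrace q (q * q * s * inverse q ^ Suc j) = D0"
      "qbrace q (q * q * s * inverse q ^ Suc (Suc j)) = D1" unfolding D0_def D1_def by presburger+
  qed
  have a1: "a1 = - S (Suc j) / D0" "b = a1 / D1" "X_coeff j = Y_coeff j * D0"
  proof -
    show "a1 = - S (Suc j) / D0" unfolding a1_def X_coeff_def aD(1) ..
    show "b = a1 / D1" by (simp only: a1_def b_def Y_coeff_def D1_def)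
    show "X_coeff j = Y_coeff j * D0" using D(2) by (simp add: Y_coeff_def D0_def)
  qed
  have ac2: "X_coeff (Suc (Suc j)) = b * D0 - cscalar (s * inverse q ^ Suc j)"
  proof -
    have "S (Suc (Suc j)) = S (Suc j) + D1 * cscalar (s * inverse q ^ Suc j)"
      by (simp add: S_def D1_def)
    then show ?thesis unfolding X_coeff_def aD(2) using D by (simp add: a1 field_simps)
  qed
  have shift: "q * D1 + inverse s * q ^ j = D0"
  proof -
    have "qbrace q (inverse q * (q * s * inverse q ^ j)) - inverse q * D0 = - inverse (q * s * inverse q ^ j)"
      unfolding D0_def by (rule qbrace_shift[OF _ q_diff]) (use s in simp)
    moreover have "inverse q * (q * s * inverse q ^ j) = s * inverse q ^ j" by simp
    moreover have "inverse (q * s * inverse q ^ j) = inverse q * (inverse s * q ^ j)" by (simp add: power_inverse)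
    ultimately have "D1 - inverse q * D0 = - (inverse q * (inverse s * q ^ j))" by (simp only: D1')
    then have "q * (D1 - inverse q * D0) = q * - (inverse q * (inverse s * q ^ j))" by (simp only:)
    then have "q * D1 - D0 = - (inverse s * q ^ j)" by (simp add: right_diff_distrib q_cancel)
    then show ?thesis by (simp add: algebra_simps)
  qed
  note IH1 = 3(1)[OF M(1)] and IH0 = 3(2)[OF M(2)]
  have EF: "E (fF * vvec j) = scP D1 (vvec j)"
  proof -
    have "inverse (q - inverse q) * (s * inverse q ^ j - inverse s * q ^ j) = D1"
      by (simp add: D1' qbrace_def divide_inverse power_inverse mult_ac)
    then show ?thesis
      using IH0 by (simp add: E_fF K_vvec Ki_vvec scP_cst flip: scP_left)
  qed
  have "E (yY * vvec (Suc j)) = scP a1 (vvec j)"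
    using IH1 by (simp add: EY[OF s] a1_def scP_cst)
  then have 1: "E (vvec (Suc (Suc j))) = 0"
    using D(1) by (simp add: Eop_lin EF scP_cst b_def[symmetric] a1(2))
  have C: "C (vvec (Suc j)) = scP (cscalar (s * inverse q ^ Suc j)) (vvec (Suc j))"
    using IH1 by (intro C_singular s sp_neq_0 K_vvec) auto
  have A: "X (yY * vvec (Suc j)) = scP (q * a1) (yY * vvec j) - C (vvec (Suc j))"
    using YX[OF s, of "vvec (Suc j)"] IH1 by (simp add: a1_def scP_cst algebra_simps)
  have B: "X (fF * vvec j) = scP (X_coeff j) (fF * vvec (j - 1)) - scP (inverse s * q ^ j) (yY * vvec j)"
    using IH0 by (simp add: X_fF Ki_vvec scP_cst)
  have "X (vvec (Suc (Suc j))) = scP (q * a1 + b * (inverse s * q ^ j)) (yY * vvec j)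
     - scP (cscalar (s * inverse q ^ Suc j)) (vvec (Suc j)) - scP (b * X_coeff j) (fF * vvec (j - 1))"
    unfolding vvec.simps(3) Xop_lin b_def[symmetric] A B C by (simp add: scP_cst scP_left algebra_simps)
  also have "q * a1 + b * (inverse s * q ^ j) = b * D0"
    unfolding shift[symmetric] using D by (simp add: a1(2) field_simps)
  finally have "X (vvec (Suc (Suc j))) = scP (X_coeff (Suc (Suc j))) (vvec (Suc j))"
    unfolding ac2 yY_vvec by (simp add: scP_cst scP_left a1(3) algebra_simps)
  then show ?case using 1 by simp
qed

lemma singular_vvec: "j \<le> M \<Longrightarrow> S j = 0 \<Longrightarrow> singular s (s * inverse q ^ j) (vvec j)"
  using vvec_EX[of j] K_vvec[of j] X_coeff_eq_0_iff[of j] by (simp add: singular_def scP_cst)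

lemma E_const_vvec:
  assumes "j \<le> M" "f \<in> Ylt 1"
  shows "E (f * vvec j) = Eop q (s * inverse q ^ j) (\<lambda>_. 0) f * vvec j"
  using uq_hom[OF s sp_neq_0 _ K_vvec assms(2), where g=gE] vvec_EX[OF assms(1)] by simp

text \<open>The closed form shows when \<open>E\<close> kills \<open>F\<^sup>iv\<^sub>j\<close>: exactly for \<open>i = M - j\<close> among the positive \<open>i\<close>.\<close>
lemma E_coeff_closed: 
  assumes "z \<noteq> 0"
  shows "E_coeff q i z * (q - inverse q)\<^sup>2 = (q ^ i - inverse q ^ i) * (z * inverse q ^ i * q - inverse z * q ^ i * inverse q)"
proof (induction i)
  case (Suc i)
  have "qbrace q (z * inverse q ^ (2 * i)) * (q - inverse q)\<^sup>2 = 
    (z * inverse q ^ (2 * i) - inverse z * q ^ (2 * i)) * (q - inverse q)"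
    using q_diff by (simp add: qbrace_def power2_eq_square power_inverse)
  moreover have "inverse q ^ (2 * i) = inverse q ^ i * inverse q ^ i" "q ^ (2 * i) = q ^ i * q ^ i"
    by (simp_all add: mult_2 power_add)
  ultimately have Q: "qbrace q (z * inverse q ^ (2 * i)) * (q - inverse q)\<^sup>2 =
    (z * (inverse q ^ i * inverse q ^ i) - inverse z * (q ^ i * q ^ i)) * (q - inverse q)" by simp
  have 1: "z * inverse q ^ Suc i * q = z * inverse q ^ i" "inverse z * q ^ Suc i * inverse q = inverse z * q ^ i"
    by simp_all
  have "E_coeff q (Suc i) z * (q - inverse q)\<^sup>2 = 
    (q ^ i - inverse q ^ i) * (z * inverse q ^ i * q - inverse z * q ^ i * inverse q) +
    (z * (inverse q ^ i * inverse q ^ i) - inverse z * (q ^ i * q ^ i)) * (q - inverse q)"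
    unfolding E_coeff_Suc distrib_right Suc Q ..
  also have "\<dots> = (q ^ Suc i - inverse q ^ Suc i) * (z * inverse q ^ i - inverse z * q ^ i)"
    by (simp add: algebra_simps)
  finally show ?case unfolding 1 .
qed (simp add: E_coeff_def)

lemma E_coeff_eq_0_iff: "i > 0 \<Longrightarrow> E_coeff q i (s * inverse q ^ j) = 0 \<longleftrightarrow> i + j = M"
proof -
  assume i: "i > 0"
  have 1: "q ^ i - inverse q ^ i \<noteq> 0"
  proof
    assume "q ^ i - inverse q ^ i = 0"
    then have "q ^ i * q ^ i = q ^ i * inverse q ^ i" by simp
    then have "q ^ (2 * i) = 1" by (simp add: mult_2 power_add power_inverse)
    then show False using q_not_root[of "2 * i"] i by simp
  qed
  have A: "s * inverse q ^ j * inverse q ^ i * q = \<epsilon> * (q ^ M * inverse q ^ (i + j))"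
    by (simp add: s_eq power_add mult_ac)
  have B: "inverse (s * inverse q ^ j) * q ^ i * inverse q = \<epsilon> * (inverse q ^ M * q ^ (i + j))"
    by (simp add: s_inv power_add power_inverse mult_ac)
  have "E_coeff q i (s * inverse q ^ j) = 0 \<longleftrightarrow> E_coeff q i (s * inverse q ^ j) * (q - inverse q)\<^sup>2 = 0"
    using q_diff by simp
  also have "\<dots> \<longleftrightarrow> \<epsilon> * (q ^ M * inverse q ^ (i + j)) = \<epsilon> * (inverse q ^ M * q ^ (i + j))"
    unfolding E_coeff_closed[OF sp_neq_0] A B using 1 by simp
  also have "\<dots> \<longleftrightarrow> q ^ M * inverse q ^ (i + j) = inverse q ^ M * q ^ (i + j)"
    using eps_simps(2) by simp
  also have "\<dots> \<longleftrightarrow> q ^ M * q ^ M = q ^ (i + j) * q ^ (i + j)"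
    by (simp add: power_inverse field_simps)
  also have "\<dots> \<longleftrightarrow> inverse q ^ (M + M) = inverse q ^ ((i + j) + (i + j))"
    unfolding power_inverse inverse_eq_iff_eq power_add[of q M M] power_add[of q "i + j" "i + j"] ..
  also have "\<dots> \<longleftrightarrow> i + j = M" unfolding inv_power_inj by auto
  finally show ?thesis .
qed

end

lemma lin_funpow: "lin scP f \<Longrightarrow> lin scP (f ^^ k)"
  by (induction k) (auto simp: lin_def)

context osc_int
begin

section \<open>Highest weight vectors for the quantum group\<close>

lemma E_fF_vvec: 
  assumes "j \<le> M" 
  shows "E (fF ^ i * vvec j) = scP (E_coeff q i (s * inverse q ^ j)) (fF ^ (i - 1) * vvec j)"
proof -
  have "Eop q (s * inverse q ^ j) (\<lambda>_. 0) (fF ^ i) = scP (E_coeff q i (s * inverse q ^ j)) (fF ^ (i - 1))"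
    using Eop_bas[of q "s * inverse q ^ j" "\<lambda>_. 0" i 0] by (simp add: bas_def)
  then show ?thesis using E_const_vvec[OF assms, of "fF ^ i"] by (simp add: fF_power_Ylt scP_cst)
qed

lemma E_Ylt: "x \<in> Ylt d \<Longrightarrow> E x \<in> Ylt d"
  by (rule Eop_Ylt) (auto intro: e_Ylt[OF s])

text \<open>In the basis \<open>F\<^sup>iv\<^sub>j\<close> the operator \<open>E\<close> lowers \<open>i\<close> by one.\<close>
lemma E_nilpotent:
  assumes y: "y \<in> Ylt d" and d: "d \<le> Suc M"
  shows "\<exists>k. (E ^^ k) y = 0"
proof -
  let ?P = "\<lambda>y. \<exists>k. \<forall>k'\<ge>k. (E ^^ k') y = 0"
  have lin: "lin scP (E ^^ k)" for k by (rule lin_funpow[OF lin_Eop])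
  have mono: "(E ^^ k) (fF ^ i * vvec j) = 0" if "i < k" "j \<le> M" for i j k
    using that(1)
  proof (induction i arbitrary: k)
    case 0
    then obtain k' where "k = Suc k'" by (cases k) auto
    moreover have "E_coeff q 0 (s * inverse q ^ j) = 0" by (simp add: E_coeff_def)
    ultimately show ?case
      using E_fF_vvec[OF \<open>j \<le> M\<close>, of 0] by (simp add: funpow_swap1 linD[OF lin] scP_cst)
  next
    case (Suc i)
    then obtain k' where "k = Suc k'" "i < k'" by (cases k) auto
    then show ?case
      using E_fF_vvec[OF \<open>j \<le> M\<close>, of "Suc i"] Suc.IH[of k'] by (simp add: funpow_swap1 linD[OF lin] scP_cst)
  qed
  have add: "?P (x + y)" if xy: "?P x" "?P y" for x y
  proof -
    obtain k k' where "\<forall>l\<ge>k. (E ^^ l) x = 0" "\<forall>l\<ge>k'. (E ^^ l) y = 0" using xy by blast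
    then have "\<forall>l\<ge>max k k'. (E ^^ l) (x + y) = 0" by (simp add: linD[OF lin])
    then show ?thesis by blast
  qed
  have zero: "?P 0" by (simp add: linD[OF lin])
  have multiple: "?P (f * vvec j)" if f: "f \<in> Ylt 1" and j: "j \<le> M" for f j
    using f
  proof (induction f rule: bas_induct)
    case zero
    then show ?case using \<open>?P 0\<close> by simp
  next
    case (add x y)
    then show ?case using \<open>\<And>x y. ?P x \<Longrightarrow> ?P y \<Longrightarrow> ?P (x + y)\<close> by (simp add: distrib_right)
  next
    case (bas a i j')
    then have "\<forall>l\<ge>Suc i. (E ^^ l) (scP a (bas i j') * vvec j) = 0"
      using mono[OF _ j, of i] by (simp add: bas_def scP_cst linD[OF lin])
    then show ?case by blast
  qed
  obtain f where f: "\<forall>j. f j \<in> Ylt 1" "y = (\<Sum>j<d. f j * vvec j)"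
    using monic_expansion[of vvec, OF monic_vvec y] by blast
  have "?P y"
    unfolding f(2)
  proof (rule sum_induct_closed[where P="?P"])
    fix j assume "j \<in> {..<d}"
    then show "?P (f j * vvec j)" using d f(1) by (intro multiple) auto
  qed (use add zero in auto)
  then show ?thesis by blast
qed

lemma E_kernel_in:
  assumes N: "\<And>x. x \<in> N \<Longrightarrow> E x \<in> N" and y: "y \<in> N" "y \<in> Ylt d" "y \<noteq> 0" and d: "d \<le> Suc M"
  shows "\<exists>y'\<in>N. y' \<in> Ylt d \<and> y' \<noteq> 0 \<and> E y' = 0"
proof -
  have "\<exists>y'\<in>N. y' \<in> Ylt d \<and> y' \<noteq> 0 \<and> E y' = 0" if "(E ^^ k) y = 0" "y \<in> N" "y \<in> Ylt d" "y \<noteq> 0" for k y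
    using that
  proof (induction k arbitrary: y)
    case (Suc k)
    show ?case
    proof (cases "E y = 0")
      case False
      then show ?thesis using Suc.prems N E_Ylt by (intro Suc.IH[of "E y"]) (auto simp: funpow_swap1)
    qed (use Suc.prems in blast)
  qed simp
  then show ?thesis using E_nilpotent[OF y(2) d] y by blast
qed

lemma K_uvec: "j \<le> M \<Longrightarrow> K (uvec j) = scP (s * inverse q ^ (2 * M - j)) (uvec j)"
proof -
  assume j: "j \<le> M"
  have "inverse q ^ (2 * (M - j)) * (s * inverse q ^ j) = s * inverse q ^ (2 * (M - j) + j)"
    by (simp add: power_add mult_ac)
  moreover have "2 * (M - j) + j = 2 * M - j" using j by simp
  ultimately show ?thesis by (simp only: uvec_def Kop_fF K_vvec scP_cst)
qed

lemma uvec_M: "uvec M = vvec M"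
  by (simp add: uvec_def)

lemma uvec_neq_0: "uvec j \<noteq> 0"
  by (simp add: uvec_def vvec_neq_0)

text \<open>In degrees at most \<open>M\<close> the operator \<open>E\<close> acts separately on each \<open>k[F]v\<^sub>j\<close>, with kernel spanned by \<open>v\<^sub>j\<close> and, for \<open>j < M\<close>,
  by \<open>u\<^sub>j\<close>.\<close>
lemma E_kernel_expansion:
  assumes y: "y \<in> Ylt d" and d: "d \<le> Suc M" and E: "E y = 0"
  shows "\<exists>\<alpha> \<beta>. y = (\<Sum>j<d. scP (\<alpha> j) (vvec j)) + (\<Sum>j\<in>{..<d} \<inter> {..<M}. scP (\<beta> j) (uvec j))"
proof -
  obtain f where f: "\<forall>j. f j \<in> Ylt 1" "y = (\<Sum>j<d. f j * vvec j)"
    using monic_expansion[of vvec, OF monic_vvec y] by blast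
  have "E y = (\<Sum>j<d. Eop q (s * inverse q ^ j) (\<lambda>_. 0) (f j) * vvec j)"
    unfolding f(2) lin_sum[OF lin_Eop] using f(1) d by (intro sum.cong refl E_const_vvec) auto
  then have z: "Eop q (s * inverse q ^ j) (\<lambda>_. 0) (f j) = 0" if "j < d" for j
    using E f(1) that
    by (intro monic_expansion_unique[of vvec d "\<lambda>j. Eop q (s * inverse q ^ j) (\<lambda>_. 0) (f j)", OF monic_vvec])
      (auto intro: Eop_Ylt)
  define \<alpha> \<beta> where "\<alpha> j = coeff (coeff (f j) 0) 0" and "\<beta> j = coeff (coeff (f j) 0) (M - j)" for j
  have fj: "f j = scP (\<alpha> j) 1 + (if j \<in> {..<M} then scP (\<beta> j) (fF ^ (M - j)) else 0)" if j: "j < d" for j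
  proof (rule Ylt_1_eqI)
    fix i
    have "E_coeff q (Suc i') (s * inverse q ^ j) * coeff (coeff (f j) 0) (Suc i') = 0" for i'
      using z[OF j] coeff_Eop_0[of q "s * inverse q ^ j" "f j" i'] by simp
    then have c: "coeff (coeff (f j) 0) i = 0" if "i > 0" "i + j \<noteq> M" 
      using that E_coeff_eq_0_iff[of i j] by (cases i) auto
    show "coeff (coeff (f j) 0) i = coeff (coeff (scP (\<alpha> j) 1 + (if j \<in> {..<M} then scP (\<beta> j) (fF ^ (M - j)) else 0)) 0) i"
    proof (cases "i = 0")
      case True
      then show ?thesis by (auto simp: \<alpha>_def coeff_fF_power coeff_1 simp flip: one_pCons)
    next
      case False
      have "coeff [:a:] i = 0" for a :: 'k using False by (cases i) auto
      then have one: "coeff (coeff (scP a (1 :: 'k poly poly)) 0) i = 0" for a by (simp add: coeff_1)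
      have fp: "coeff (coeff (scP b (fF ^ k)) 0) i = (if k = i then b else 0)" for b and k :: nat
        by (simp add: coeff_fF_power)
      show ?thesis using False c j d
        by (cases "i + j = M") (auto simp: \<beta>_def one fp simp del: coeff_scP)
    qed
  qed (use f(1) in \<open>auto intro!: Ylt_closed fF_power_Ylt\<close>)
  have "y = (\<Sum>j<d. scP (\<alpha> j) (vvec j) + (if j \<in> {..<M} then scP (\<beta> j) (uvec j) else 0))"
    unfolding f(2)
  proof (intro sum.cong refl)
    fix j assume "j \<in> {..<d}"
    then show "f j * vvec j = scP (\<alpha> j) (vvec j) + (if j \<in> {..<M} then scP (\<beta> j) (uvec j) else 0)"
      by (simp add: fj[of j] distrib_right scP_cst uvec_def)
  qed
  also have "\<dots> = (\<Sum>j<d. scP (\<alpha> j) (vvec j)) + (\<Sum>j\<in>{..<d} \<inter> {..<M}. scP (\<beta> j) (uvec j))"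
    by (simp only: sum.distrib sum.inter_restrict[OF finite_lessThan])
  finally show ?thesis by blast
qed

text \<open>The two kinds of highest weight vectors are put into one family, since their weights are distinct also across the
  kinds: the exponents are at most \<open>M\<close> for \<open>v\<^sub>j\<close> and exceed \<open>M\<close> for \<open>u\<^sub>j\<close> with \<open>j < M\<close>.\<close>
definition zvec :: "nat + nat \<Rightarrow> 'k poly poly" where
  "zvec = case_sum vvec uvec"

definition zwt :: "nat + nat \<Rightarrow> nat" where
  "zwt = case_sum (\<lambda>j. j) (\<lambda>j. 2 * M - j)"

lemma K_zvec: 
  assumes "i \<in> Sum_Type.Plus {..M} {..<M}" shows "K (scP a (zvec i)) = scP (s * inverse q ^ zwt i) (scP a (zvec i))"
  using assms K_uvec by (auto simp: zvec_def zwt_def K_vvec Kop_lin scP_cst mult_ac)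

lemma zwt_inj: 
  assumes "i \<in> Sum_Type.Plus {..M} {..<M}" "i' \<in> Sum_Type.Plus {..M} {..<M}" "i \<noteq> i'"
  shows "s * inverse q ^ zwt i \<noteq> s * inverse q ^ zwt i'"
  using assms s by (auto simp: zwt_def inv_power_inj)

lemma E_kernel_zvec:
  assumes y: "y \<in> Ylt d" and d: "d \<le> Suc M" and E: "E y = 0"
  shows "\<exists>\<gamma>. y = (\<Sum>i\<in>Sum_Type.Plus {..<d} ({..<d} \<inter> {..<M}). scP (\<gamma> i) (zvec i))"
proof -
  obtain \<alpha> \<beta> where "y = (\<Sum>j<d. scP (\<alpha> j) (vvec j)) + (\<Sum>j\<in>{..<d} \<inter> {..<M}. scP (\<beta> j) (uvec j))"
    using E_kernel_expansion[OF assms] by blast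
  then have "y = (\<Sum>i\<in>Sum_Type.Plus {..<d} ({..<d} \<inter> {..<M}). scP (case_sum \<alpha> \<beta> i) (zvec i))"
    by (simp add: sum.Plus zvec_def)
  then show ?thesis by blast
qed

text \<open>\<open>N\<close> is only required to be stable under \<open>K\<close> and \<open>E\<close>, so that it may be a submodule intersected with the span of
  some of the \<open>F\<^sup>iv\<^sub>j\<close>.\<close>
lemma highest_weight_vector_in:
  assumes N: "0 \<in> N" "\<And>x y. x \<in> N \<Longrightarrow> y \<in> N \<Longrightarrow> x + y \<in> N" "\<And>a x. x \<in> N \<Longrightarrow> scP a x \<in> N"
    "\<And>x. x \<in> N \<Longrightarrow> K x \<in> N" "\<And>x. x \<in> N \<Longrightarrow> E x \<in> N"
    and y: "y \<in> N" "y \<in> Ylt d" "y \<noteq> 0" and d: "d \<le> Suc M"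
  shows "\<exists>j<d. vvec j \<in> N \<or> (j < M \<and> uvec j \<in> N)"
proof -
  obtain x where x: "x \<in> N" "x \<in> Ylt d" "x \<noteq> 0" "E x = 0"
    using E_kernel_in[of N, OF N(5) y d] by blast
  let ?I = "Sum_Type.Plus {..<d} ({..<d} \<inter> {..<M})"
  obtain \<gamma> where \<gamma>: "x = (\<Sum>i\<in>?I. scP (\<gamma> i) (zvec i))" using E_kernel_zvec[OF x(2) d x(4)] by blast
  have I: "i \<in> Sum_Type.Plus {..M} {..<M}" if "i \<in> ?I" for i using that d by auto
  obtain i where i: "i \<in> ?I" "scP (\<gamma> i) (zvec i) \<noteq> 0" using x(3) \<gamma> by (meson sum.neutral)
  have "x = scP (\<gamma> i) (zvec i) + (\<Sum>i\<in>?I - {i}. scP (\<gamma> i) (zvec i))"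
    unfolding \<gamma> using i(1) by (intro sum.remove) auto
  then have "scP (\<gamma> i) (zvec i) + (\<Sum>i\<in>?I - {i}. scP (\<gamma> i) (zvec i)) \<in> N" using x(1) by simp
  then have "scP (\<gamma> i) (zvec i) \<in> N"
  proof (rule eigen_isolate[where s=s and \<nu>="\<lambda>i. s * inverse q ^ zwt i" and \<mu>="s * inverse q ^ zwt i", rotated -1])
    show "K (scP (\<gamma> i) (zvec i)) = scP (s * inverse q ^ zwt i) (scP (\<gamma> i) (zvec i))"
      using I[OF i(1)] by (rule K_zvec)
    fix k assume k: "k \<in> ?I - {i}"
    show "K (scP (\<gamma> k) (zvec k)) = scP (s * inverse q ^ zwt k) (scP (\<gamma> k) (zvec k))"
      using I[of k] k by (intro K_zvec) auto
    show "s * inverse q ^ zwt k \<noteq> s * inverse q ^ zwt i"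
      using k I[of k] I[OF i(1)] by (intro zwt_inj) auto
  qed (use N in auto)
  then have "scP (inverse (\<gamma> i)) (scP (\<gamma> i) (zvec i)) \<in> N" by (rule N(3))
  then have "zvec i \<in> N" using i(2) by (simp add: scP_cst)
  then show ?thesis using i(1) by (auto simp: zvec_def)
qed

lemma singular_unique:
  assumes w: "singular s (s * inverse q ^ d) w" and d: "d \<le> M"
  shows "\<exists>\<gamma>. w = scP \<gamma> (vvec d)"
proof -
  have Kw: "K w = scP (s * inverse q ^ d) w" and Ew: "E w = 0" using w by (simp_all add: singular_def)
  have wY: "w \<in> Ylt (Suc d)"
    unfolding Ylt_def
  proof (intro CollectI allI impI)
    fix j assume j: "Suc d \<le> j"
    show "coeff w j = 0"
      using weight_vector_coeff[OF s Kw, of j] j by (auto simp: poly_eq_iff)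
  qed
  let ?I = "Sum_Type.Plus {..<Suc d} ({..<Suc d} \<inter> {..<M})"
  obtain \<gamma> where \<gamma>: "w = (\<Sum>i\<in>?I. scP (\<gamma> i) (zvec i))" using E_kernel_zvec[OF wY _ Ew] d by auto
  have I: "i \<in> Sum_Type.Plus {..M} {..<M}" if "i \<in> ?I" for i using that d by auto
  let ?x = "scP (\<gamma> (Inl d)) (vvec d)"
  have "w = scP (\<gamma> (Inl d)) (zvec (Inl d)) + (\<Sum>i\<in>?I - {Inl d}. scP (\<gamma> i) (zvec i))"
    unfolding \<gamma> by (intro sum.remove) auto
  then have "(?x - w) + (\<Sum>i\<in>?I - {Inl d}. scP (\<gamma> i) (zvec i)) \<in> {0}" by (simp add: zvec_def)
  then have "?x - w \<in> {0}"
  proof (rule eigen_isolate[where s=s and \<nu>="\<lambda>i. s * inverse q ^ zwt i" and \<mu>="s * inverse q ^ d", rotated -1])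
    show "K (?x - w) = scP (s * inverse q ^ d) (?x - w)"
      by (simp add: Kop_lin Kw K_vvec scP_cst mult_ac)
    fix k assume k: "k \<in> ?I - {Inl d}"
    show "K (scP (\<gamma> k) (zvec k)) = scP (s * inverse q ^ zwt k) (scP (\<gamma> k) (zvec k))"
      using I[of k] k by (intro K_zvec) auto
    have "zwt (Inl d) = d" by (simp add: zwt_def)
    then show "s * inverse q ^ zwt k \<noteq> s * inverse q ^ d"
      using k I[of k] d zwt_inj[of k "Inl d"] by auto
  qed (auto simp: Kop_lin scP_cst)
  then show ?thesis by (intro exI[of _ "\<gamma> (Inl d)"]) simp
qed

section \<open>Moving between highest weight vectors\<close>

lemma XF_coeff_closed: "XF_coeff q i * (q\<^sup>2 - 1) = q ^ (2 * i) - 1"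
proof (induction i)
  case (Suc i)
  have "q ^ (2 * Suc i) = q ^ (2 * i) * q\<^sup>2" by (simp add: power2_eq_square)
  moreover have "XF_coeff q (Suc i) * (q\<^sup>2 - 1) = XF_coeff q i * (q\<^sup>2 - 1) + q ^ (2 * i) * (q\<^sup>2 - 1)"
    by (simp only: XF_coeff_Suc distrib_right)
  ultimately show ?case unfolding Suc by (simp add: right_diff_distrib)
qed (simp add: XF_coeff_0)

lemma XF_coeff_neq_0: "i > 0 \<Longrightarrow> XF_coeff q i \<noteq> 0"
  using XF_coeff_closed[of i] q_not_root[of "2 * i"] by auto

lemma XF_coeff_qbrace:
  assumes "i + j = M"
  shows "XF_coeff q i * (inverse s * q ^ j) = qbrace q (q * s * inverse q ^ j)"
proof -
  have 1: "inverse s * q ^ j = \<epsilon> * q * inverse q ^ i"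
    using assms by (auto simp: s_inv power_add power_inverse)
  have 2: "q * s * inverse q ^ j = \<epsilon> * q ^ i"
    using assms by (auto simp: sM power_add power_inverse mult.assoc)
  have "XF_coeff q i * (\<epsilon> * q * inverse q ^ i) * (q - inverse q) = \<epsilon> * inverse q ^ i * (XF_coeff q i * (q\<^sup>2 - 1))"
  proof -
    have "q * (q - inverse q) = q\<^sup>2 - 1" by (simp add: power2_eq_square right_diff_distrib)
    moreover have "XF_coeff q i * (\<epsilon> * q * inverse q ^ i) * (q - inverse q) =
      \<epsilon> * inverse q ^ i * (XF_coeff q i * (q * (q - inverse q)))" by (simp only: mult_ac)
    ultimately show ?thesis by (simp only:)
  qed
  also have "\<dots> = \<epsilon> * (q ^ i - inverse q ^ i)"
    unfolding XF_coeff_closed by (simp add: right_diff_distrib power_inverse mult_2 power_add)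
  also have "\<dots> = qbrace q (\<epsilon> * q ^ i) * (q - inverse q)"
  proof -
    have "qbrace q z * (q - inverse q) = z - inverse z" for z
      unfolding qbrace_def by (rule nonzero_eq_divide_eq[THEN iffD1, OF q_diff refl])
    then show ?thesis by (simp only: inverse_mult_distrib eps_simps power_inverse right_diff_distrib)
  qed
  finally show ?thesis unfolding 1 2 using q_diff by simp
qed

text \<open>The part of \<open>Xu\<^sub>j\<close> proportional to \<open>F\<^sup>M\<^sup>-\<^sup>jv\<^sub>j\<^sub>-\<^sub>1\<close> cancels precisely for the exponent \<open>M - j\<close>; what remains comes
  from \<open>[F,X]\<close> and is nonzero whatever the value of \<open>S j\<close>.\<close>
lemma X_uvec:
  assumes j: "j < M"
  shows "\<exists>\<gamma>. \<gamma> \<noteq> 0 \<and> X (uvec j) = scP \<gamma> (uvec (Suc j))"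
proof -
  define i where "i = M - Suc j"
  have i: "M - j = Suc i" "Suc i + j = M" using j by (auto simp: i_def)
  let ?k = "XF_coeff q (Suc i) * (inverse s * q ^ j)"
  have "qbrace q (q * s * inverse q ^ j) \<noteq> 0" using qbrace_b[of j] j by simp
  then have a: "X_coeff j = Y_coeff j * ?k" unfolding XF_coeff_qbrace[OF i(2)] by (simp add: Y_coeff_def)
  have "X (uvec j) = scP (X_coeff j) (fF ^ Suc i * vvec (j - 1)) - scP ?k (fF ^ i * (yY * vvec j))"
    using vvec_EX[of j] j unfolding uvec_def i(1) X_fF_power by (simp add: Ki_vvec scP_cst)
  also have "scP ?k (fF ^ i * (yY * vvec j)) = scP ?k (fF ^ i * vvec (Suc j)) + scP (X_coeff j) (fF ^ Suc i * vvec (j - 1))"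
    unfolding yY_vvec by (simp add: a distrib_left scP_cst mult_ac)
  finally have "X (uvec j) = scP (- ?k) (uvec (Suc j))"
    by (simp add: uvec_def i_def scP_left)
  moreover have "- ?k \<noteq> 0" using XF_coeff_neq_0[of "Suc i"] s by simp
  ultimately show ?thesis by blast
qed

lemma yY_uvec:
  assumes j: "j < M"
  shows "yY * uvec j = fF * uvec (Suc j) + (if j = 0 then 0 else scP (Y_coeff j) (uvec (j - 1)))"
proof -
  have e: "Suc (M - Suc j) = M - j" "j > 0 \<Longrightarrow> M - (j - 1) = Suc (M - j)" using j by auto
  have u: "uvec (j - 1) = fF ^ Suc (M - j) * vvec (j - 1)" if "j > 0"
    unfolding uvec_def e(2)[OF that] ..
  have "yY * uvec j = fF ^ (M - j) * (yY * vvec j)" by (simp add: uvec_def mult_ac)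
  also have "\<dots> = fF ^ Suc (M - Suc j) * vvec (Suc j) + scP (Y_coeff j) (fF ^ Suc (M - j) * vvec (j - 1))"
    unfolding yY_vvec e(1) by (simp add: distrib_left scP_cst mult_ac)
  also have "fF ^ Suc (M - Suc j) * vvec (Suc j) = fF * uvec (Suc j)" by (simp add: uvec_def mult.assoc)
  also have "scP (Y_coeff j) (fF ^ Suc (M - j) * vvec (j - 1)) = (if j = 0 then 0 else scP (Y_coeff j) (uvec (j - 1)))"
    using u by (simp add: Y_coeff_0 scP_cst)
  finally show ?thesis .
qed

lemma stableN:
  assumes "stable scP T N" "x \<in> N"
  shows "fF * x \<in> N" "yY * x \<in> N" "K x \<in> N" "Ki x \<in> N" "E x \<in> N" "X x \<in> N"
  using stableD(4)[OF assms, of "Uq gF"] stableD(4)[OF assms, of gY] stableD(4)[OF assms, of "Uq gK"]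
    stableD(4)[OF assms, of "Uq gKi"] stableD(4)[OF assms, of "Uq gE"] stableD(4)[OF assms, of gX] by simp_all

lemma stable_scP_cancel:
  assumes "stable scP T N" "scP a x \<in> N" "a \<noteq> 0" shows "x \<in> N"
  using stableD(3)[OF assms(1,2), of "inverse a"] assms(3) by (simp add: scP_cst)

lemma uvec_up:
  assumes N: "stable scP T N" and j: "uvec j \<in> N" "j \<le> k" "k \<le> M"
  shows "uvec k \<in> N"
  using j(2,3)
proof (induction k rule: dec_induct)
  case (step k)
  obtain \<gamma> where "\<gamma> \<noteq> 0" "X (uvec k) = scP \<gamma> (uvec (Suc k))" using X_uvec[of k] step by auto
  then show ?case using stableN(6)[OF N, of "uvec k"] step stable_scP_cancel[OF N] by auto
qed (use j in simp)

lemma vvec_down: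
  assumes N: "stable scP T N" and j: "vvec j \<in> N" "j \<le> M" "\<And>i. 0 < i \<Longrightarrow> i \<le> j \<Longrightarrow> S i \<noteq> 0"
  shows "1 \<in> N"
  using j
proof (induction j)
  case (Suc j)
  have "X (vvec (Suc j)) = scP (X_coeff (Suc j)) (vvec j)" using vvec_EX[of "Suc j"] Suc.prems by simp
  moreover have "X_coeff (Suc j) \<noteq> 0" using Suc.prems X_coeff_eq_0_iff[of "Suc j"] by simp
  ultimately have "vvec j \<in> N" using stableN(6)[OF N Suc.prems(1)] stable_scP_cancel[OF N] by auto
  then show ?case using Suc by simp
qed simp

lemma highest_weight_vector_in_stable:
  assumes N: "stable scP T N" and y: "y \<in> N" "y \<in> Ylt d" "y \<noteq> 0" and d: "d \<le> Suc M"
  shows "\<exists>j<d. vvec j \<in> N \<or> (j < M \<and> uvec j \<in> N)"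
  by (rule highest_weight_vector_in[OF _ _ _ _ _ y d]) (use stableD[OF N] stableN[OF N] in auto)

section \<open>Submodules beyond the last zero\<close>

text \<open>The weight comparisons at the end work without decomposing \<open>N\<close> into weight spaces: \<open>Ew\<close>, \<open>Xw\<close> and \<open>Kw\<close> are multiples of
  \<open>w\<close>, and degrees or eigenvalues leave only the expected possibility.\<close>
lemma submodule_is_Verma:
  assumes nz: "\<And>j. 0 < j \<Longrightarrow> j \<le> M \<Longrightarrow> S j \<noteq> 0"
    and N: "stable scP T N" "1 \<notin> N" "N \<noteq> {0}"
  obtains D w where "D > M" "w \<noteq> 0" "singular s (s * inverse q ^ D) w" "N = range (\<lambda>y. y * w)"
proof -
  have low: "x = 0" if "x \<in> N" "x \<in> Ylt (Suc M)" for x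
  proof (rule ccontr)
    note xN = that
    assume "x \<noteq> 0"
    then obtain j where j: "j < Suc M" "vvec j \<in> N \<or> (j < M \<and> uvec j \<in> N)"
      using highest_weight_vector_in_stable[OF N(1) xN _ le_refl] by blast
    then have "vvec j \<in> N \<or> vvec M \<in> N"
      using uvec_up[OF N(1), of j M] uvec_M by auto
    then obtain j' where "j' \<le> M" "vvec j' \<in> N" using j(1) less_Suc_eq_le by blast
    then show False using vvec_down[OF N(1), of j'] nz N(2) by auto
  qed
  define P where "P D \<longleftrightarrow> (\<exists>x\<in>N. x \<in> Ylt (Suc D) \<and> x \<noteq> 0)" for D
  define D where "D = (LEAST D. P D)"
  have "\<exists>x\<in>N. x \<noteq> 0" using N(3) stableD(1)[OF N(1)] by auto
  then have "\<exists>D. P D" unfolding P_def using Ylt_exists by (meson Ylt_mono le_SucI order_refl)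
  then have PD: "P D" unfolding D_def by (rule LeastI_ex)
  have DM: "D > M"
  proof (rule ccontr)
    assume "\<not> D > M"
    then show False using PD low Ylt_mono[of _ "Suc D" "Suc M"] by (auto simp: P_def)
  qed
  have least: "x = 0" if "x \<in> N" "x \<in> Ylt D" for x
  proof -
    obtain D' where D': "D = Suc D'" using DM by (cases D) auto
    then have "\<not> P D'" unfolding D_def by (metis not_less_Least lessI)
    then show ?thesis using that D' by (auto simp: P_def)
  qed
  let ?Q = "\<lambda>x. x \<in> N \<and> x \<in> Ylt (Suc D) \<and> x \<noteq> 0"
  obtain x where x: "?Q x" and xmin: "\<And>y. ?Q y \<Longrightarrow> degree (coeff x D) \<le> degree (coeff y D)"
    using PD ex_has_least_nat[of ?Q _ "\<lambda>x. degree (coeff x D)"] by (auto simp: P_def)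
  have cx: "coeff x D \<noteq> 0"
  proof
    assume "coeff x D = 0"
    then have "x \<in> Ylt D" using x by (auto simp: Ylt_def) (metis le_antisym not_less_eq_eq)
    then show False using least x by blast
  qed
  have top: "coeff (coeff (E z) D) i = E_coeff q (Suc i) (s * inverse q ^ D) * coeff (coeff z D) (Suc i)"
    if "z \<in> Ylt (Suc D)" for z i
    by (rule coeff_Eop_top[OF e_Ylt[OF s] that])
  have "degree (coeff x D) = 0"
  proof (rule ccontr)
    assume "degree (coeff x D) \<noteq> 0"
    then obtain g where g: "degree (coeff x D) = Suc g" by (cases "degree (coeff x D)") auto
    have "E_coeff q (Suc g) (s * inverse q ^ D) \<noteq> 0" using E_coeff_eq_0_iff[of "Suc g" D] DM by simp
    then have "coeff (coeff (E x) D) g \<noteq> 0"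
      using top[of x g] x g cx by (metis leading_coeff_neq_0 mult_eq_0_iff)
    then have "E x \<noteq> 0" by auto
    then have "Suc g \<le> degree (coeff (E x) D)"
      using xmin[of "E x"] x g stableN(5)[OF N(1)] E_Ylt by auto
    moreover have "degree (coeff (E x) D) \<le> g"
      using g x by (intro degree_le) (simp add: top coeff_eq_0)
    ultimately show False by simp
  qed
  then obtain a where a: "coeff x D = [:a:]" "a \<noteq> 0" using cx by (metis degree_eq_zeroE pCons_0_0)
  define w where "w = scP (inverse a) x"
  have wN: "w \<in> N" "w \<in> Ylt (Suc D)" unfolding w_def using x stableD(3)[OF N(1)] Ylt_closed(3) by auto
  have wD: "coeff w D = 1" using a by (simp add: w_def one_pCons)
  have wm: "monicY D w"
    unfolding monicY_def Ylt_def
  proof (intro CollectI allI impI)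
    fix j assume "D \<le> j"
    then show "coeff (w - yY ^ D) j = 0"
      using wN(2) wD by (cases "j = D") (auto simp: coeff_yY_power Ylt_def)
  qed
  have N_eq: "N = range (\<lambda>y. y * w)"
  proof
    show "range (\<lambda>y. y * w) \<subseteq> N" using stable_mult[OF N(1) wN(1)] by auto
    show "N \<subseteq> range (\<lambda>y. y * w)"
    proof
      fix z assume z: "z \<in> N"
      obtain y r where yr: "r \<in> Ylt D" "z = y * w + r" using monicY_division[OF wm] by blast
      have "z + scP (- 1) (y * w) \<in> N"
        by (intro stableD[OF N(1)] z stable_mult[OF N(1) wN(1)])
      then have "r \<in> N" using yr(2) by (simp add: scP_left scP_cst)
      then have "r = 0" using least yr(1) by blast
      then show "z \<in> range (\<lambda>y. y * w)" using yr(2) by auto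
    qed
  qed
  have w0: "w \<noteq> 0" using wD by auto
  have Ew: "E w = 0"
  proof (rule least)
    show "E w \<in> N" by (rule stableN(5)[OF N(1) wN(1)])
    have "coeff (E w) D = 0" by (rule poly_eqI) (simp add: top[OF wN(2)] wD)
    then show "E w \<in> Ylt D"
      using E_Ylt[OF wN(2)] by (auto simp: Ylt_def) (metis le_antisym not_less_eq_eq)
  qed
  have Kw: "K w = scP (s * inverse q ^ D) w"
  proof -
    let ?d = "K w + scP (- (s * inverse q ^ D)) w"
    have "coeff (K w) D = [:s * inverse q ^ D:]"
      by (rule poly_eqI) (simp add: coeff_Kop wD coeff_1 coeff_pCons split: nat.split)
    then have "coeff ?d D = 0" by (simp add: wD one_pCons)
    moreover have "?d \<in> Ylt (Suc D)" by (intro Ylt_closed Kop_Ylt wN)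
    ultimately have "?d \<in> Ylt D" by (auto simp: Ylt_def) (metis le_antisym not_less_eq_eq)
    moreover have "?d \<in> N" by (intro stableD[OF N(1)] stableN[OF N(1)] wN)
    ultimately have "?d = 0" by (intro least)
    then show ?thesis by (simp add: scP_left)
  qed
  have Xw: "X w = 0"
  proof -
    obtain y where y: "X w = y * w" using N_eq stableN(6)[OF N(1) wN(1)] by blast
    have "K (X w) = scP (q * (s * inverse q ^ D)) (X w)" by (simp add: KX[OF s] Kw Xop_lin scP_cst)
    moreover have "K (y * w) = Kop q 1 y * K w" using Kop_mult[of q 1 s y w] by simp
    ultimately have "Kop q 1 y * scP (s * inverse q ^ D) w = scP (q * (s * inverse q ^ D)) (y * w)"
      by (simp add: y Kw)
    then have "scP (s * inverse q ^ D) (Kop q 1 y * w) = scP (s * inverse q ^ D) (scP q y * w)"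
      by (simp add: scP_cst mult_ac)
    then have "scP (s * inverse q ^ D) (Kop q 1 y * w - scP q y * w) = 0" by (simp add: scP_cst)
    then have "Kop q 1 y * w = scP q y * w" using s by simp
    then have Ky: "Kop q 1 y = scP q y" using w0 by simp
    have "coeff (coeff y j) i = 0" for j i
    proof -
      have "inverse q ^ (2 * i + j) * coeff (coeff y j) i = q * coeff (coeff y j) i"
        using arg_cong[OF Ky, of "\<lambda>x. coeff (coeff x j) i"] by (simp add: coeff_Kop)
      then have "inverse q ^ Suc (2 * i + j) * coeff (coeff y j) i = inverse q ^ 0 * coeff (coeff y j) i"
        by auto
      then show ?thesis using inv_power_inj[of "Suc (2 * i + j)" 0] by (simp del: power_Suc)
    qed
    then have "y = 0" by (simp add: poly_eq_iff)
    then show ?thesis by (simp add: y)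
  qed
  show thesis
    by (rule that[OF DM w0 _ N_eq]) (simp add: singular_def Ew Kw Xw)
qed

end

context osc_param
begin

lemma stable_image_singular:
  assumes s: "s \<noteq> 0" "s' \<noteq> 0" and w: "singular s s' w" and A: "stable scP (osc_op q c s') A"
  shows "stable scP (osc_op q c s) ((\<lambda>y. y * w) ` A)"
proof (rule stableI)
  fix x y assume "x \<in> (\<lambda>y. y * w) ` A" "y \<in> (\<lambda>y. y * w) ` A"
  then show "x + y \<in> (\<lambda>y. y * w) ` A" using stableD(2)[OF A] by (auto simp: distrib_right[symmetric])
next
  fix g x assume "x \<in> (\<lambda>y. y * w) ` A"
  then show "osc_op q c s g x \<in> (\<lambda>y. y * w) ` A"
    using stableD(4)[OF A] by (auto simp: osc_hom[OF s w, symmetric])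
qed (use stableD(1,3)[OF A] in \<open>auto simp: scP_cst[symmetric] intro!: image_eqI[of 0 _ 0]\<close>)

end

section \<open>Between two consecutive zeros\<close>

text \<open>\<open>d\<close> is the first positive zero of \<open>S\<close>, that is, the distance from one zero \<open>n\<^sub>i\<close> to the next when \<open>s = t\<^sub>i\<close>.\<close>
locale osc_gap = osc_int q c s \<epsilon> M for q :: "'k::field" and c s \<epsilon> M +
  fixes d :: nat
  assumes d_pos: "0 < d" and d_le: "d \<le> M" and S_d: "S d = 0"
    and S_nz: "\<And>j. 0 < j \<Longrightarrow> j < d \<Longrightarrow> S j \<noteq> 0"
begin

definition next_verma :: "'k poly poly set" where "next_verma = range (\<lambda>y. y * vvec d)"

text \<open>This turns out to be the maximal submodule.\<close>
definition gap_submod :: "'k poly poly set" where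
  "gap_submod = {(\<Sum>j<d. f j * uvec j) + y * vvec d |f y. \<forall>j. f j \<in> Ylt 1}"

lemma stable_next_verma: "stable scP T next_verma"
  unfolding next_verma_def
  by (rule stable_image_singular[OF s sp_neq_0 singular_vvec[OF d_le S_d] stable_UNIV])

lemma vvec_d_next_verma: "y * vvec d \<in> next_verma"
  unfolding next_verma_def by blast

lemma next_verma_Ylt: "x \<in> next_verma \<Longrightarrow> x \<in> Ylt d \<Longrightarrow> x = 0"
  using monicY_mult_Ylt[OF monic_vvec] by (auto simp: next_verma_def)

lemma next_verma_gap_submod: "x \<in> next_verma \<Longrightarrow> x \<in> gap_submod"
  unfolding next_verma_def gap_submod_def by (auto intro!: exI[of _ "\<lambda>_. 0"])

lemma uvec_d_next_verma: "uvec d \<in> next_verma"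
  unfolding uvec_def by (rule vvec_d_next_verma)

lemma gap_submod_closed:
  "x \<in> gap_submod \<Longrightarrow> x' \<in> gap_submod \<Longrightarrow> x + x' \<in> gap_submod" "x \<in> gap_submod \<Longrightarrow> scP a x \<in> gap_submod" "x \<in> gap_submod \<Longrightarrow> fF * x \<in> gap_submod" "0 \<in> gap_submod"
  "x \<in> gap_submod \<Longrightarrow> x' \<in> gap_submod \<Longrightarrow> x - x' \<in> gap_submod"
proof -
  show add: "x + x' \<in> gap_submod" if x: "x \<in> gap_submod" "x' \<in> gap_submod" for x x'
  proof -
    obtain f y f' y' where "x = (\<Sum>j<d. f j * uvec j) + y * vvec d" "\<forall>j. f j \<in> Ylt 1"
      "x' = (\<Sum>j<d. f' j * uvec j) + y' * vvec d" "\<forall>j. f' j \<in> Ylt 1" using x by (auto simp: gap_submod_def)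
    then have "x + x' = (\<Sum>j<d. (f j + f' j) * uvec j) + (y + y') * vvec d \<and> (\<forall>j. f j + f' j \<in> Ylt 1)"
      by (simp add: distrib_right sum.distrib Ylt_closed)
    then show ?thesis unfolding gap_submod_def by (intro CollectI exI[of _ "\<lambda>j. f j + f' j"] exI[of _ "y + y'"]) simp
  qed
  show scale: "scP a x \<in> gap_submod" if x: "x \<in> gap_submod" for x a
  proof -
    obtain f y where "x = (\<Sum>j<d. f j * uvec j) + y * vvec d" "\<forall>j. f j \<in> Ylt 1" using x by (auto simp: gap_submod_def)
    then have "scP a x = (\<Sum>j<d. scP a (f j) * uvec j) + scP a y * vvec d \<and> (\<forall>j. scP a (f j) \<in> Ylt 1)"
      by (simp add: scP_def distrib_left sum_distrib_left mult.assoc) (simp add: scP_def[symmetric] Ylt_closed)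
    then show ?thesis unfolding gap_submod_def by (intro CollectI exI[of _ "\<lambda>j. scP a (f j)"] exI[of _ "scP a y"]) simp
  qed
  show "fF * x \<in> gap_submod" if x: "x \<in> gap_submod"
  proof -
    obtain f y where "x = (\<Sum>j<d. f j * uvec j) + y * vvec d" "\<forall>j. f j \<in> Ylt 1" using x by (auto simp: gap_submod_def)
    then have "fF * x = (\<Sum>j<d. (fF * f j) * uvec j) + (fF * y) * vvec d \<and> (\<forall>j. fF * f j \<in> Ylt 1)"
      by (simp add: distrib_left sum_distrib_left mult.assoc Ylt_closed)
    then show ?thesis unfolding gap_submod_def by (intro CollectI exI[of _ "\<lambda>j. fF * f j"] exI[of _ "fF * y"]) simp
  qed
  show "0 \<in> gap_submod" using next_verma_gap_submod stableD(1)[OF stable_next_verma] by blast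
  show "x - x' \<in> gap_submod" if "x \<in> gap_submod" "x' \<in> gap_submod"
    using add[OF that(1) scale[OF that(2), of "-1"]] by (simp add: scP_left scP_cst)
qed

lemma uvec_gap_submod: 
  assumes "j \<le> d" shows "uvec j \<in> gap_submod"
proof (cases "j = d")
  case True
  then show ?thesis using uvec_d_next_verma next_verma_gap_submod by blast
next
  case False
  define f where "f = (\<lambda>i. if i = j then 1 else 0 :: 'k poly poly)"
  have "(\<Sum>i<d. f i * uvec i) = (\<Sum>i<d. if i = j then uvec i else 0)"
    by (intro sum.cong) (auto simp: f_def)
  then have "uvec j = (\<Sum>i<d. f i * uvec i) + 0 * vvec d" using False assms by simp
  moreover have "\<forall>i. f i \<in> Ylt 1" by (simp add: f_def)
  ultimately show ?thesis unfolding gap_submod_def by blast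
qed

lemma gap_submod_induct [consumes 1, case_names add scale fF uvec vvec]:
  assumes x: "x \<in> gap_submod" and add: "\<And>x y. P x \<Longrightarrow> P y \<Longrightarrow> P (x + y)" and scale: "\<And>a x. P x \<Longrightarrow> P (scP a x)"
    and fF: "\<And>x. x \<in> gap_submod \<Longrightarrow> P x \<Longrightarrow> P (fF * x)" and u: "\<And>j. j < d \<Longrightarrow> P (uvec j)" and v: "\<And>y. P (y * vvec d)"
  shows "P x"
proof -
  obtain f y where f: "x = (\<Sum>j<d. f j * uvec j) + y * vvec d" "\<forall>j. f j \<in> Ylt 1" using x by (auto simp: gap_submod_def)
  have zero: "P 0" using v[of 0] by simp
  have "P (g * uvec j) \<and> g * uvec j \<in> gap_submod" if j: "j < d" and g: "g \<in> Ylt 1" for g j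
    using g
  proof (induction g rule: yY_fF_induct)
    case (yY i)
    then show ?case using u[OF j] uvec_gap_submod[of j] j by simp
  qed (use zero j in \<open>auto simp: distrib_right scP_cst mult.assoc intro: add scale fF gap_submod_closed\<close>)
  then have "P (\<Sum>j<d. f j * uvec j)"
    using f(2) by (intro sum_induct_closed[where P=P]) (auto intro: zero add)
  then show ?thesis unfolding f(1) using v by (intro add)
qed

text \<open>Each operator is moved past \<open>F\<close>, so its action has to be known on the \<open>u\<^sub>j\<close> only. The order of the steps matters: \<open>X\<close> produces
  \<open>YK\<^sup>-\<^sup>1\<close>, and \<open>E\<close> produces \<open>K - K\<^sup>-\<^sup>1\<close>.\<close>
lemma stable_gap_submod: "stable scP T gap_submod"
proof -
  have next_verma: "T g (y * vvec d) \<in> gap_submod" for g y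
    using stableD(4)[OF stable_next_verma vvec_d_next_verma] next_verma_gap_submod by blast
  have Y: "yY * x \<in> gap_submod" if "x \<in> gap_submod" for x
    using that
  proof (induction x rule: gap_submod_induct)
    case (uvec j)
    have "uvec (j - 1) \<in> gap_submod" by (rule uvec_gap_submod) (use uvec in simp)
    then show ?case using uvec d_le uvec_gap_submod[of "Suc j"]
      by (auto simp: yY_uvec intro: gap_submod_closed)
  qed (use next_verma[of gY] in \<open>auto simp: distrib_left scP_cst mult.left_commute[of yY fF] intro: gap_submod_closed\<close>)
  have K: "K x \<in> gap_submod" if "x \<in> gap_submod" for x
    using that
  proof (induction x rule: gap_submod_induct)
    case (uvec j)
    then show ?case using d_le uvec_gap_submod[of j] by (auto simp: K_uvec intro: gap_submod_closed)
  next
    case (fF x)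
    then show ?case using Kop_fF[of q s 1 x] by (auto intro: gap_submod_closed)
  qed (use next_verma[of "Uq gK"] in \<open>auto simp: Kop_lin intro: gap_submod_closed\<close>)
  have Ki: "Ki x \<in> gap_submod" if "x \<in> gap_submod" for x
    using that
  proof (induction x rule: gap_submod_induct)
    case (uvec j)
    then have "Ki (uvec j) = scP (inverse (s * inverse q ^ (2 * M - j))) (uvec j)"
      using d_le s by (intro Kop_inv_weight K_uvec) auto
    then show ?case using uvec uvec_gap_submod[of j] by (auto intro: gap_submod_closed)
  next
    case (fF x)
    then show ?case using Kop_fF[of "inverse q" "inverse s" 1 x] by (auto intro: gap_submod_closed)
  qed (use next_verma[of "Uq gKi"] in \<open>auto simp: Kop_lin intro: gap_submod_closed\<close>)
  have E: "E x \<in> gap_submod" if "x \<in> gap_submod" for x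
    using that
  proof (induction x rule: gap_submod_induct)
    case (uvec j)
    then show ?case using d_le E_coeff_eq_0_iff[of "M - j" j] gap_submod_closed(4)
      by (simp add: uvec_def E_fF_vvec scP_cst)
  qed (use next_verma[of "Uq gE"] in \<open>auto simp: Eop_lin E_fF intro: gap_submod_closed K Ki\<close>)
  have X: "X x \<in> gap_submod" if "x \<in> gap_submod" for x
    using that
  proof (induction x rule: gap_submod_induct)
    case (uvec j)
    then obtain \<gamma> where "X (uvec j) = scP \<gamma> (uvec (Suc j))" using X_uvec[of j] d_le by auto
    then show ?case using uvec uvec_gap_submod[of "Suc j"] by (auto intro: gap_submod_closed)
  qed (use next_verma[of gX] in \<open>auto simp: Xop_lin X_fF intro: gap_submod_closed Y Ki\<close>)
  show ?thesis
  proof (rule stableI)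
    fix g x assume "x \<in> gap_submod"
    then show "T g x \<in> gap_submod"
    proof (cases g)
      case (Uq u)
      then show ?thesis using \<open>x \<in> gap_submod\<close> K Ki E gap_submod_closed(3) by (cases u) auto
    qed (use \<open>x \<in> gap_submod\<close> X Y in auto)
  qed (auto intro: gap_submod_closed)
qed

lemma uvec_const_Ylt: "j < d \<Longrightarrow> f \<in> Ylt 1 \<Longrightarrow> f * uvec j \<in> Ylt d"
  unfolding uvec_def
  by (intro Ylt_const_mult Ylt_fF_power Ylt_mono[OF monicY_coeff(3)[OF monic_vvec]]) auto

lemma one_notin_gap_submod: "1 \<notin> gap_submod"
proof
  assume "1 \<in> gap_submod"
  then obtain f y where f: "1 = (\<Sum>j<d. f j * uvec j) + y * vvec d" "\<forall>j. f j \<in> Ylt 1" by (auto simp: gap_submod_def)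
  have "(\<Sum>j<d. f j * uvec j) \<in> Ylt d" using f(2) by (intro Ylt_sum uvec_const_Ylt) auto
  moreover have "(1 :: 'k poly poly) \<in> Ylt d" using Ylt_mono[of 1 "Suc 0" d] d_pos by simp
  moreover have "y * vvec d = 1 - (\<Sum>j<d. f j * uvec j)"
    by (metis f(1) add_diff_cancel_left')
  ultimately have "y * vvec d \<in> Ylt d" by (simp add: Ylt_closed)
  then have y: "y = 0" by (rule monicY_mult_Ylt[OF monic_vvec])
  define g where "g j = f j * fF ^ (M - j) - (if j = 0 then 1 else 0)" for j
  have "(\<Sum>j<d. g j * vvec j) = (\<Sum>j<d. f j * uvec j) - (\<Sum>j<d. if j = 0 then vvec j else 0)"
    unfolding sum_subtractf[symmetric]
    by (intro sum.cong) (auto simp: g_def uvec_def left_diff_distrib mult.assoc)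
  also have "\<dots> = 0" using f(1) y d_pos by simp
  finally have "g 0 = 0"
    using f(2) d_pos
    by (intro monic_expansion_unique[of vvec d g, OF monic_vvec])
      (auto simp: g_def intro!: Ylt_closed(2) Ylt_const_mult fF_power_Ylt)
  then have "f 0 * fF ^ M = 1" by (simp add: g_def)
  moreover obtain M' where "M = Suc M'" using d_pos d_le by (cases M) auto
  ultimately have "fF * (f 0 * fF ^ M') = 1" by (simp add: mult_ac)
  then have "coeff (coeff (fF * (f 0 * fF ^ M')) 0) 0 = coeff (coeff 1 0) 0" by simp
  then show False by (simp add: coeff_fF)
qed

text \<open>The coefficients \<open>g\<^sub>j \<in> k[F]\<close> of degree less than \<open>M - j\<close>: the normal forms modulo \<open>gap_submod\<close>.\<close>
definition small :: "(nat \<Rightarrow> 'k poly poly) \<Rightarrow> bool" where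
  "small g \<longleftrightarrow> (\<forall>j. g j \<in> Ylt 1 \<and> (\<forall>i\<ge>M - j. coeff (coeff (g j) 0) i = 0))"

lemma reduce_gap_submod: "\<exists>g. small g \<and> x - (\<Sum>j<d. g j * vvec j) \<in> gap_submod"
proof -
  obtain y r where yr: "r \<in> Ylt d" "x = y * vvec d + r" using monicY_division[OF monic_vvec] by blast
  obtain f where f: "\<forall>j. f j \<in> Ylt 1" "r = (\<Sum>j<d. f j * vvec j)"
    using monic_expansion[of vvec, OF monic_vvec yr(1)] by blast
  define a where "a j = coeff (f j) 0" for j
  have fa: "f j = [:a j:]" for j
  proof -
    have "f j \<in> Ylt (Suc 0)" using f(1) by simp
    then obtain b where "f j = [:b:]" by (auto simp: Ylt_1)
    then show ?thesis by (simp add: a_def)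
  qed
  define g h where "g j = [:a j mod monom 1 (M - j):]" and "h j = [:a j div monom 1 (M - j):]" for j
  have gh: "f j = g j + h j * fF ^ (M - j)" for j
    by (simp add: fa g_def h_def fF_power add.commute mult.commute)
  have "coeff (a j mod monom 1 (M - j)) i = 0" if "i \<ge> M - j" for i j
  proof -
    have "monom 1 (M - j) \<noteq> (0 :: 'k poly)" by simp
    from degree_mod_less[OF this, of "a j"] show ?thesis
      using that by (auto simp: degree_monom_eq coeff_eq_0)
  qed
  then have small: "small g" by (simp add: small_def g_def Ylt_const)
  have "x - (\<Sum>j<d. g j * vvec j) = (\<Sum>j<d. h j * uvec j) + y * vvec d"
    unfolding yr(2) f(2) gh by (simp add: distrib_right sum.distrib uvec_def mult.assoc)
  moreover have "\<forall>j. h j \<in> Ylt 1" by (simp add: h_def Ylt_const)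
  ultimately have "x - (\<Sum>j<d. g j * vvec j) \<in> gap_submod" unfolding gap_submod_def by blast
  then show ?thesis using small by blast
qed

lemma S_nz_le: "j < d \<Longrightarrow> 0 < i \<Longrightarrow> i \<le> j \<Longrightarrow> S i \<noteq> 0"
  by (rule S_nz) auto

lemma vvec_notin_max_submod: "j < d \<Longrightarrow> vvec j \<notin> max_submod s"
  using vvec_down[OF stable_max_submod, of j] S_nz_le[of j] d_le one_notin_max_submod by auto

text \<open>Reduce an element of the maximal submodule modulo \<open>gap_submod\<close>. If the normal form were not zero, there would be a
  highest weight vector among the normal forms, which can only be some \<open>v\<^sub>j\<close> with \<open>j < d\<close>; but then \<open>X\<close> leads
  to \<open>1\<close>.\<close>
lemma max_submod_eq_gap_submod: "max_submod s = gap_submod"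
proof
  show gap_submod: "gap_submod \<subseteq> max_submod s" by (rule max_submod_maximal[OF s stable_gap_submod one_notin_gap_submod])
  show "max_submod s \<subseteq> gap_submod"
  proof
    fix x assume x: "x \<in> max_submod s"
    obtain g where g: "small g" "x - (\<Sum>j<d. g j * vvec j) \<in> gap_submod" using reduce_gap_submod by blast
    let ?r = "\<Sum>j<d. g j * vvec j"
    interpret T: operators scP T by (rule operators_osc_op)
    have r: "?r \<in> max_submod s"
      using T.stable_minus[OF stable_max_submod x, of "x - ?r"] g(2) gap_submod by auto
    have rY: "?r \<in> Ylt d"
      using g(1) by (intro Ylt_sum Ylt_const_mult Ylt_mono[OF monicY_coeff(3)[OF monic_vvec]]) (auto simp: small_def)
    define L where "L = {(\<Sum>j<d. g j * vvec j) |g. small g}"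
    have "?r = 0"
    proof (rule ccontr)
      assume nz: "?r \<noteq> 0"
      have "\<exists>j<d. vvec j \<in> max_submod s \<inter> L \<or> (j < M \<and> uvec j \<in> max_submod s \<inter> L)"
      proof (rule highest_weight_vector_in[OF _ _ _ _ _ _ rY nz])
        show "0 \<in> max_submod s \<inter> L"
          using stableD(1)[OF stable_max_submod] unfolding L_def by (auto simp: small_def intro!: exI[of _ "\<lambda>_. 0"])
        show "?r \<in> max_submod s \<inter> L" using r g(1) by (auto simp: L_def)
        show "d \<le> Suc M" using d_le by simp
      next
        fix x y assume xy: "x \<in> max_submod s \<inter> L" "y \<in> max_submod s \<inter> L"
        then obtain g g' where "small g" "small g'" "x = (\<Sum>j<d. g j * vvec j)" "y = (\<Sum>j<d. g' j * vvec j)"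
          by (auto simp: L_def)
        then have "small (\<lambda>j. g j + g' j) \<and> x + y = (\<Sum>j<d. (g j + g' j) * vvec j)"
          by (simp add: small_def Ylt_closed distrib_right sum.distrib)
        then have "x + y \<in> L" unfolding L_def by (intro CollectI exI[of _ "\<lambda>j. g j + g' j"]) simp
        then show "x + y \<in> max_submod s \<inter> L" using stableD(2)[OF stable_max_submod] xy by blast
      next
        fix a x assume xy: "x \<in> max_submod s \<inter> L"
        then obtain g where "small g" "x = (\<Sum>j<d. g j * vvec j)" by (auto simp: L_def)
        then have "small (\<lambda>j. scP a (g j)) \<and> scP a x = (\<Sum>j<d. scP a (g j) * vvec j)"
          using lin_sum[OF lin_scP[of a]] by (simp add: small_def Ylt_closed scP_cst)
        then have "scP a x \<in> L" unfolding L_def by (intro CollectI exI[of _ "\<lambda>j. scP a (g j)"]) simp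
        then show "scP a x \<in> max_submod s \<inter> L" using stableD(3)[OF stable_max_submod] xy by blast
      next
        fix x assume xy: "x \<in> max_submod s \<inter> L"
        then obtain g where g: "small g" "x = (\<Sum>j<d. g j * vvec j)" by (auto simp: L_def)
        define g' where "g' j = scP (s * inverse q ^ j) (Kop q 1 (g j))" for j
        have "K (g j * vvec j) = g' j * vvec j" for j
          using Kop_mult[of q 1 s "g j" "vvec j"] by (simp add: K_vvec g'_def scP_cst)
        then have "K x = (\<Sum>j<d. g' j * vvec j)" unfolding g(2) lin_sum[OF lin_Kop] by simp
        moreover have "small g'"
          using g(1) by (auto simp: small_def g'_def coeff_Kop intro!: Ylt_closed Kop_Ylt)
        ultimately have "K x \<in> L" unfolding L_def by blast
        then show "K x \<in> max_submod s \<inter> L" using stableN(3)[OF stable_max_submod] xy by blast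
        define g'' where "g'' j = Eop q (s * inverse q ^ j) (\<lambda>_. 0) (g j)" for j
        have "E x = (\<Sum>j<d. g'' j * vvec j)"
          unfolding g(2) lin_sum[OF lin_Eop] g''_def
          using g(1) d_le by (intro sum.cong refl E_const_vvec) (auto simp: small_def)
        moreover have "small g''"
          using g(1) by (auto simp: small_def g''_def coeff_Eop_0 intro!: Eop_Ylt)
        ultimately have "E x \<in> L" unfolding L_def by blast
        then show "E x \<in> max_submod s \<inter> L" using stableN(5)[OF stable_max_submod] xy by blast
      qed
      then obtain j where j: "j < d" "uvec j \<in> L" using vvec_notin_max_submod by blast
      then obtain g where g: "small g" "uvec j = (\<Sum>i<d. g i * vvec i)" by (auto simp: L_def)
      define f where "f i = g i - (if i = j then fF ^ (M - j) else 0)" for i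
      have "(\<Sum>i<d. f i * vvec i) = (\<Sum>i<d. g i * vvec i) - (\<Sum>i<d. if i = j then uvec i else 0)"
        unfolding sum_subtractf[symmetric]
        by (intro sum.cong) (auto simp: f_def left_diff_distrib uvec_def)
      also have "\<dots> = 0" using g(2) j(1) by simp
      finally have "f j = 0"
        using g(1) j(1)
        by (intro monic_expansion_unique[of vvec d f, OF monic_vvec])
          (auto simp: f_def small_def intro!: Ylt_closed(2) fF_power_Ylt)
      then have "g j = fF ^ (M - j)" by (simp add: f_def)
      then have "coeff (coeff (g j) 0) (M - j) = 1" by (simp add: coeff_fF_power)
      then show False using g(1) by (simp add: small_def)
    qed
    then show "x \<in> gap_submod" using g(2) by simp
  qed
qed

lemma simple_quotient_spanned:
  "\<exists>a. x - (\<Sum>(j, i)\<in>{..<d} \<times> {..<M}. scP (a (j, i)) (fF ^ i * vvec j)) \<in> max_submod s"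
proof -
  obtain g where g: "small g" "x - (\<Sum>j<d. g j * vvec j) \<in> gap_submod" using reduce_gap_submod by blast
  have "g j = (\<Sum>i<M. scP (coeff (coeff (g j) 0) i) (fF ^ i))" for j
  proof (rule Ylt_1_eqI)
    fix i
    have "coeff (coeff (\<Sum>i<M. scP (coeff (coeff (g j) 0) i) (fF ^ i)) 0) i =
      (\<Sum>i'<M. if i' = i then coeff (coeff (g j) 0) i else 0)"
      unfolding coeff_sum by (intro sum.cong refl) (simp add: coeff_fF_power)
    also have "\<dots> = coeff (coeff (g j) 0) i" using g(1) by (auto simp: small_def)
    finally show "coeff (coeff (g j) 0) i = coeff (coeff (\<Sum>i<M. scP (coeff (coeff (g j) 0) i) (fF ^ i)) 0) i" ..
  qed (use g(1) in \<open>auto simp: small_def intro!: Ylt_sum Ylt_closed(3) fF_power_Ylt\<close>)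
  note exp = this
  have "g j * vvec j = (\<Sum>i<M. scP (coeff (coeff (g j) 0) i) (fF ^ i * vvec j))" for j
  proof -
    have "g j * vvec j = (\<Sum>i<M. scP (coeff (coeff (g j) 0) i) (fF ^ i)) * vvec j"
      by (subst exp) (rule refl)
    then show ?thesis by (simp only: sum_distrib_right scP_cst)
  qed
  then have "(\<Sum>j<d. g j * vvec j) = (\<Sum>(j, i)\<in>{..<d} \<times> {..<M}. scP (coeff (coeff (g j) 0) i) (fF ^ i * vvec j))"
    by (simp add: sum.cartesian_product)
  then show ?thesis
    using g(2) unfolding max_submod_eq_gap_submod
    by (intro exI[of _ "\<lambda>(j, i). coeff (coeff (g j) 0) i"]) simp
qed

definition u :: "'k poly poly" where "u = uvec (d - 1)"

definition u_weight :: 'k where "u_weight = s * inverse q ^ (2 * M - (d - 1))"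

lemma u_weight_neq_0: "u_weight \<noteq> 0"
  using s by (simp add: u_weight_def)

lemma u_props: "E u \<in> next_verma" "X u \<in> next_verma" "K u = scP u_weight u"
proof -
  have d: "d - 1 < M" "Suc (d - 1) = d" using d_pos d_le by auto
  show "K u = scP u_weight u" using d by (simp add: u_def u_weight_def K_uvec)
  have "E u = 0"
    using d E_coeff_eq_0_iff[of "M - (d - 1)" "d - 1"] by (simp add: u_def uvec_def E_fF_vvec scP_cst)
  then show "E u \<in> next_verma" using stableD(1)[OF stable_next_verma] by simp
  obtain \<gamma> where "X u = scP \<gamma> (uvec d)" using X_uvec[OF d(1)] d(2) by (auto simp: u_def)
  then show "X u \<in> next_verma" using stableD(3)[OF stable_next_verma uvec_d_next_verma] by simp
qed

lemma u_hom: "osc_op q c u_weight g x * u - T g (x * u) \<in> next_verma"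
  by (rule osc_hom_mod[OF s u_weight_neq_0 stable_next_verma u_props])

lemma u_max_submod: "u \<in> max_submod s" and next_verma_max_submod: "next_verma \<subseteq> max_submod s"
  using uvec_gap_submod[of "d - 1"] next_verma_gap_submod unfolding max_submod_eq_gap_submod u_def by auto

lemma u_notin_next_verma: "u \<notin> next_verma"
proof
  assume "u \<in> next_verma"
  moreover have "u \<in> Ylt d" using uvec_const_Ylt[of "d - 1" 1] d_pos by (simp add: u_def)
  ultimately show False using next_verma_Ylt[of u] uvec_neq_0 by (simp add: u_def)
qed

text \<open>The submodules of \<open>Z(u_weight)\<close> are carried to submodules of \<open>Z(s)\<close> by multiplication by \<open>u\<close>, which is a homomorphism only
  modulo \<open>next_verma\<close>.\<close>
lemma stable_preimage:
  assumes "stable scP (osc_op q c u_weight) A"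
  shows "stable scP T {x. \<exists>y\<in>A. x - y * u \<in> next_verma}"
proof (rule stableI)
  show "0 \<in> {x. \<exists>y\<in>A. x - y * u \<in> next_verma}"
    using stableD(1)[OF stable_next_verma] stableD(1)[OF assms] by (auto intro!: bexI[of _ 0])
next
  fix x x' assume "x \<in> {x. \<exists>y\<in>A. x - y * u \<in> next_verma}" "x' \<in> {x. \<exists>y\<in>A. x - y * u \<in> next_verma}"
  then obtain y y' where y: "y \<in> A" "y' \<in> A" "x - y * u \<in> next_verma" "x' - y' * u \<in> next_verma" by blast
  then have "(x + x') - (y + y') * u \<in> next_verma"
    using stableD(2)[OF stable_next_verma y(3,4)] by (simp add: algebra_simps)
  then show "x + x' \<in> {x. \<exists>y\<in>A. x - y * u \<in> next_verma}" using stableD(2)[OF assms y(1,2)] by blast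
next
  fix a x assume "x \<in> {x. \<exists>y\<in>A. x - y * u \<in> next_verma}"
  then obtain y where y: "y \<in> A" "x - y * u \<in> next_verma" by blast
  then have "scP a x - scP a y * u \<in> next_verma" using stableD(3)[OF stable_next_verma y(2), of a] by (simp add: scP_cst)
  then show "scP a x \<in> {x. \<exists>y\<in>A. x - y * u \<in> next_verma}" using stableD(3)[OF assms y(1)] by blast
next
  fix g x assume "x \<in> {x. \<exists>y\<in>A. x - y * u \<in> next_verma}"
  then obtain y where y: "y \<in> A" "x - y * u \<in> next_verma" by blast
  interpret T: operators scP T by (rule operators_osc_op)
  have "T g (x - y * u) - (osc_op q c u_weight g y * u - T g (y * u)) \<in> next_verma"
    by (intro T.stable_minus[OF stable_next_verma] stableD(4)[OF stable_next_verma] y u_hom)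
  then have "T g x - osc_op q c u_weight g y * u \<in> next_verma" by (simp add: T.T_diff)
  then show "T g x \<in> {x. \<exists>y\<in>A. x - y * u \<in> next_verma}" using stableD(4)[OF assms y(1)] by blast
qed

text \<open>As \<open>b\<^sub>j \<noteq> 0\<close> for \<open>0 < j < d\<close>, the formula for \<open>Yu\<^sub>j\<close> gives \<open>u\<^sub>j\<^sub>-\<^sub>1\<close> from \<open>u\<^sub>j\<close> and \<open>u\<^sub>j\<^sub>+\<^sub>1\<close>. The descent starts at
  \<open>u\<^sub>d\<^sub>-\<^sub>1 = u\<close> and \<open>u\<^sub>d \<in> next_verma\<close>.\<close>
lemma u_generates: 
  assumes x: "x \<in> max_submod s" shows "\<exists>y. x - y * u \<in> next_verma"
proof -
  let ?G = "{x. \<exists>y\<in>UNIV. x - y * u \<in> next_verma}"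
  have G: "stable scP T ?G" by (rule stable_preimage[OF stable_UNIV])
  have ZG: "z \<in> ?G" if "z \<in> next_verma" for z using that by (auto intro!: exI[of _ 0])
  have "uvec (d - 1 - k) \<in> ?G \<and> uvec (d - k) \<in> ?G" if "k \<le> d - 1" for k
    using that
  proof (induction k)
    case 0
    have "uvec (d - 1) - 1 * u \<in> next_verma" using stableD(1)[OF stable_next_verma] by (simp add: u_def)
    then have "uvec (d - 1) \<in> ?G" by blast
    then show ?case using ZG[OF uvec_d_next_verma] by simp
  next
    case (Suc k)
    define j where "j = d - 1 - k"
    have j: "0 < j" "j < d" "j < M" "d - k = Suc j" "d - 1 - Suc k = j - 1" "d - Suc k = j"
      using Suc.prems d_le by (auto simp: j_def)
    have IH: "uvec j \<in> ?G" "uvec (Suc j) \<in> ?G" 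
    proof -
      have "uvec (d - 1 - k) \<in> ?G \<and> uvec (d - k) \<in> ?G" using Suc.prems by (intro Suc.IH) simp
      then show "uvec j \<in> ?G" "uvec (Suc j) \<in> ?G" by (simp_all only: j(4) j_def)
    qed
    interpret T: operators scP T by (rule operators_osc_op)
    have "scP (Y_coeff j) (uvec (j - 1)) = yY * uvec j - fF * uvec (Suc j)"
      using yY_uvec[OF j(3)] j(1) by simp
    also have "\<dots> \<in> ?G" by (intro T.stable_minus[OF G] stableN[OF G] IH)
    finally have "uvec (j - 1) \<in> ?G"
      using stable_scP_cancel[OF G, of "Y_coeff j" "uvec (j - 1)"] Y_coeff_eq_0_iff[OF j(3)] S_nz[OF j(1,2)] by blast
    then show ?case using IH by (simp only: j(5,6))
  qed
  note * = this
  have u: "uvec j \<in> ?G" if "j < d" for j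
  proof -
    have "d - 1 - (d - 1 - j) = j" "d - 1 - j \<le> d - 1" using that by simp_all
    then show ?thesis using *[of "d - 1 - j"]
      by (simp only:)
  qed
  obtain f y where f: "x = (\<Sum>j<d. f j * uvec j) + y * vvec d" using x unfolding max_submod_eq_gap_submod gap_submod_def by blast
  have "x \<in> ?G"
    unfolding f by (intro stableD(2)[OF G] stable_sum[OF G] stable_mult[OF G] u ZG vvec_d_next_verma) auto
  then show ?thesis by blast
qed

text \<open>The kernel is a proper submodule. If it were not maximal, the image of the maximal submodule would be nonzero in the
  quotient, hence contain some \<open>u\<^sub>j\<close> and then \<open>u\<close> itself, and \<open>1\<close> would lie in the maximal submodule of
  \<open>Z(u_weight)\<close>.\<close>
lemma u_kernel: "y * u \<in> next_verma \<longleftrightarrow> y \<in> max_submod u_weight"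
proof -
  let ?Kr = "{y. y * u \<in> next_verma}"
  interpret T: operators scP T by (rule operators_osc_op)
  have "stable scP (osc_op q c u_weight) ?Kr"
  proof (rule stableI)
    fix g y assume y: "y \<in> ?Kr"
    have "(osc_op q c u_weight g y * u - T g (y * u)) + T g (y * u) \<in> next_verma"
      by (intro stableD[OF stable_next_verma] u_hom) (use y in auto)
    then show "osc_op q c u_weight g y \<in> ?Kr" by simp
  qed (use stableD[OF stable_next_verma] in \<open>auto simp: distrib_right scP_cst\<close>)
  moreover have "1 \<notin> ?Kr" using u_notin_next_verma by simp
  ultimately have Kr: "?Kr \<subseteq> max_submod u_weight" by (rule max_submod_maximal[OF u_weight_neq_0])
  have "y * u \<in> next_verma" if y: "y \<in> max_submod u_weight" for y
  proof (rule ccontr)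
    assume ny: "y * u \<notin> next_verma"
    let ?N = "{x. \<exists>y\<in>max_submod u_weight. x - y * u \<in> next_verma}"
    have N: "stable scP T ?N" by (rule stable_preimage[OF stable_max_submod])
    have NW: "?N \<subseteq> max_submod s"
    proof
      fix x assume "x \<in> ?N"
      then obtain y' where "x - y' * u \<in> next_verma" by blast
      then have "(x - y' * u) + y' * u \<in> max_submod s"
        using next_verma_max_submod by (intro stableD(2)[OF stable_max_submod] stable_mult[OF stable_max_submod u_max_submod]) auto
      then show "x \<in> max_submod s" by simp
    qed
    obtain z r where zr: "r \<in> Ylt d" "y * u = z * vvec d + r" using monicY_division[OF monic_vvec] by blast
    have "r - y * u \<in> next_verma"
      using T.stable_uminus[OF stable_next_verma vvec_d_next_verma, of z] zr(2) by (simp add: algebra_simps)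
    then have "r \<in> ?N" using y by blast
    moreover have "r \<noteq> 0" using ny zr(2) vvec_d_next_verma by auto
    ultimately obtain j where j: "j < d" "vvec j \<in> ?N \<or> (j < M \<and> uvec j \<in> ?N)"
      using highest_weight_vector_in_stable[OF N _ zr(1)] d_le by auto
    then have "uvec j \<in> ?N" using NW vvec_notin_max_submod[OF j(1)] by blast
    then have "u \<in> ?N" using uvec_up[OF N, of j "d - 1"] j(1) d_le by (simp add: u_def)
    then obtain y' where y': "y' \<in> max_submod u_weight" "u - y' * u \<in> next_verma" by blast
    then have "1 - y' \<in> ?Kr" by (simp add: left_diff_distrib)
    then have "(1 - y') + y' \<in> max_submod u_weight" using Kr y'(1) by (intro stableD(2)[OF stable_max_submod]) auto
    then show False using one_notin_max_submod by simp
  qed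
  then show ?thesis using Kr by blast
qed

end

section \<open>Back to the modules\<close>

text \<open>The relations of the quantum group are among those of the oscillator algebra, so all classes in the union coincide.\<close>
lemma uq_to_osc_cls: 
  "uq_to_osc q C0 (cls (uq_rels q) p) = cls (osc_rels q C0) (free_map Uq p)"
proof -
  have rel: "free_map Uq p \<in> rel_ideal (osc_rels q C0)" if "p \<in> rel_ideal (uq_rels q)" for p
  proof -
    have "rel_ideal (uq_rels q) \<subseteq> {p. free_map Uq p \<in> rel_ideal (osc_rels q C0)}"
    proof (rule rel_ideal_minimal)
      show "uq_rels q \<subseteq> {p. free_map Uq p \<in> rel_ideal (osc_rels q C0)}"
        unfolding osc_rels_def Let_def uq_rels_at_map by (auto intro: rel_ideal_props(5))
    qed (auto simp: free_map_simps free_map_mult intro: rel_ideal_props)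
    then show ?thesis using that by auto
  qed
  have "cls (osc_rels q C0) (free_map Uq p') = cls (osc_rels q C0) (free_map Uq p)"
    if "p' \<in> cls (uq_rels q) p" for p'
    using rel[of "p' - p"] that by (simp add: mem_cls_iff cls_eq_iff free_map_simps)
  then show ?thesis unfolding uq_to_osc_def using cls_self[of p "uq_rels q"] by blast
qed

lemma models_restrict_uq:
  assumes M: "models sc T (osc_rels q C0) B D \<pi> M"
  shows "models sc (\<lambda>g. T (Uq g)) (uq_rels q) B D \<pi> (restrict_scalars (uq_to_osc q C0) M)"
proof -
  interpret operators sc T by (rule modelsD(1)[OF M])
  have "operators sc (\<lambda>g. T (Uq g))" by unfold_locales (simp_all add: T_add T_scale)
  moreover have "stable sc (\<lambda>g. T (Uq g)) A" if "stable sc T A" for A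
    using that by (simp add: stable_def)
  ultimately show ?thesis
    using modelsD(2,3,4)[OF M]
    unfolding models_def
    by (simp add: restrict_scalars_def uq_to_osc_cls modelsD(5,6)[OF M] modelsD(7)[OF M] modelsD(8)[OF M]
        modelsD(9)[OF M] ev_free_map[OF modelsD(1)[OF M]])
qed

context osc_param
begin

lemma cyclic: 
  assumes s: "s \<noteq> 0" shows "\<exists>p. ev scP (osc_op q c s) p 1 = x"
proof -
  interpret operators scP "osc_op q c s" by (rule operators_osc_op)
  have Y: "\<exists>p. eval p 1 = yY ^ j" for j
  proof (induction j)
    case 0
    show ?case using ev_one[of 1] by auto
  next
    case (Suc j)
    then obtain p where "eval p 1 = yY ^ j" by blast
    then have "eval (gen gY * p) 1 = yY ^ Suc j" by (simp add: ev_gen_mult)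
    then show ?case by blast
  qed
  obtain d where "x \<in> Ylt d" using Ylt_exists by blast
  then show ?thesis
  proof (induction x rule: yY_fF_induct)
    case zero
    show ?case using ev_zero[of 1] by blast
  next
    case (add x y)
    then obtain p p' where "eval p 1 = x" "eval p' 1 = y" by blast
    then have "eval (p + p') 1 = x + y" by (simp add: ev_plus)
    then show ?case by blast
  next
    case (scale a x)
    then obtain p where "eval p 1 = x" by blast
    then have "eval (scal a * p) 1 = scP a x" by (simp add: ev_scal_mult)
    then show ?case by blast
  next
    case (fF x)
    then obtain p where "eval p 1 = x" by blast
    then have "eval (gen (Uq gF) * p) 1 = fF * x" by (simp add: ev_gen_mult)
    then show ?case by blast
  qed (rule Y)
qed

abbreviation "A \<equiv> osc q C0"
abbreviation "Z \<equiv> osc_verma q C0"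

lemma A_presented: "A = presented rels"
  by (simp add: osc_def)

text \<open>The parametrisations \<open>\<pi>\<close> of \<open>Z(s)\<close> by polynomials.\<close>
definition vmodel :: "'k \<Rightarrow> ('k poly poly \<Rightarrow> (osc_gen, 'k) free_alg set set) \<Rightarrow> bool" where
  "vmodel s \<pi> \<longleftrightarrow> models scP (osc_op q c s) rels UNIV {0} \<pi> (Z s)"

lemma vmodel_exists: "s \<noteq> 0 \<Longrightarrow> \<exists>\<pi>. vmodel s \<pi>"
  using models_osc_verma unfolding vmodel_def by blast

lemma vmodelD: 
  assumes "vmodel s \<pi>"
  shows "models scP (osc_op q c s) rels UNIV {0} \<pi> (Z s)" "\<pi> x = \<pi> y \<longleftrightarrow> x = y" "carrier (Z s) = range \<pi>"
    "inj \<pi>"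
proof -
  show M: "models scP (osc_op q c s) rels UNIV {0} \<pi> (Z s)" using assms by (simp add: vmodel_def)
  show eq: "\<pi> x = \<pi> y \<longleftrightarrow> x = y" for x y using modelsD(9)[OF M, of x y] by simp
  show "carrier (Z s) = range \<pi>" by (rule modelsD(5)[OF M])
  show "inj \<pi>" by (rule injI) (simp add: eq)
qed

lemma submodule_vmodel:
  assumes s: "s \<noteq> 0" and M: "vmodel s \<pi>" and N: "submodule N A (Z s)" "N \<noteq> carrier (Z s)"
  obtains B where "N = \<pi> ` B" "stable scP (osc_op q c s) B" "B \<subseteq> max_submod s"
proof -
  note M' = vmodelD(1)[OF M]
  let ?B = "{x \<in> UNIV. \<pi> x \<in> N}"
  note B = models_submoduleD[OF M' N(1)[unfolded A_presented]]
  have "1 \<notin> ?B"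
  proof
    assume "1 \<in> ?B"
    then have "x \<in> ?B" for x using stable_mult[OF B(1), of 1 x] by simp
    then show False using B(4) N(2) vmodelD(3)[OF M] by auto
  qed
  then show thesis using that[of ?B] B(1,4) max_submod_maximal[OF s B(1)] by auto
qed

lemma osc_verma_max_eq:
  assumes s: "s \<noteq> 0" and M: "vmodel s \<pi>"
  shows "osc_verma_max q C0 s = \<pi> ` max_submod s"
proof -
  note M' = vmodelD(1)[OF M]
  have sub: "submodule (\<pi> ` max_submod s) A (Z s)"
    unfolding A_presented by (rule models_submoduleI[OF M' stable_max_submod]) simp
  have ne: "\<pi> ` max_submod s \<noteq> carrier (Z s)"
    using one_notin_max_submod[of s] vmodelD(2,3)[OF M] by (metis image_iff rangeI)
  show ?thesis
    unfolding osc_verma_max_def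
  proof (rule the_equality)
    show "maximal_submodule A (Z s) (\<pi> ` max_submod s)"
      unfolding maximal_submodule_def
    proof (intro conjI allI impI sub ne)
      fix N assume N: "submodule N A (Z s) \<and> \<pi> ` max_submod s \<subseteq> N \<and> N \<noteq> carrier (Z s)"
      then obtain B where "N = \<pi> ` B" "B \<subseteq> max_submod s" using submodule_vmodel[OF s M] by metis
      then show "N = \<pi> ` max_submod s" using N by auto
    qed
  next
    fix N assume N: "maximal_submodule A (Z s) N"
    then obtain B where "N = \<pi> ` B" "B \<subseteq> max_submod s"
      using submodule_vmodel[OF s M, of N] unfolding maximal_submodule_def by metis
    then have "N \<subseteq> \<pi> ` max_submod s" by auto
    then show "N = \<pi> ` max_submod s" using N sub ne unfolding maximal_submodule_def by metis
  qed
qed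

lemma models_osc_simple:
  assumes s: "s \<noteq> 0"
  obtains \<pi>' where "models scP (osc_op q c s) rels UNIV (max_submod s) \<pi>' (osc_simple q C0 s)"
proof -
  obtain \<pi> where M: "vmodel s \<pi>" using vmodel_exists[OF s] by blast
  have "models scP (osc_op q c s) rels UNIV (max_submod s) (\<lambda>x. \<pi> ` max_submod s +>\<^bsub>Z s\<^esub> \<pi> x) (quotient_module (Z s) (\<pi> ` max_submod s))"
    by (rule models_quotient[OF vmodelD(1)[OF M] stable_max_submod]) (use stableD(1)[OF stable_max_submod] in auto)
  then show thesis using that unfolding osc_simple_def osc_verma_max_eq[OF s M] by blast
qed

lemma embedding_exists:
  assumes s: "s \<noteq> 0" "s' \<noteq> 0" and w: "singular s s' w" "w \<noteq> 0"
  shows "\<exists>f. lmod_embedding A (Z s') (Z s) f"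
proof -
  obtain \<pi> \<pi>' where M: "vmodel s \<pi>" "vmodel s' \<pi>'" using vmodel_exists s by blast
  note M1 = vmodelD(1)[OF M(1)] and M2 = vmodelD(1)[OF M(2)]
  define f where "f m = \<pi> (inv_into UNIV \<pi>' m * w)" for m
  have f: "f (\<pi>' x) = \<pi> (x * w)" for x using vmodelD(4)[OF M(2)] by (simp add: f_def inv_f_f)
  have "f \<in> lmod_hom A (Z s') (Z s)"
    unfolding lmod_hom_def A_presented carrier_presented vmodelD(3)[OF M(2)] vmodelD(3)[OF M(1)]
    by (auto simp: f modelsD(7)[OF M2] modelsD(7)[OF M1] modelsD(8)[OF M2] modelsD(8)[OF M1]
        distrib_right osc_hom_ev[OF s w(1)])
  moreover have "inj_on f (carrier (Z s'))"
    using w(2) by (auto simp: inj_on_def vmodelD(3)[OF M(2)] f vmodelD(2)[OF M(1)])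
  ultimately show ?thesis unfolding lmod_embedding_def by blast
qed

text \<open>The image \<open>w\<close> of the highest weight vector is singular, because whatever holds for \<open>1\<close> in \<open>Z(s')\<close> holds for \<open>w\<close>.\<close>
lemma embedding_singular:
  assumes s: "s \<noteq> 0" "s' \<noteq> 0" and M: "vmodel s \<pi>" "vmodel s' \<pi>'" and f: "lmod_embedding A (Z s') (Z s) f"
  obtains w where "singular s s' w" "w \<noteq> 0" "\<And>x. f (\<pi>' x) = \<pi> (x * w)"
proof -
  note M1 = vmodelD(1)[OF M(1)] and M2 = vmodelD(1)[OF M(2)]
  interpret A1: operators scP "osc_op q c s" by (rule operators_osc_op)
  interpret A2: operators scP "osc_op q c s'" by (rule operators_osc_op)
  have hom: "f (cls rels p \<odot>\<^bsub>Z s'\<^esub> \<pi>' x) = cls rels p \<odot>\<^bsub>Z s\<^esub> f (\<pi>' x)" "f (\<pi>' x) \<in> carrier (Z s)" for p x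
    using f vmodelD(3)[OF M(2)] unfolding lmod_embedding_def lmod_hom_def A_presented carrier_presented by auto
  obtain w where w: "f (\<pi>' 1) = \<pi> w" using hom(2)[of 1] vmodelD(3)[OF M(1)] by auto
  have ev: "f (\<pi>' (ev scP (osc_op q c s') p 1)) = \<pi> (ev scP (osc_op q c s) p w)" for p
    using hom(1)[of p 1] by (simp add: w modelsD(8)[OF M1] modelsD(8)[OF M2])
  have eq: "ev scP (osc_op q c s) p w = ev scP (osc_op q c s) p' w"
    if "ev scP (osc_op q c s') p 1 = ev scP (osc_op q c s') p' 1" for p p'
    using ev[of p] ev[of p'] that vmodelD(2)[OF M(1)] by simp
  have 1: "Eop q s' (eseq q c s') 1 = 0" "Xop q c s' 1 = 0" "Kop q s' 1 = scP s' 1"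
    using E_bas_0[OF s(2), of 0] X_bas_0[OF s(2), of 0] Kop_bas[of q s' 0 0]
    by (simp_all add: e_0[OF s(2)] x_0[OF s(2)])
  have sing: "singular s s' w"
    using eq[of "gen (Uq gE)" 0] eq[of "gen gX" 0] eq[of "gen (Uq gK)" "scal s'"]
    by (simp add: singular_def A1.ev_simps A2.ev_simps 1)
  have "w \<noteq> 0"
  proof
    assume "w = 0"
    then have "f (\<pi>' 1) = f (\<pi>' 0)" using w ev[of 0] by (simp add: A1.ev_simps A2.ev_simps)
    then have "\<pi>' 1 = \<pi>' 0" using f vmodelD(3)[OF M(2)] by (auto simp: lmod_embedding_def inj_on_def)
    then show False using vmodelD(2)[OF M(2), of 1 0] by simp
  qed
  moreover have "f (\<pi>' x) = \<pi> (x * w)" for x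
  proof -
    obtain p where "ev scP (osc_op q c s') p 1 = x" using cyclic[OF s(2)] by blast
    then show ?thesis using ev[of p] osc_hom_ev[OF s sing, of p 1] by simp
  qed
  ultimately show thesis using sing that by blast
qed

text \<open>The image of \<open>Z(s')\<close> in \<open>Z(s)\<close> and its subquotients are thereby modelled on the polynomials of \<open>Z(s')\<close>, which reduces the
  statements about the filtration of \<open>Z(r)\<close> to one step inside each \<open>Z(t\<^sub>i)\<close>.\<close>
lemma models_generated:
  assumes s: "s \<noteq> 0" "s' \<noteq> 0" and w: "singular s s' w" "w \<noteq> 0" and M: "vmodel s \<pi>"
    and B: "stable scP (osc_op q c s') B"
  shows "models scP (osc_op q c s') rels B {0} (\<lambda>x. \<pi> (x * w)) (submod (Z s) ((\<lambda>x. \<pi> (x * w)) ` B))"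
  using B w(2) modelsD(6)[OF vmodelD(1)[OF M]] operators.stable_singleton_0[OF operators_osc_op] stableD(1)[OF B]
  unfolding models_def submod_def
  by (simp add: operators_osc_op modelsD(7)[OF vmodelD(1)[OF M]] modelsD(8)[OF vmodelD(1)[OF M]]
      vmodelD(2)[OF M] distrib_right osc_hom_ev[OF s w(1)])

lemma submodule_generated:
  assumes s: "s \<noteq> 0" "s' \<noteq> 0" and w: "singular s s' w" and M: "vmodel s \<pi>"
    and B: "stable scP (osc_op q c s') B"
  shows "submodule ((\<lambda>x. \<pi> (x * w)) ` B) A (Z s)"
  using models_submoduleI[OF vmodelD(1)[OF M] stable_image_singular[OF s w B]]
  by (simp add: A_presented image_image)

lemma simple_if_no_maximal:
  assumes s: "s \<noteq> 0" and max_submod: "max_submod s = {0}"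
  shows "simple_module A (Z s)"
proof -
  obtain \<pi> where M: "vmodel s \<pi>" using vmodel_exists[OF s] by blast
  note M' = vmodelD(1)[OF M]
  have "\<pi> 1 \<noteq> \<pi> 0" using vmodelD(2)[OF M] by simp
  then have "carrier (Z s) \<noteq> {\<zero>\<^bsub>Z s\<^esub>}"
    unfolding vmodelD(3)[OF M] modelsD(6)[OF M'] by blast
  moreover have "N = {\<zero>\<^bsub>Z s\<^esub>}" if N: "submodule N A (Z s)" "N \<noteq> carrier (Z s)" for N
  proof -
    obtain B where B: "N = \<pi> ` B" "stable scP (osc_op q c s) B" "B \<subseteq> max_submod s"
      using submodule_vmodel[OF s M N] by blast
    then have "B = {0}" using stableD(1)[OF B(2)] max_submod by auto
    then show ?thesis using B(1) modelsD(6)[OF M'] by simp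
  qed
  ultimately show ?thesis unfolding simple_module_def by blast
qed

end

context osc_int
begin

text \<open>Division by the monic \<open>v\<^sub>d\<close>, followed by expansion of the remainder in the monic \<open>v\<^sub>i\<close> with \<open>i < d\<close>.\<close>
lemma restricted_direct_sum:
  assumes M: "vmodel s \<pi>" and d: "d \<le> M"
  defines "V \<equiv> \<lambda>i. if i < d then (\<lambda>f. f * vvec i) ` Ylt 1 else range (\<lambda>y. y * vvec d)"
  assumes S: "S d = 0"
  shows "internal_direct_sum (uq q) (restrict_scalars (uq_to_osc q C0) (Z s)) {..d} (\<lambda>i. \<pi> ` V i)"
    "i < d \<Longrightarrow> lmod_iso (uq q) (submod (restrict_scalars (uq_to_osc q C0) (Z s)) (\<pi> ` V i))
       (uq_verma q (s * inverse q ^ i))"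
proof -
  let ?T = "\<lambda>g. T (Uq g)"
  have MU: "models scP ?T (uq_rels q) UNIV {0} \<pi> (restrict_scalars (uq_to_osc q C0) (Z s))"
    by (rule models_restrict_uq[OF vmodelD(1)[OF M]])
  have hom: "?T g (f * vvec i) = uq_op q (s * inverse q ^ i) (\<lambda>_. 0) g f * vvec i" if "i < d" "f \<in> Ylt 1" for g f i
    using uq_hom[OF s sp_neq_0 _ K_vvec that(2), of i g] vvec_EX[of i] that d by simp
  have st: "stable scP ?T (V i)" if "i \<le> d" for i
  proof (cases "i < d")
    case True
    have uq_op: "uq_op q (s * inverse q ^ i) (\<lambda>_. 0) g f \<in> Ylt 1" if "f \<in> Ylt 1" for f g
      by (rule stableD(4)[OF stable_Ylt that]) simp
    show ?thesis
    proof (rule stableI)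
      fix x y assume "x \<in> V i" "y \<in> V i"
      then show "x + y \<in> V i" using True by (auto simp: V_def distrib_right[symmetric] intro!: imageI Ylt_closed)
    next
      fix g x assume "x \<in> V i"
      then show "?T g x \<in> V i" using True hom[OF True] uq_op by (auto simp: V_def simp del: osc_op.simps)
    next
      have "0 * vvec i \<in> V i" unfolding V_def using True by auto
      then show "0 \<in> V i" by simp
      fix a x assume "x \<in> V i"
      then obtain f where "f \<in> Ylt 1" "x = f * vvec i" using True by (auto simp: V_def)
      then have "scP a f \<in> Ylt 1" "scP a x = scP a f * vvec i" by (auto simp: scP_cst intro: Ylt_closed)
      then show "scP a x \<in> V i" using True by (auto simp: V_def)
    qed
  next
    case False
    then show ?thesis
      using stable_image_singular[OF s sp_neq_0 singular_vvec[OF d S] stable_UNIV]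
      by (simp add: V_def stable_def del: osc_op.simps)
  qed
  have "internal_direct_sum (presented (uq_rels q)) (restrict_scalars (uq_to_osc q C0) (Z s)) {..d} (\<lambda>i. \<pi> ` V i)"
  proof (rule models_direct_sum[OF MU])
    fix x :: "'k poly poly"
    obtain y r where yr: "r \<in> Ylt d" "x = y * vvec d + r" using monicY_division[OF monic_vvec] by blast
    obtain f where f: "\<forall>j. f j \<in> Ylt 1" "r = (\<Sum>j<d. f j * vvec j)"
      using monic_expansion[of vvec, OF monic_vvec yr(1)] by blast
    define g where "g j = (if j < d then f j * vvec j else y * vvec d)" for j
    have "x = sum g {..d}"
      using yr(2) f(2) by (simp add: g_def lessThan_Suc_atMost[symmetric])
    moreover have "\<forall>i\<in>{..d}. g i \<in> V i" using f(1) by (auto simp: g_def V_def)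
    ultimately show "\<exists>f. (\<forall>i\<in>{..d}. f i \<in> V i) \<and> x = sum f {..d}" by blast
  next
    fix f assume f: "\<And>i. i \<in> {..d} \<Longrightarrow> f i \<in> V i" and z: "sum f {..d} = 0"
    have "\<exists>h. i < d \<longrightarrow> h \<in> Ylt 1 \<and> f i = h * vvec i" for i
      using f[of i] by (cases "i < d") (auto simp: V_def)
    then obtain h where h: "\<And>i. i < d \<Longrightarrow> h i \<in> Ylt 1 \<and> f i = h i * vvec i" by metis
    obtain y where y: "f d = y * vvec d" using f[of d] by (auto simp: V_def)
    have sum: "(\<Sum>i<d. h i * vvec i) + y * vvec d = 0"
      using z h y by (simp add: lessThan_Suc_atMost[symmetric])
    have "(\<Sum>i<d. h i * vvec i) \<in> Ylt d"
      using h by (intro Ylt_sum Ylt_const_mult Ylt_mono[OF monicY_coeff(3)[OF monic_vvec]]) auto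
    then have "0 - (\<Sum>i<d. h i * vvec i) \<in> Ylt d" by (intro Ylt_closed) auto
    moreover have "0 = y * vvec d + (\<Sum>i<d. h i * vvec i)" using sum by (simp add: add.commute)
    then have "0 - (\<Sum>i<d. h i * vvec i) = y * vvec d" by (simp only: diff_eq_eq)
    ultimately have "y * vvec d \<in> Ylt d" by (simp only:)
    then have y0: "y = 0" by (rule monicY_mult_Ylt[OF monic_vvec])
    then have "h i = 0" if "i < d" for i
      using sum h that by (intro monic_expansion_unique[of vvec d h, OF monic_vvec]) auto
    then show "\<forall>i\<in>{..d}. f i = 0" using h y y0 by (metis atMost_iff le_neq_implies_less mult_zero_left)
  qed (use st in auto)
  then show "internal_direct_sum (uq q) (restrict_scalars (uq_to_osc q C0) (Z s)) {..d} (\<lambda>i. \<pi> ` V i)"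
    by (simp add: uq_def)
  show "lmod_iso (uq q) (submod (restrict_scalars (uq_to_osc q C0) (Z s)) (\<pi> ` V i))
       (uq_verma q (s * inverse q ^ i))" if i: "i < d"
  proof -
    have MV: "models scP ?T (uq_rels q) (V i) {0} \<pi> (submod (restrict_scalars (uq_to_osc q C0) (Z s)) (\<pi> ` V i))"
      using i st[of i] stableD(1)[OF st[of i]] by (intro models_submod[OF MU]) auto
    obtain \<pi>' where M': "models scP (uq_op q (s * inverse q ^ i) (\<lambda>_. 0)) (uq_rels q) (Ylt 1) {0} \<pi>' (uq_verma q (s * inverse q ^ i))"
      using models_uq_verma[OF q_neq_0 sp_neq_0] by blast
    have "lmod_iso (presented (uq_rels q)) (submod (restrict_scalars (uq_to_osc q C0) (Z s)) (\<pi> ` V i)) (uq_verma q (s * inverse q ^ i))"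
      by (rule conjunct2[OF models_iso[OF M' MV, of "\<lambda>f. f * vvec i"]])
        (use i hom[OF i] vvec_neq_0[of i] in \<open>auto simp: V_def distrib_right scP_cst simp del: osc_op.simps\<close>)
    then show ?thesis by (simp add: uq_def)
  qed
qed

lemma maximal_is_Verma:
  assumes nz: "\<And>j. 0 < j \<Longrightarrow> j \<le> M \<Longrightarrow> S j \<noteq> 0" and ns: "\<not> simple_module A (Z s)"
  obtains D where "D > M" "lmod_iso A (submod (Z s) (osc_verma_max q C0 s)) (Z (s * inverse q ^ D))"
proof -
  have "max_submod s \<noteq> {0}" using simple_if_no_maximal[OF s] ns by blast
  then obtain D w where D: "D > M" "w \<noteq> 0" "singular s (s * inverse q ^ D) w" "max_submod s = range (\<lambda>y. y * w)"
    using submodule_is_Verma[OF nz stable_max_submod one_notin_max_submod] by metis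
  obtain \<pi> where M: "vmodel s \<pi>" using vmodel_exists[OF s] by blast
  obtain \<pi>' where M': "vmodel (s * inverse q ^ D) \<pi>'" using vmodel_exists[OF sp_neq_0] by blast
  have max: "osc_verma_max q C0 s = (\<lambda>x. \<pi> (x * w)) ` UNIV"
    unfolding osc_verma_max_eq[OF s M] D(4) by (simp add: image_image)
  have "lmod_iso (presented rels) (submod (Z s) (osc_verma_max q C0 s)) (Z (s * inverse q ^ D))"
    unfolding max
    by (rule conjunct1[OF models_iso[OF models_generated[OF s sp_neq_0 D(3,2) M stable_UNIV] vmodelD(1)[OF M'], of "\<lambda>x. x"]])
      auto
  then show thesis using that[OF D(1)] unfolding A_presented by blast
qed

end

context osc_gap
begin

lemma simple_finite_dimensional:
  "finite_dimensional (restrict_scalars (\<lambda>a. cls rels (scal a)) (osc_simple q C0 s))"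
proof -
  obtain \<pi> where M: "models scP T rels UNIV (max_submod s) \<pi> (osc_simple q C0 s)" using models_osc_simple[OF s] .
  show ?thesis
  proof (rule models_finite_dimensional[OF M, where I="{..<d} \<times> {..<M}" and h="\<lambda>(j, i). fF ^ i * vvec j"])
    fix x :: "'k poly poly"
    show "\<exists>a. x - (\<Sum>k\<in>{..<d} \<times> {..<M}. scP (a k) (case k of (j, i) \<Rightarrow> fF ^ i * vvec j)) \<in> max_submod s"
      using simple_quotient_spanned[of x] by (simp add: case_prod_unfold)
  qed auto
qed

text \<open>\<open>N\<close> is to be the maximal submodule of a copy of \<open>Z(s)\<close>, modulo the next Verma module.\<close>
lemma gap_quotient_iso:
  assumes M: "models scP T rels (max_submod s) next_verma \<pi> N"
  shows "lmod_iso A N (osc_simple q C0 u_weight)"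
proof -
  obtain \<pi>' where M': "models scP (osc_op q c u_weight) rels UNIV (max_submod u_weight) \<pi>' (osc_simple q C0 u_weight)"
    using models_osc_simple[OF u_weight_neq_0] .
  have "lmod_iso (presented rels) N (osc_simple q C0 u_weight)"
    by (rule conjunct2[OF models_iso[OF M' M, of "\<lambda>x. x * u"]])
      (use u_generates u_kernel u_hom stable_mult[OF stable_max_submod u_max_submod] in \<open>auto simp: distrib_right scP_cst simp del: osc_op.simps\<close>)
  then show ?thesis unfolding A_presented .
qed

lemma u_weight_eq: "u_weight = inverse (q ^ 3 * (s * inverse q ^ d))"
proof -
  obtain d' where d': "d = Suc d'" using d_pos by (cases d) auto
  obtain m where m: "M = d + m" using d_le le_Suc_ex by blast
  have e: "2 * M - (d - 1) = M + Suc m" using d' m by simp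
  have "u_weight = \<epsilon> * inverse q * inverse q ^ Suc m"
    unfolding u_weight_def e by (simp add: s_eq power_add power_inverse)
  also have "\<dots> = (inverse q * inverse q) * \<epsilon> * inverse q ^ m" by (simp only: power_Suc mult_ac)
  also have "inverse q * inverse q = inverse q ^ 3 * q" by (simp add: power3_eq_cube)
  also have "inverse q ^ m = inverse q ^ M * q ^ d" by (simp add: m power_add power_inverse)
  also have "inverse q ^ 3 * q * \<epsilon> * (inverse q ^ M * q ^ d) = inverse q ^ 3 * (\<epsilon> * q * inverse q ^ M) * q ^ d"
    by (simp only: mult_ac)
  also have "\<dots> = inverse (q ^ 3 * (s * inverse q ^ d))"
    by (simp add: s_inv power_inverse mult_ac)
  finally show ?thesis .
qed

end
lemma (in osc_param) singular_trans:
  assumes s: "s \<noteq> 0" "s' \<noteq> 0" and w: "singular s s' w" and v: "singular s' s'' v"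
  shows "singular s s'' (v * w)"
  using osc_hom[OF s w, of "Uq gE" v] osc_hom[OF s w, of gX v] osc_hom[OF s w, of "Uq gK" v] v
  by (simp add: singular_def scP_cst)

theorem theorem7p1:
  fixes q r :: "'k::field" and C0 :: "(uq_gen, 'k) free_alg set"
    and n l :: nat and ns :: "nat \<Rightarrow> nat" and t :: "nat \<Rightarrow> 'k"
  assumes char: "CHAR('k) \<noteq> 2"
    and q: "q \<noteq> 0" "\<And>m. m > 0 \<Longrightarrow> q ^ m \<noteq> 1"
    and C0: "C0 \<in> ring_center (uq q)" "C0 \<noteq> \<zero>\<^bsub>uq q\<^esub>"
    and r: "r = q ^ n \<or> r = - (q ^ n)"
    and ns: "ns 0 = 0" "strict_mono_on {..l} ns"
      "ns ` {..l} = {j. j \<le> n + 1 \<and> alpha q C0 r (j + 1) = 0}"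
    and t: "\<And>i. t i = q powi (- int (ns i)) * r"
  shows
    "(\<forall>i\<le>l. \<exists>f. lmod_embedding (osc q C0) (osc_verma q C0 (t i)) (osc_verma q C0 r) f) \<and>
     (\<forall>\<phi> Z W.
        (\<forall>i\<le>l. lmod_embedding (osc q C0) (osc_verma q C0 (t i)) (osc_verma q C0 r) (\<phi> i)) \<and>
        (\<forall>i. Z i = \<phi> i ` carrier (osc_verma q C0 (t i))) \<and>
        (\<forall>i. W i = \<phi> i ` osc_verma_max q C0 (t i)) \<longrightarrow>
        \<comment> \<open>(1)\<close>
        (\<exists>S. internal_direct_sum (uq q)
               (restrict_scalars (uq_to_osc q C0) (osc_verma q C0 r)) {..ns l} S \<and>
             (\<forall>i<ns l. lmod_iso (uq q)
               (submod (restrict_scalars (uq_to_osc q C0) (osc_verma q C0 r)) (S i))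
               (uq_verma q (q powi (- int i) * r))) \<and>
             S (ns l) = Z l) \<and>
        \<comment> \<open>(2)\<close>
        (\<forall>i\<le>l. submodule (Z i) (osc q C0) (osc_verma q C0 r)) \<and>
        (\<forall>i\<le>l. submodule (W i) (osc q C0) (osc_verma q C0 r)) \<and>
        Z 0 = carrier (osc_verma q C0 r) \<and>
        (\<forall>i\<le>l. W i \<subset> Z i) \<and>
        (\<forall>i<l. Z (Suc i) \<subset> W i) \<and>
        (\<forall>i\<le>l. lmod_iso (osc q C0)
          (quotient_module (submod (osc_verma q C0 r) (Z i)) (W i))
          (osc_simple q C0 (t i))) \<and>
        (\<forall>i<l. lmod_iso (osc q C0)
          (quotient_module (submod (osc_verma q C0 r) (W i)) (Z (Suc i)))
          (osc_simple q C0 (inverse (q ^ 3 * t (Suc i)))))) \<and>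
     \<comment> \<open>(3)\<close>
     (\<not> simple_module (osc q C0) (osc_verma q C0 (t l)) \<longrightarrow>
        (\<exists>(N::nat) s. N > 0 \<and> (s = q powi (- int N) \<or> s = - (q powi (- int N))) \<and>
           lmod_iso (osc q C0)
             (submod (osc_verma q C0 (t l)) (osc_verma_max q C0 (t l)))
             (osc_verma q C0 s))) \<and>
     \<comment> \<open>(4)\<close>
     (\<forall>i<l. finite_dimensional
        (restrict_scalars (\<lambda>c. cls (osc_rels q C0) (scal c)) (osc_simple q C0 (t i))))"
proof -
  obtain c where c: "C0 = cls (uq_rels q) c"
    using C0(1) by (auto simp: ring_center_def uq_def carrier_presented)
  interpret P: osc_param q c
    using q ring_center_presented[of "uq_rels q" c] C0(1) by unfold_locales (auto simp: c uq_def)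
  obtain \<epsilon> where eps: "\<epsilon> = 1 \<or> \<epsilon> = - 1" "r = \<epsilon> * q ^ n" using r by force
  have powi: "q powi (- int j) = inverse q ^ j" for j
    by (simp add: power_int_minus power_inverse)
  have r0: "r \<noteq> 0" using eps q(1) by auto
  have t_eq: "t i = r * inverse q ^ ns i" for i by (simp add: t powi mult.commute)
  have t0: "t i \<noteq> 0" for i using r0 q(1) by (simp add: t_eq)
  have ns_le: "ns i \<le> n + 1" if "i \<le> l" for i
    using ns(3) that by blast
  interpret R: osc_int q c r \<epsilon> "n + 1"
    by unfold_locales (use eps in \<open>auto simp: mult_ac\<close>)
  have alpha: "alpha q C0 r (j + 1) = R.S j" for j
  proof -
    have "qbrace q (q powi (1 - int k) * r) * central_scalar q C0 (q powi (- int k) * r) =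
      qbrace q (q * r * inverse q ^ k) * P.cscalar (r * inverse q ^ k)" for k
    proof -
      have "q powi (1 - int k) * r = q * r * inverse q ^ k"
        using power_int_diff[of q 1 "int k"] q(1) by (simp add: divide_inverse power_inverse mult_ac)
      moreover have "q powi (- int k) * r = r * inverse q ^ k" by (simp add: powi mult.commute)
      ultimately show ?thesis using P.central_scalar[OF R.sp_neq_0[of k]] by (simp only: c)
    qed
    then show ?thesis by (simp add: alpha_def R.S_def)
  qed
  have zeros: "R.S j = 0 \<longleftrightarrow> j \<in> ns ` {..l}" if "j \<le> n + 1" for j
    using ns(3) that alpha[of j] by auto
  have Sns: "R.S (ns i) = 0" if "i \<le> l" for i using zeros[OF ns_le[OF that]] that by auto
  have int: "osc_int q c (t i) \<epsilon> (n + 1 - ns i)" if "i \<le> l" for i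
  proof unfold_locales
    have "q * t i = \<epsilon> * (q ^ (n + 1) * inverse q ^ ns i)" by (simp add: t_eq eps(2) mult_ac)
    then show "q * t i = \<epsilon> * q ^ (n + 1 - ns i)" by (simp only: R.q_power_diff[OF ns_le[OF that]])
  qed (rule eps(1))
  have shift: "osc_int.S q c (t i) j = R.S (ns i + j)" if i: "i \<le> l" for i j
  proof -
    interpret I: osc_int q c "t i" \<epsilon> "n + 1 - ns i" by (rule int[OF i])
    show ?thesis
    proof (induction j)
      case 0
      show ?case using Sns[OF i] by (simp add: I.S_def)
    next
      case (Suc j)
      have e: "q * t i * inverse q ^ j = q * r * inverse q ^ (ns i + j)" "t i * inverse q ^ j = r * inverse q ^ (ns i + j)"
        by (simp_all add: t_eq power_add mult_ac)
      have "I.S (Suc j) = I.S j + qbrace q (q * t i * inverse q ^ j) * P.cscalar (t i * inverse q ^ j)"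
        by (simp only: I.S_def sum.lessThan_Suc)
      also have "\<dots> = R.S (Suc (ns i + j))"
        unfolding e Suc by (simp only: R.S_def sum.lessThan_Suc)
      finally show ?case by simp
    qed
  qed
  have between: "R.S j \<noteq> 0" if "i < l" "ns i < j" "j < ns (Suc i)" for i j
  proof
    assume "R.S j = 0"
    moreover have "j \<le> n + 1" using ns_le[of "Suc i"] that by simp
    ultimately obtain k where k: "k \<le> l" "j = ns k" using zeros by auto
    then have "i < k" "k < Suc i"
      using that ns(2) by (auto simp: strict_mono_on_less)
    then show False by simp
  qed
  have ns_less: "ns i < ns (Suc i)" if "i < l" for i
    using ns(2) that by (auto simp: strict_mono_on_less)
  have gap: "osc_gap q c (t i) \<epsilon> (n + 1 - ns i) (ns (Suc i) - ns i)" if i: "i < l" for i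
  proof -
    interpret I: osc_int q c "t i" \<epsilon> "n + 1 - ns i" using int i by simp
    show ?thesis
    proof unfold_locales
      show "I.S (ns (Suc i) - ns i) = 0"
        using shift[of i "ns (Suc i) - ns i"] Sns[of "Suc i"] ns_less[OF i] i by simp
      show "I.S j \<noteq> 0" if "0 < j" "j < ns (Suc i) - ns i" for j
        using shift[of i j] between[OF i, of "ns i + j"] that i by simp
    qed (use ns_less[OF i] ns_le[of "Suc i"] i in auto)
  qed
  have after: "osc_int.S q c (t l) j \<noteq> 0" if "0 < j" "j \<le> n + 1 - ns l" for j
  proof
    assume "osc_int.S q c (t l) j = 0"
    then have "R.S (ns l + j) = 0" by (simp add: shift)
    moreover have "ns l + j \<le> n + 1" using that ns_le[of l] by simp
    ultimately obtain k where "k \<le> l" "ns l + j = ns k" using zeros by auto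
    then show False using ns(2) that by (metis atMost_iff le_add1 le_antisym less_add_same_cancel1 nat_less_le order_refl strict_mono_on_leD)
  qed
  have sing: "P.singular r (t i) (R.vvec (ns i))" if "i \<le> l" for i
    unfolding t_eq by (rule R.singular_vvec[OF ns_le[OF that] Sns[OF that]])
  have embeddings: "\<forall>i\<le>l. \<exists>f. lmod_embedding (osc q C0) (osc_verma q C0 (t i)) (osc_verma q C0 r) f"
    using P.embedding_exists[OF r0 t0 sing R.vvec_neq_0] by (simp add: c)
  have part3: "\<exists>(N::nat) s. N > 0 \<and> (s = q powi (- int N) \<or> s = - (q powi (- int N))) \<and>
     lmod_iso (osc q C0) (submod (osc_verma q C0 (t l)) (osc_verma_max q C0 (t l))) (osc_verma q C0 s)"
    if "\<not> simple_module (osc q C0) (osc_verma q C0 (t l))"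
  proof -
    interpret I: osc_int q c "t l" \<epsilon> "n + 1 - ns l" by (rule int) simp
    have "\<exists>D>n + 1 - ns l. lmod_iso (osc q C0)
      (submod (osc_verma q C0 (t l)) (osc_verma_max q C0 (t l))) (osc_verma q C0 (t l * inverse q ^ D))"
      by (rule I.maximal_is_Verma[folded c]) (use after that in blast)+
    then obtain D where D: "D > n + 1 - ns l"
      "lmod_iso (osc q C0) (submod (osc_verma q C0 (t l)) (osc_verma_max q C0 (t l))) (osc_verma q C0 (t l * inverse q ^ D))"
      by blast
    define N where "N = ns l + D - n"
    have N: "ns l + D = n + N" "N > 0" using D(1) ns_le[of l] by (auto simp: N_def)
    have "t l * inverse q ^ D = \<epsilon> * (q ^ n * inverse q ^ n) * inverse q ^ N"
      by (simp add: t_eq eps(2) mult.assoc flip: power_add) (simp add: N(1) power_add mult_ac)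
    then have "t l * inverse q ^ D = \<epsilon> * q powi (- int N)" using q(1) by (simp add: powi power_inverse)
    then have "t l * inverse q ^ D = q powi (- int N) \<or> t l * inverse q ^ D = - (q powi (- int N))"
      using eps(1) by auto
    then show ?thesis using D(2) N(2) by blast
  qed
  have part4: "finite_dimensional (restrict_scalars (\<lambda>c. cls (osc_rels q C0) (scal c)) (osc_simple q C0 (t i)))"
    if "i < l" for i
    using osc_gap.simple_finite_dimensional[OF gap[OF that]] by (simp add: c)
  obtain \<pi> where \<pi>: "P.vmodel r \<pi>" using P.vmodel_exists[OF r0] by blast
  have main: "(\<exists>S. internal_direct_sum (uq q)
               (restrict_scalars (uq_to_osc q C0) (osc_verma q C0 r)) {..ns l} S \<and>
             (\<forall>i<ns l. lmod_iso (uq q)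
               (submod (restrict_scalars (uq_to_osc q C0) (osc_verma q C0 r)) (S i))
               (uq_verma q (q powi (- int i) * r))) \<and>
             S (ns l) = Z l) \<and>
        (\<forall>i\<le>l. submodule (Z i) (osc q C0) (osc_verma q C0 r)) \<and>
        (\<forall>i\<le>l. submodule (W i) (osc q C0) (osc_verma q C0 r)) \<and>
        Z 0 = carrier (osc_verma q C0 r) \<and>
        (\<forall>i\<le>l. W i \<subset> Z i) \<and>
        (\<forall>i<l. Z (Suc i) \<subset> W i) \<and>
        (\<forall>i\<le>l. lmod_iso (osc q C0)
          (quotient_module (submod (osc_verma q C0 r) (Z i)) (W i))
          (osc_simple q C0 (t i))) \<and>
        (\<forall>i<l. lmod_iso (osc q C0)
          (quotient_module (submod (osc_verma q C0 r) (W i)) (Z (Suc i)))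
          (osc_simple q C0 (inverse (q ^ 3 * t (Suc i)))))"
    if \<phi>: "\<forall>i\<le>l. lmod_embedding (osc q C0) (osc_verma q C0 (t i)) (osc_verma q C0 r) (\<phi> i)"
      and Z: "\<forall>i. Z i = \<phi> i ` carrier (osc_verma q C0 (t i))"
      and W: "\<forall>i. W i = \<phi> i ` osc_verma_max q C0 (t i)" for \<phi> Z W
  proof -
    have "\<exists>w. P.singular r (t i) w \<and> w \<noteq> 0 \<and> Z i = range (\<lambda>x. \<pi> (x * w)) \<and> W i = (\<lambda>x. \<pi> (x * w)) ` P.max_submod (t i)"
      if i: "i \<le> l" for i
    proof -
      obtain \<pi>' where \<pi>': "P.vmodel (t i) \<pi>'" using P.vmodel_exists[OF t0] by blast
      obtain w where w: "P.singular r (t i) w" "w \<noteq> 0" "\<And>x. \<phi> i (\<pi>' x) = \<pi> (x * w)"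
        using P.embedding_singular[OF r0 t0 \<pi> \<pi>', folded c] \<phi> i by metis
      moreover have "Z i = range (\<lambda>x. \<pi> (x * w))"
        using Z P.vmodelD(3)[OF \<pi>', folded c] by (simp add: image_image w(3))
      moreover have "W i = (\<lambda>x. \<pi> (x * w)) ` P.max_submod (t i)"
        using W P.osc_verma_max_eq[OF t0 \<pi>', folded c] by (simp add: image_image w(3))
      ultimately show ?thesis by blast
    qed
    then obtain w where w: "\<And>i. i \<le> l \<Longrightarrow> P.singular r (t i) (w i)" "\<And>i. i \<le> l \<Longrightarrow> w i \<noteq> 0"
      and Zi: "\<And>i. i \<le> l \<Longrightarrow> Z i = range (\<lambda>x. \<pi> (x * w i))"
      and Wi: "\<And>i. i \<le> l \<Longrightarrow> W i = (\<lambda>x. \<pi> (x * w i)) ` P.max_submod (t i)" by metis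
    have inj: "\<pi> x = \<pi> y \<longleftrightarrow> x = y" for x y by (rule P.vmodelD(2)[OF \<pi>])
    have vvec_multiple: "\<exists>\<gamma>. \<gamma> \<noteq> 0 \<and> v = scP \<gamma> (R.vvec (ns i))" if "i \<le> l" "P.singular r (t i) v" "v \<noteq> 0" for i v
      using R.singular_unique[OF that(2)[unfolded t_eq] ns_le[OF that(1)]] that(3) by auto
    have range_scP: "range (\<lambda>x. \<pi> (x * scP \<gamma> v)) = range (\<lambda>x. \<pi> (x * v))" if "\<gamma> \<noteq> 0" for \<gamma> and v :: "'k poly poly"
    proof -
      have "x * scP \<gamma> v = scP \<gamma> x * v" "x * v = scP (inverse \<gamma>) x * scP \<gamma> v" for x
        using that by (simp_all add: scP_cst)
      note e = this
      show ?thesis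
      proof (intro subset_antisym image_subsetI)
        show "\<pi> (x * scP \<gamma> v) \<in> range (\<lambda>x. \<pi> (x * v))" for x unfolding e(1) by blast
        show "\<pi> (x * v) \<in> range (\<lambda>x. \<pi> (x * scP \<gamma> v))" for x unfolding e(2) by blast
      qed
    qed
    have Z_vvec: "Z i = range (\<lambda>x. \<pi> (x * R.vvec (ns i)))" if "i \<le> l" for i
    proof -
      note i = that
      obtain \<gamma> where \<gamma>: "\<gamma> \<noteq> 0" "w i = scP \<gamma> (R.vvec (ns i))"
        using vvec_multiple[OF i w(1,2)[OF i]] by blast
      show ?thesis unfolding Zi[OF that] \<gamma>(2) by (rule range_scP[OF \<gamma>(1)])
    qed
    have Z0: "Z 0 = carrier (osc_verma q C0 r)"
      using Z_vvec[of 0] P.vmodelD(3)[OF \<pi>, folded c] by (simp add: ns(1))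
    have model_Z: "models scP (osc_op q c (t i)) (osc_rels q C0) UNIV {0} (\<lambda>x. \<pi> (x * w i)) (submod (osc_verma q C0 r) (Z i))"
      and model_W: "models scP (osc_op q c (t i)) (osc_rels q C0) (P.max_submod (t i)) {0} (\<lambda>x. \<pi> (x * w i)) (submod (osc_verma q C0 r) (W i))"
      if "i \<le> l" for i
      using P.models_generated[OF r0 t0 w(1,2)[OF that] \<pi> stable_UNIV]
        P.models_generated[OF r0 t0 w(1,2)[OF that] \<pi> P.stable_max_submod] that
      by (simp_all add: Zi Wi c)
    have sub: "submodule (Z i) (osc q C0) (osc_verma q C0 r)" "submodule (W i) (osc q C0) (osc_verma q C0 r)"
      if "i \<le> l" for i
      using P.submodule_generated[OF r0 t0 w(1)[OF that] \<pi> stable_UNIV]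
        P.submodule_generated[OF r0 t0 w(1)[OF that] \<pi> P.stable_max_submod] that
      by (simp_all add: Zi Wi c)
    have strict: "W i \<subset> Z i" if i: "i \<le> l" for i
    proof -
      have "\<pi> (1 * w i) \<notin> W i" using P.one_notin_max_submod[of "t i"] w(2)[OF i] by (auto simp: Wi[OF i] inj)
      moreover have "\<pi> (1 * w i) \<in> Z i" "W i \<subseteq> Z i" unfolding Zi[OF i] Wi[OF i] by blast+
      ultimately show ?thesis by blast
    qed
    have Z_Suc: "Z (Suc i) = (\<lambda>x. \<pi> (x * w i)) ` osc_gap.next_verma q c (t i) (ns (Suc i) - ns i)" if i: "i < l" for i
    proof -
      interpret G: osc_gap q c "t i" \<epsilon> "n + 1 - ns i" "ns (Suc i) - ns i" by (rule gap[OF i])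
      let ?d = "ns (Suc i) - ns i"
      have tS: "t i * inverse q ^ ?d = t (Suc i)"
        using ns_less[OF i] by (simp add: t_eq mult.assoc flip: power_add)
      have "P.singular r (t (Suc i)) (G.vvec ?d * w i)"
        using P.singular_trans[OF r0 t0 w(1) G.singular_vvec[OF G.d_le G.S_d]] i by (simp add: tS)
      moreover have "G.vvec ?d * w i \<noteq> 0" using w(2)[of i] i G.vvec_neq_0 by simp
      ultimately have "\<exists>\<gamma>. \<gamma> \<noteq> 0 \<and> G.vvec ?d * w i = scP \<gamma> (R.vvec (ns (Suc i)))"
        using i by (intro vvec_multiple) auto
      then obtain \<gamma> where \<gamma>: "\<gamma> \<noteq> 0" "G.vvec ?d * w i = scP \<gamma> (R.vvec (ns (Suc i)))" by blast
      have "range (\<lambda>x. \<pi> (x * (G.vvec ?d * w i))) = range (\<lambda>x. \<pi> (x * R.vvec (ns (Suc i))))"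
        unfolding \<gamma>(2) by (rule range_scP[OF \<gamma>(1)])
      then have "Z (Suc i) = range (\<lambda>x. \<pi> (x * (G.vvec ?d * w i)))"
        using Z_vvec[of "Suc i"] i by simp
      then show ?thesis by (simp add: G.next_verma_def image_image mult.assoc)
    qed
    have Z_Suc_W: "Z (Suc i) \<subset> W i" if i: "i < l" for i
    proof -
      interpret G: osc_gap q c "t i" \<epsilon> "n + 1 - ns i" "ns (Suc i) - ns i" by (rule gap[OF i])
      have "\<pi> (G.u * w i) \<notin> Z (Suc i)" using G.u_notin_next_verma w(2)[of i] i by (auto simp: Z_Suc inj)
      moreover have "\<pi> (G.u * w i) \<in> W i" unfolding Wi[OF less_imp_le[OF i]] using G.u_max_submod by blast
      moreover have "Z (Suc i) \<subseteq> W i" unfolding Wi[OF less_imp_le[OF i]] Z_Suc[OF i] using G.next_verma_max_submod by blast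
      ultimately show ?thesis by blast
    qed
    have iso1: "lmod_iso (osc q C0) (quotient_module (submod (osc_verma q C0 r) (Z i)) (W i)) (osc_simple q C0 (t i))"
      if i: "i \<le> l" for i
    proof -
      note MQ = models_quotient[OF model_Z[OF i] P.stable_max_submod, folded Wi[OF i]]
      obtain \<pi>' where M': "models scP (osc_op q c (t i)) (osc_rels q C0) UNIV (P.max_submod (t i)) \<pi>' (osc_simple q C0 (t i))"
        using P.models_osc_simple[OF t0, folded c] by blast
      have "lmod_iso (presented (osc_rels q C0)) (quotient_module (submod (osc_verma q C0 r) (Z i)) (W i)) (osc_simple q C0 (t i))"
        by (rule conjunct1[OF models_iso[OF MQ M', of "\<lambda>x. x"]])
          (use stableD(1)[OF P.stable_max_submod] in \<open>auto intro!: exI[where P="\<lambda>x. y - x \<in> B" and x=y for y B]\<close>)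
      then show ?thesis by (simp add: osc_def)
    qed
    have iso2: "lmod_iso (osc q C0) (quotient_module (submod (osc_verma q C0 r) (W i)) (Z (Suc i)))
          (osc_simple q C0 (inverse (q ^ 3 * t (Suc i))))" if i: "i < l" for i
    proof -
      interpret G: osc_gap q c "t i" \<epsilon> "n + 1 - ns i" "ns (Suc i) - ns i" by (rule gap[OF i])
      have tS: "t i * inverse q ^ (ns (Suc i) - ns i) = t (Suc i)"
        using ns_less[OF i] by (simp add: t_eq mult.assoc flip: power_add)
      note MQ = models_quotient[OF model_W[OF less_imp_le[OF i]] G.stable_next_verma _ G.next_verma_max_submod, folded Z_Suc[OF i]]
      have "lmod_iso (osc q C0) (quotient_module (submod (osc_verma q C0 r) (W i)) (Z (Suc i))) (osc_simple q C0 G.u_weight)"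
        using G.gap_quotient_iso[folded c, OF MQ] stableD(1)[OF G.stable_next_verma] by simp
      then show ?thesis unfolding G.u_weight_eq tS .
    qed
    define S where "S i = \<pi> ` (if i < ns l then (\<lambda>f. f * R.vvec i) ` Ylt 1 else range (\<lambda>y. y * R.vvec (ns l)))" for i
    note dsum = R.restricted_direct_sum[OF \<pi> ns_le[OF order_refl] Sns[OF order_refl], folded c S_def]
    have part1: "\<exists>S. internal_direct_sum (uq q)
               (restrict_scalars (uq_to_osc q C0) (osc_verma q C0 r)) {..ns l} S \<and>
             (\<forall>i<ns l. lmod_iso (uq q)
               (submod (restrict_scalars (uq_to_osc q C0) (osc_verma q C0 r)) (S i))
               (uq_verma q (q powi (- int i) * r))) \<and>
             S (ns l) = Z l"
    proof (intro exI[of _ S] conjI allI impI)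
      show "internal_direct_sum (uq q) (restrict_scalars (uq_to_osc q C0) (osc_verma q C0 r)) {..ns l} S"
        by (rule dsum(1))
      show "lmod_iso (uq q) (submod (restrict_scalars (uq_to_osc q C0) (osc_verma q C0 r)) (S i))
               (uq_verma q (q powi (- int i) * r))" if "i < ns l" for i
        using dsum(2)[OF that] by (simp add: powi mult.commute)
      show "S (ns l) = Z l" using Z_vvec[of l] by (simp add: S_def image_image)
    qed
    show ?thesis
      by (intro conjI allI impI; (rule part1 | rule Z0 | erule sub(1) | erule sub(2) | erule strict
            | erule Z_Suc_W | erule iso1 | erule iso2))
  qed
  show ?thesis
    by (intro conjI; (rule embeddings | intro allI impI; elim conjE; rule main; assumption
          | rule impI; erule part3 | intro allI impI; erule part4))
qed

end
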